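(* Let $\mathcal V$ be a finite-dimensional linear subspace of $(L^2(\Omega))^d$. Let $f\in L^2(\Omega)$, let $w\in H^2(\Omega)\cap H^1_0(\Omega)$ satisfy $-\Delta w=f$, let $u\in H^1_0(\Omega)$ be the solution of $$\int_\Omega(\nabla\varphi)^Ta\nabla u=\int_\Omega(\nabla\varphi)^T\nabla w\qquad\text{for all }\varphi\in H^1_0(\Omega),$$ and let $\zeta_{\mathcal V}\in\mathcal V$ be the solution of $$\int_\Omega\eta^Ta\,\zeta_{\mathcal V}=\int_\Omega\eta^T\nabla w\qquad\text{for all }\eta\in\mathcal V.$$ Define $$\mathcal K_{\mathcal V}:=\sup_{\zeta\in\mathcal V\setminus\{0\}}\frac{\|\zeta_{curl}\|_{(L^2(\Omega))^d}}{\|\zeta\|_{(L^2(\Omega))^d}},$$ $$\mathcal D_{\mathcal V}:=\inf_{a',\mathcal V'\,:\,\operatorname{div}(a'\mathcal V')=\operatorname{div}(a\mathcal V)}\ \sup_{w'\in H^2(\Omega)\cap H^1_0(\Omega)}\ \inf_{\zeta'\in\mathcal V'}\frac{\|(a'(\nabla u'-\zeta'))_{pot}\|_{(L^2(\Omega))^d}}{\|\Delta w'\|_{L^2(\Omega)}},$$ where the first infimum is over all finite-dimensional linear subspaces $\mathcal V'\subset(L^2(\Omega))^d$ and all bounded uniformly elliptic matrices $a'$ ($a'_{ij}\in L^\infty(\Omega)$) with $\operatorname{div}(a'\mathcal V')=\operatorname{div}(a\mathcal V)$, the supremum is over $w'\neq0$, and $u'\in H_0^1(\Omega)$ is the weak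 solution of $\operatorname{div}(a'\nabla u')=\Delta w'$ with zero Dirichlet boundary condition on $\partial\Omega$. Then there exists a constant $C^*>0$ depending only on $\lambda_{\min}(a)$ and $\lambda_{\max}(a)$ such that, for $\mathcal K_{\mathcal V}\le C^*$, $$\|\nabla u-\zeta_{\mathcal V}\|_{(L^2(\Omega))^d}\le C\,\|f\|_{L^2(\Omega)}\big(\mathcal D_{\mathcal V}+\mathcal K_{\mathcal V}\big),$$ where $C$ is a constant depending only on $\lambda_{\min}(a)$ and $\lambda_{\max}(a)$.
   Context: $\Omega\subset\mathbb{R}^d$ ($d\ge2$) is a bounded domain with smooth (e.g. $C^2$) boundary. The matrix $a=(a_{ij})$ has $a_{ij}\in L^\infty(\Omega)$, is symmetric, and is uniformly elliptic: $\lambda_{\min}(a)|\xi|^2\le\xi^Ta(x)\xi\le\lambda_{\max}(a)|\xi|^2$ for all $\xi\in\mathbb{R}^d$ and $x\in\Omega$, with $0<\lambda_{\min}(a)\le\lambda_{\max}(a)<\infty$. For $k\in(L^2(\Omega))^d$, $k=k_{pot}+k_{curl}$ is the Weyl–Helmholtz decomposition: $k_{pot}$ is the $L^2$-orthogonal projection of $k$ onto the closure of $\{\nabla g: g\in C_0^\infty(\Omega)\}$ in $(L^2(\Omega))^d$, and $k_{curl}=k-k_{pot}$ is the orthogonal (divergence-free) part. For a finite-dimensional $\mathcal V\subset(L^2(\Omega))^d$, $\operatorname{div}(a\mathcal V):=\{\operatorname{div}(a\zeta):\zeta\in\mathcal V\}\subset H^{-1}(\Omega)$.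
   Formalization: The constant C may also depend on the fixed domain Ω (and d), not only on λ_min(a) and λ_max(a); a C independent of Ω is impossible, since D_V scales like a length while K_V is scale invariant. C* does not depend on Ω. *)

theory Defs
  imports "HOL-Analysis.Analysis"
begin

section \<open>Smooth functions and domains\<close>

definition partial :: "'n \<Rightarrow> (real^'n::finite \<Rightarrow> real) \<Rightarrow> (real^'n \<Rightarrow> real)" where
  "partial i f = (\<lambda>x. frechet_derivative f (at x) (axis i 1))"

definition grad :: "(real^'n::finite \<Rightarrow> real) \<Rightarrow> (real^'n \<Rightarrow> real^'n)" where
  "grad f = (\<lambda>x. \<chi> i. partial i f x)"

fun iter_partial :: "'n list \<Rightarrow> (real^'n::finite \<Rightarrow> real) \<Rightarrow> (real^'n \<Rightarrow> real)" where
  "iter_partial [] f = f"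
| "iter_partial (i # is) f = partial i (iter_partial is f)"

text \<open>The value of a Frechet derivative is meaningful only at points of differentiability, so
  differentiability of the derivatives of order below \<open>k\<close> is required explicitly.
  The set \<open>U\<close> is meant to be open.\<close>

definition Ck_on :: "nat \<Rightarrow> (real^'n::finite) set \<Rightarrow> (real^'n \<Rightarrow> real) \<Rightarrow> bool" where
  "Ck_on k U f \<longleftrightarrow>
     (\<forall>is. length is < k \<longrightarrow> (\<forall>x\<in>U. iter_partial is f differentiable (at x))) \<and>
     (\<forall>is. length is \<le> k \<longrightarrow> continuous_on U (iter_partial is f))"

definition test_functions :: "(real^'n::finite) set \<Rightarrow> (real^'n \<Rightarrow> real) set" where
  "test_functions \<Omega> = {\<phi>. (\<forall>k. Ck_on k UNIV \<phi>) \<and>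
     compact (closure {x. \<phi> x \<noteq> 0}) \<and> closure {x. \<phi> x \<noteq> 0} \<subseteq> \<Omega>}"

text \<open>A bounded domain lying locally on one side of its boundary, which is locally the regular
  zero level set of a \<open>C\<^sup>2\<close> function.\<close>

definition bounded_C2_domain :: "(real^'n::finite) set \<Rightarrow> bool" where
  "bounded_C2_domain \<Omega> \<longleftrightarrow> open \<Omega> \<and> connected \<Omega> \<and> \<Omega> \<noteq> {} \<and> bounded \<Omega> \<and>
     (\<forall>p\<in>frontier \<Omega>. \<exists>r>0. \<exists>\<psi>. Ck_on 2 (ball p r) \<psi> \<and> grad \<psi> p \<noteq> 0 \<and>
        \<Omega> \<inter> ball p r = {x \<in> ball p r. \<psi> x < 0})"

section \<open>Lebesgue and Sobolev spaces\<close>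

text \<open>Elements of \<open>L\<^sup>2(\<Omega>)\<close> are represented by functions on the whole space; only their
  restriction to \<open>\<Omega>\<close>, up to null sets, is relevant.\<close>

definition L2 :: "(real^'n::finite) set \<Rightarrow> (real^'n \<Rightarrow> 'b::euclidean_space) set" where
  "L2 \<Omega> = {f. f \<in> borel_measurable (lebesgue_on \<Omega>) \<and>
              integrable (lebesgue_on \<Omega>) (\<lambda>x. (norm (f x))\<^sup>2)}"

definition l2norm :: "(real^'n::finite) set \<Rightarrow> (real^'n \<Rightarrow> 'b::euclidean_space) \<Rightarrow> real" where
  "l2norm \<Omega> f = sqrt (\<integral>x. (norm (f x))\<^sup>2 \<partial>lebesgue_on \<Omega>)"

definition l2inner ::
  "(real^'n::finite) set \<Rightarrow> (real^'n \<Rightarrow> 'b::euclidean_space) \<Rightarrow> (real^'n \<Rightarrow> 'b) \<Rightarrow> real" where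
  "l2inner \<Omega> f g = (\<integral>x. f x \<bullet> g x \<partial>lebesgue_on \<Omega>)"

definition ae_zero :: "(real^'n::finite) set \<Rightarrow> (real^'n \<Rightarrow> 'b::euclidean_space) \<Rightarrow> bool" where
  "ae_zero \<Omega> f \<longleftrightarrow> (AE x in lebesgue_on \<Omega>. f x = 0)"

definition is_weak_partial ::
  "(real^'n::finite) set \<Rightarrow> 'n \<Rightarrow> (real^'n \<Rightarrow> real) \<Rightarrow> (real^'n \<Rightarrow> real) \<Rightarrow> bool" where
  "is_weak_partial \<Omega> i u v \<longleftrightarrow>
     (\<forall>\<phi>\<in>test_functions \<Omega>. l2inner \<Omega> u (partial i \<phi>) = - l2inner \<Omega> v \<phi>)"

text \<open>The weak derivative is determined only almost everywhere; a representative is chosen.\<close>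

definition wpartial ::
  "(real^'n::finite) set \<Rightarrow> 'n \<Rightarrow> (real^'n \<Rightarrow> real) \<Rightarrow> (real^'n \<Rightarrow> real)" where
  "wpartial \<Omega> i u = (SOME v. v \<in> L2 \<Omega> \<and> is_weak_partial \<Omega> i u v)"

definition wgrad ::
  "(real^'n::finite) set \<Rightarrow> (real^'n \<Rightarrow> real) \<Rightarrow> (real^'n \<Rightarrow> real^'n)" where
  "wgrad \<Omega> u = (\<lambda>x. \<chi> i. wpartial \<Omega> i u x)"

definition wlaplacian ::
  "(real^'n::finite) set \<Rightarrow> (real^'n \<Rightarrow> real) \<Rightarrow> (real^'n \<Rightarrow> real)" where
  "wlaplacian \<Omega> u = (\<lambda>x. \<Sum>i\<in>UNIV. wpartial \<Omega> i (wpartial \<Omega> i u) x)"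

definition H1 :: "(real^'n::finite) set \<Rightarrow> (real^'n \<Rightarrow> real) set" where
  "H1 \<Omega> = {u \<in> L2 \<Omega>. \<forall>i. \<exists>v\<in>L2 \<Omega>. is_weak_partial \<Omega> i u v}"

definition H2 :: "(real^'n::finite) set \<Rightarrow> (real^'n \<Rightarrow> real) set" where
  "H2 \<Omega> = {u \<in> H1 \<Omega>. \<forall>i. wpartial \<Omega> i u \<in> H1 \<Omega>}"

text \<open>The closure of the test functions in the norm of \<open>H\<^sup>1(\<Omega>)\<close>.\<close>

definition H10 :: "(real^'n::finite) set \<Rightarrow> (real^'n \<Rightarrow> real) set" where
  "H10 \<Omega> = {u \<in> H1 \<Omega>. \<forall>e>0. \<exists>\<phi>\<in>test_functions \<Omega>.
      l2norm \<Omega> (\<lambda>x. u x - \<phi> x) < e \<and> l2norm \<Omega> (\<lambda>x. wgrad \<Omega> u x - grad \<phi> x) < e}"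

text \<open>The distributional divergence of an \<open>L\<^sup>2\<close> vector field, as an element of \<open>H\<^sup>-\<^sup>1(\<Omega>)\<close>,
  that is, a functional on \<open>H\<^sup>1\<^sub>0(\<Omega>)\<close>.  It is set to 0 off \<open>H\<^sup>1\<^sub>0(\<Omega>)\<close> so that equality of
  HOL functions is equality in \<open>H\<^sup>-\<^sup>1(\<Omega>)\<close>.\<close>

definition wdiv ::
  "(real^'n::finite) set \<Rightarrow> (real^'n \<Rightarrow> real^'n) \<Rightarrow> ((real^'n \<Rightarrow> real) \<Rightarrow> real)" where
  "wdiv \<Omega> k = (\<lambda>\<phi>. if \<phi> \<in> H10 \<Omega> then - l2inner \<Omega> (wgrad \<Omega> \<phi>) k else 0)"

section \<open>Weyl--Helmholtz decomposition\<close>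

definition pot_space :: "(real^'n::finite) set \<Rightarrow> (real^'n \<Rightarrow> real^'n) set" where
  "pot_space \<Omega> = {k \<in> L2 \<Omega>. \<forall>e>0. \<exists>g\<in>test_functions \<Omega>. l2norm \<Omega> (\<lambda>x. k x - grad g x) < e}"

definition pot_part ::
  "(real^'n::finite) set \<Rightarrow> (real^'n \<Rightarrow> real^'n) \<Rightarrow> (real^'n \<Rightarrow> real^'n)" where
  "pot_part \<Omega> k = (SOME p. p \<in> pot_space \<Omega> \<and>
      (\<forall>q\<in>pot_space \<Omega>. l2inner \<Omega> (\<lambda>x. k x - p x) q = 0))"

definition curl_part ::
  "(real^'n::finite) set \<Rightarrow> (real^'n \<Rightarrow> real^'n) \<Rightarrow> (real^'n \<Rightarrow> real^'n)" where
  "curl_part \<Omega> k = (\<lambda>x. k x - pot_part \<Omega> k x)"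

section \<open>Coefficients and approximation spaces\<close>

definition Linf_matrix :: "(real^'n::finite) set \<Rightarrow> (real^'n \<Rightarrow> real^'n^'n) \<Rightarrow> bool" where
  "Linf_matrix \<Omega> a \<longleftrightarrow> (\<forall>i j. (\<lambda>x. a x $ i $ j) \<in> borel_measurable (lebesgue_on \<Omega>) \<and>
     (\<exists>B. AE x in lebesgue_on \<Omega>. \<bar>a x $ i $ j\<bar> \<le> B))"

definition elliptic_with ::
  "(real^'n::finite) set \<Rightarrow> real \<Rightarrow> real \<Rightarrow> (real^'n \<Rightarrow> real^'n^'n) \<Rightarrow> bool" where
  "elliptic_with \<Omega> lmin lmax a \<longleftrightarrow> 0 < lmin \<and> lmin \<le> lmax \<and>
     (\<forall>x\<in>\<Omega>. \<forall>\<xi>. lmin * (norm \<xi>)\<^sup>2 \<le> \<xi> \<bullet> (a x *v \<xi>) \<and> \<xi> \<bullet> (a x *v \<xi>) \<le> lmax * (norm \<xi>)\<^sup>2)"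

definition mult_field ::
  "(real^'n::finite \<Rightarrow> real^'n^'n) \<Rightarrow> (real^'n \<Rightarrow> real^'n) \<Rightarrow> (real^'n \<Rightarrow> real^'n)" where
  "mult_field a k = (\<lambda>x. a x *v k x)"

text \<open>A finite-dimensional linear subspace of \<open>(L\<^sup>2(\<Omega>))\<^sup>d\<close>, given as the set of all
  representatives of its elements; hence it is closed under changes on null sets, and it is
  spanned by finitely many fields up to such changes.\<close>

definition findim_subspace ::
  "(real^'n::finite) set \<Rightarrow> (real^'n \<Rightarrow> real^'n) set \<Rightarrow> bool" where
  "findim_subspace \<Omega> V \<longleftrightarrow> V \<subseteq> L2 \<Omega> \<and> (\<lambda>x. 0) \<in> V \<and>
     (\<forall>k\<in>V. \<forall>l\<in>V. (\<lambda>x. k x + l x) \<in> V) \<and>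
     (\<forall>c. \<forall>k\<in>V. (\<lambda>x. c *\<^sub>R k x) \<in> V) \<and>
     (\<forall>k\<in>V. \<forall>l\<in>L2 \<Omega>. (AE x in lebesgue_on \<Omega>. l x = k x) \<longrightarrow> l \<in> V) \<and>
     (\<exists>B. finite B \<and> B \<subseteq> V \<and>
        (\<forall>k\<in>V. \<exists>c. AE x in lebesgue_on \<Omega>. k x = (\<Sum>b\<in>B. c b *\<^sub>R b x)))"

definition div_space ::
  "(real^'n::finite) set \<Rightarrow> (real^'n \<Rightarrow> real^'n^'n) \<Rightarrow> (real^'n \<Rightarrow> real^'n) set
     \<Rightarrow> ((real^'n \<Rightarrow> real) \<Rightarrow> real) set" where
  "div_space \<Omega> a V = (\<lambda>\<zeta>. wdiv \<Omega> (mult_field a \<zeta>)) ` V"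

text \<open>The extrema are taken in \<open>ennreal\<close>; in particular \<open>K_const \<Omega> V = 0\<close> if \<open>V\<close> is trivial.\<close>

definition K_const :: "(real^'n::finite) set \<Rightarrow> (real^'n \<Rightarrow> real^'n) set \<Rightarrow> ennreal" where
  "K_const \<Omega> V = (SUP \<zeta>\<in>{\<zeta>\<in>V. \<not> ae_zero \<Omega> \<zeta>}.
     ennreal (l2norm \<Omega> (curl_part \<Omega> \<zeta>) / l2norm \<Omega> \<zeta>))"

definition weak_solution ::
  "(real^'n::finite) set \<Rightarrow> (real^'n \<Rightarrow> real^'n^'n) \<Rightarrow> (real^'n \<Rightarrow> real) \<Rightarrow> (real^'n \<Rightarrow> real) \<Rightarrow> bool"
  where \<comment> \<open>\<open>u\<close> vanishes on the boundary and \<open>div (a \<nabla>u) = g\<close>\<close>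
  "weak_solution \<Omega> a g u \<longleftrightarrow> u \<in> H10 \<Omega> \<and>
     (\<forall>\<phi>\<in>H10 \<Omega>. l2inner \<Omega> (wgrad \<Omega> \<phi>) (mult_field a (wgrad \<Omega> u)) = - l2inner \<Omega> \<phi> g)"

text \<open>For given \<open>a'\<close> and \<open>w'\<close> the function \<open>u'\<close> is determined almost everywhere, so the
  supremum over the pairs \<open>(w', u')\<close> is a supremum over \<open>w'\<close>.\<close>

definition D_const ::
  "(real^'n::finite) set \<Rightarrow> (real^'n \<Rightarrow> real^'n^'n) \<Rightarrow> (real^'n \<Rightarrow> real^'n) set \<Rightarrow> ennreal" where
  "D_const \<Omega> a V =
     (INF (a', V') \<in> {(a', V'). Linf_matrix \<Omega> a' \<and> (\<exists>lmin lmax. elliptic_with \<Omega> lmin lmax a') \<and>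
                         findim_subspace \<Omega> V' \<and> div_space \<Omega> a' V' = div_space \<Omega> a V}.
      SUP (w', u') \<in> {(w', u'). w' \<in> H2 \<Omega> \<inter> H10 \<Omega> \<and> \<not> ae_zero \<Omega> w' \<and>
                         weak_solution \<Omega> a' (wlaplacian \<Omega> w') u'}.
      INF \<zeta>'\<in>V'. ennreal
        (l2norm \<Omega> (pot_part \<Omega> (mult_field a' (\<lambda>x. wgrad \<Omega> u' x - \<zeta>' x)))
           / l2norm \<Omega> (wlaplacian \<Omega> w')))"

end

theory Submission
  imports Defs "HOL-Library.Function_Algebras" "HOL-Computational_Algebra.Polynomial"
begin

text \<open>Let \<open>a'\<close>, \<open>V'\<close> compete in the infimum defining \<open>D_const\<close>, let \<open>u'\<close> solve \<open>div (a' \<nabla>u') = \<Delta>w\<close> (Lax--Milgram,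
  since \<open>a'\<close> need not be symmetric), and let \<open>\<zeta>' \<in> V'\<close>. Choose \<open>\<zeta> \<in> V\<close> with \<open>div (a \<zeta>) = div (a' \<zeta>')\<close>.
  The fields \<open>a \<nabla>u\<close> and \<open>a' \<nabla>u'\<close> have the same potential part \<open>\<nabla>w\<close>, hence
  \<open>(a (\<nabla>u - \<zeta>))\<^sub>p\<^sub>o\<^sub>t = (a' (\<nabla>u' - \<zeta>'))\<^sub>p\<^sub>o\<^sub>t\<close>. By ellipticity this controls \<open>\<nabla>u - \<zeta>\<close> up to the curl part of \<open>\<zeta>\<close>,
  and a perturbed form of Cea's lemma passes from \<open>\<zeta>\<close> to the Galerkin solution. The estimate holds for
  every \<open>\<zeta>'\<close>, so the extrema in \<open>D_const\<close> need not be attained.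

  On the analytic side, the \<open>L\<^sup>2\<close> closure of the gradients of test functions must be shown to consist of
  weak gradients of functions in \<open>H\<^sup>1\<^sub>0\<close>: this uses completeness of \<open>L\<^sup>2\<close>, the Poincare inequality and
  uniqueness of weak derivatives.\<close>

section \<open>Semi-inner product spaces\<close>

text \<open>Fields in V need not be gradients, so the equation for u cannot be tested with them:
  Galerkin orthogonality fails by a term that sees only the curl part of the test field, of relative
  size at most K. Keeping the coefficient \<open>L * K\<close> of this perturbation below
  \<open>l / 2\<close> dictates \<open>Cs = lmin / (2 * lmax)\<close>.

  The matrix a should enter the constants only through its ellipticity bounds. Since a is symmetric,
  \<open>ip x (A y)\<close> is a semi-inner product, and Cauchy-Schwarz for it bounds the operator
  by lmax without reference to the bounds on the entries. The ellipticity bounds of a' serve to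
  solve for u' and then disappear, because a' enters the estimate only through the residual.

  The abstract estimate carries K times the norm of grad w. Green's formula and the Poincare
  inequality replace this by the norm of f; here alone the radius R of the domain enters the
  constant.

  Weak derivatives and potential parts are chosen representatives. The arguments therefore run on
  inner products and norms, and equalities are obtained up to null sets or up to norm zero.\<close>

lemma quadratic_bound:
  fixes a b c :: real
  assumes nn: "\<And>t. 0 \<le> a + 2 * t * b + t\<^sup>2 * c"
  shows "b\<^sup>2 \<le> a * c"
proof (cases "c = 0")
  case True
  have "b = 0"
  proof (rule ccontr)
    assume "b \<noteq> 0"
    \<comment> \<open>This choice of t gives the linear polynomial the value -1.\<close>
    then show False using nn[of "- (a + 1) / (2 * b)"] True by (simp add: field_simps)
  qed
  then show ?thesis using True by simp
next
  case False
  have "c \<ge> 0"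
  proof (rule ccontr)
    assume c: "\<not> 0 \<le> c"
    \<comment> \<open>Large enough that \<open>t * (-c)\<close> exceeds
      \<open>1 + |a| + 2 * |b|\<close> while t is at least 1; the quadratic is then negative at
      t.\<close>
    define t where "t = (1 + \<bar>a\<bar> + 2*\<bar>b\<bar>) / (- c) + 1"
    have t1: "t \<ge> 1" using c unfolding t_def by (simp add: divide_nonneg_pos divide_nonneg_neg)
    have ct: "t * (- c) = 1 + \<bar>a\<bar> + 2*\<bar>b\<bar> - c" using c unfolding t_def by (simp add: field_simps)
    have e1: "1 + \<bar>a\<bar> \<le> t * (1 + \<bar>a\<bar>)" using t1 mult_right_mono[of 1 t "1 + \<bar>a\<bar>"] by simp
    have e2: "0 \<le> t * (-c)" using t1 c by (intro mult_nonneg_nonneg) auto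
    have "t\<^sup>2 * (-c) = t * (t * (-c))" by (simp add: power2_eq_square)
    also have "\<dots> = t * (1 + \<bar>a\<bar> + 2*\<bar>b\<bar> - c)" using ct by simp
    also have "\<dots> = t * (1 + \<bar>a\<bar>) + t * (2*\<bar>b\<bar>) + t * (-c)" by (simp add: algebra_simps)
    also have "\<dots> \<ge> (1 + \<bar>a\<bar>) + t * (2*\<bar>b\<bar>) + 0"
      using e1 e2 by linarith
    finally have 1: "t\<^sup>2 * c \<le> - (1 + \<bar>a\<bar>) - t * (2*\<bar>b\<bar>)" by simp
    have "2 * t * b \<le> t * (2*\<bar>b\<bar>)" using t1 by (simp add: mult_left_mono)
    with 1 nn[of t] show False by linarith
  qed
  with False have c: "c > 0" by simp
  have "0 \<le> a + 2 * (- b / c) * b + (- b / c)\<^sup>2 * c" by (rule nn)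
  also have "\<dots> = a - b\<^sup>2 / c" using c by (simp add: power2_eq_square field_simps)
  finally show ?thesis using c by (simp add: field_simps)
qed

text \<open>Elements of \<open>L\<^sup>2\<close> are functions rather than classes, so the inner product is not definite.\<close>

locale semi_inner =
  fixes H :: "'v::real_vector set" and ip :: "'v \<Rightarrow> 'v \<Rightarrow> real"
  assumes subspace_H: "subspace H"
    and ip_add: "x \<in> H \<Longrightarrow> y \<in> H \<Longrightarrow> z \<in> H \<Longrightarrow> ip (x + y) z = ip x z + ip y z"
    and ip_scale: "x \<in> H \<Longrightarrow> z \<in> H \<Longrightarrow> ip (c *\<^sub>R x) z = c * ip x z"
    and ip_commute: "x \<in> H \<Longrightarrow> z \<in> H \<Longrightarrow> ip x z = ip z x"
    and ip_nonneg: "x \<in> H \<Longrightarrow> 0 \<le> ip x x"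
begin

definition nm :: "'v \<Rightarrow> real" where "nm x = sqrt (ip x x)"

lemma H_0 [simp]: "0 \<in> H"
  and H_add [simp]: "x \<in> H \<Longrightarrow> y \<in> H \<Longrightarrow> x + y \<in> H"
  and H_diff [simp]: "x \<in> H \<Longrightarrow> y \<in> H \<Longrightarrow> x - y \<in> H"
  and H_scale [simp]: "x \<in> H \<Longrightarrow> c *\<^sub>R x \<in> H"
  using subspace_H by (auto simp: subspace_def intro: subspace_diff)

lemma H_uminus [simp]: "x \<in> H \<Longrightarrow> - x \<in> H"
  using H_scale[of x "-1"] by simp

lemma ip_diff: "x \<in> H \<Longrightarrow> y \<in> H \<Longrightarrow> z \<in> H \<Longrightarrow> ip (x - y) z = ip x z - ip y z"
  using ip_add[of "x - y" y z] by simp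

lemma ip_add_right: "x \<in> H \<Longrightarrow> y \<in> H \<Longrightarrow> z \<in> H \<Longrightarrow> ip z (x + y) = ip z x + ip z y"
  by (metis H_add ip_add ip_commute)

lemma ip_diff_right: "x \<in> H \<Longrightarrow> y \<in> H \<Longrightarrow> z \<in> H \<Longrightarrow> ip z (x - y) = ip z x - ip z y"
  by (metis H_diff ip_diff ip_commute)

lemma ip_scale_right: "x \<in> H \<Longrightarrow> z \<in> H \<Longrightarrow> ip z (c *\<^sub>R x) = c * ip z x"
  by (metis H_scale ip_commute ip_scale)

lemma ip_zero [simp]: "x \<in> H \<Longrightarrow> ip 0 x = 0" "x \<in> H \<Longrightarrow> ip x 0 = 0"
  using ip_scale[of x x 0] ip_scale_right[of x x 0] by auto

lemmas ip_simps = ip_add ip_diff ip_scale ip_add_right ip_diff_right ip_scale_right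

lemma nm_nonneg [simp]: "x \<in> H \<Longrightarrow> 0 \<le> nm x"
  by (simp add: nm_def ip_nonneg)

lemma nm_sq: "x \<in> H \<Longrightarrow> (nm x)\<^sup>2 = ip x x"
  by (simp add: nm_def ip_nonneg)

lemma nm_zero [simp]: "nm 0 = 0"
  by (simp add: nm_def)

lemma nm_scale: "x \<in> H \<Longrightarrow> nm (c *\<^sub>R x) = \<bar>c\<bar> * nm x"
  by (simp add: nm_def ip_simps real_sqrt_mult flip: mult.assoc)

lemma nm_minus_commute: "x \<in> H \<Longrightarrow> y \<in> H \<Longrightarrow> nm (x - y) = nm (y - x)"
  using nm_scale[of "x - y" "-1"] by simp

lemma ip_quadratic:
  assumes "x \<in> H" "y \<in> H"
  shows "ip (x + t *\<^sub>R y) (x + t *\<^sub>R y) = ip x x + 2 * t * ip x y + t\<^sup>2 * ip y y"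
  using assms by (simp add: ip_simps ip_commute[of y x] power2_eq_square algebra_simps)

lemma ip_cauchy_schwarz_sq:
  assumes "x \<in> H" "y \<in> H"
  shows "(ip x y)\<^sup>2 \<le> ip x x * ip y y"
proof (rule quadratic_bound)
  fix t
  show "0 \<le> ip x x + 2 * t * ip x y + t\<^sup>2 * ip y y"
    using ip_nonneg[of "x + t *\<^sub>R y"] ip_quadratic[of x y t] assms by simp
qed

lemma cauchy_schwarz: "x \<in> H \<Longrightarrow> y \<in> H \<Longrightarrow> \<bar>ip x y\<bar> \<le> nm x * nm y"
  using real_sqrt_le_mono[OF ip_cauchy_schwarz_sq[of x y]] by (simp add: nm_def real_sqrt_mult)

lemma nm_triangle:
  assumes "x \<in> H" "y \<in> H"
  shows "nm (x + y) \<le> nm x + nm y"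
proof (rule power2_le_imp_le)
  have "(nm (x + y))\<^sup>2 = ip x x + 2 * ip x y + ip y y"
    using ip_quadratic[of x y 1] assms by (simp add: nm_sq)
  also have "\<dots> \<le> ip x x + 2 * (nm x * nm y) + ip y y"
    using cauchy_schwarz[of x y] assms by simp
  also have "\<dots> = (nm x + nm y)\<^sup>2"
    using assms by (simp add: power2_sum nm_sq)
  finally show "(nm (x + y))\<^sup>2 \<le> (nm x + nm y)\<^sup>2" .
qed (use assms in simp)

lemma nm_triangle_diff: "x \<in> H \<Longrightarrow> y \<in> H \<Longrightarrow> z \<in> H \<Longrightarrow> nm (x - z) \<le> nm (x - y) + nm (y - z)"
  using nm_triangle[of "x - y" "y - z"] by simp

text \<open>Pythagoras. It makes projections nonexpansive and bounds the curl part of a field by the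
  field itself.\<close>

lemma nm_orthogonal_le:
  assumes "p \<in> H" "c \<in> H" "ip c p = 0"
  shows "nm p \<le> nm (p + c)" "nm c \<le> nm (p + c)"
proof -
  have "ip (p + c) (p + c) = ip p p + ip c c"
    using ip_quadratic[of p c 1] assms by (simp add: ip_commute[of p c])
  then show "nm p \<le> nm (p + c)" "nm c \<le> nm (p + c)"
    using assms by (simp_all add: nm_def ip_nonneg)
qed

text \<open>Cauchy-Schwarz. It carries integral identities from test functions to their
  limits.\<close>

lemma tendsto_ip:
  assumes "\<And>n. X n \<in> H" "x \<in> H" "y \<in> H" "(\<lambda>n. nm (X n - x)) \<longlonglongrightarrow> 0"
  shows "(\<lambda>n. ip (X n) y) \<longlonglongrightarrow> ip x y"
proof -
  have "(\<lambda>n. ip (X n) y - ip x y) \<longlonglongrightarrow> 0"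
  proof (rule Lim_null_comparison)
    show "\<forall>\<^sub>F n in sequentially. norm (ip (X n) y - ip x y) \<le> nm (X n - x) * nm y"
      using cauchy_schwarz[of "X _ - x" y] assms by (simp add: ip_diff)
    show "(\<lambda>n. nm (X n - x) * nm y) \<longlonglongrightarrow> 0" using tendsto_mult_right[OF assms(4), of "nm y"] by simp
  qed
  then show ?thesis by (simp add: LIM_zero_iff)
qed

lemma nm_tendsto_0_commute:
  assumes "\<And>n. X n \<in> H" "x \<in> H"
  shows "(\<lambda>n. nm (x - X n)) \<longlonglongrightarrow> 0 \<longleftrightarrow> (\<lambda>n. nm (X n - x)) \<longlonglongrightarrow> 0"
  using nm_minus_commute[OF assms(2) assms(1)] by simp

end

section \<open>Completeness: orthogonal projection, contractions, Lax-Milgram\<close>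

locale semi_hilbert = semi_inner +
  assumes complete_H: "(\<And>n. X n \<in> H) \<Longrightarrow> (\<And>e. e > 0 \<Longrightarrow> \<exists>N::nat. \<forall>m\<ge>N. \<forall>n\<ge>N. nm (X m - X n) < e)
      \<Longrightarrow> \<exists>x\<in>H. (\<lambda>n. nm (X n - x)) \<longlonglongrightarrow> 0"
begin

text \<open>Closedness is expressed by approximation, so S contains every element of H at distance
  zero from it. Limits in a seminorm are not unique, but whichever one completeness supplies then
  lies in S.\<close>

definition closed_subspace :: "'a set \<Rightarrow> bool" where
  "closed_subspace S \<longleftrightarrow> subspace S \<and> S \<subseteq> H \<and> (\<forall>x\<in>H. (\<forall>e>0. \<exists>s\<in>S. nm (x - s) < e) \<longrightarrow> x \<in> S)"

lemma closed_subspace_limit: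
  assumes S: "closed_subspace S" and X: "\<And>n::nat. X n \<in> S"
    and C: "\<And>e. e > 0 \<Longrightarrow> \<exists>N::nat. \<forall>m\<ge>N. \<forall>n\<ge>N. nm (X m - X n) < e"
  shows "\<exists>x\<in>S. (\<lambda>n. nm (X n - x)) \<longlonglongrightarrow> 0"
proof -
  have XH: "X n \<in> H" for n using S X unfolding closed_subspace_def by auto
  obtain x where x: "x \<in> H" and lim: "(\<lambda>n. nm (X n - x)) \<longlonglongrightarrow> 0"
    using complete_H[of X] XH C by blast
  have "\<exists>s\<in>S. nm (x - s) < e" if "e > 0" for e
  proof -
    from LIMSEQ_D[OF lim that] obtain n where "norm (nm (X n - x) - 0) < e" by blast
    then have "nm (x - X n) < e" using nm_minus_commute[of x "X n"] x XH by simp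
    then show ?thesis using X by blast
  qed
  then show ?thesis using S x lim unfolding closed_subspace_def by blast
qed

text \<open>A minimising sequence for the distance to S is Cauchy by the parallelogram law, and
  perturbing its limit along S shows orthogonality.\<close>

lemma projection_exists:
  assumes S: "closed_subspace S" and x: "x \<in> H"
  shows "\<exists>p\<in>S. \<forall>q\<in>S. ip (x - p) q = 0"
proof -
  have subS: "subspace S" and SH: "\<And>s. s \<in> S \<Longrightarrow> s \<in> H"
    using S unfolding closed_subspace_def by auto
  define Q where "Q s = ip (x - s) (x - s)" for s
  define d where "d = (INF s\<in>S. Q s)"
  have bdd: "bdd_below (Q ` S)"
    using SH x by (intro bdd_belowI[of _ 0]) (auto simp: Q_def ip_nonneg)
  have ne: "S \<noteq> {}" using subS by (auto simp: subspace_def)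
  have dle: "d \<le> Q s" if "s \<in> S" for s
    unfolding d_def using bdd that by (rule cINF_lower)
  have "\<exists>s\<in>S. Q s < d + 1 / real (Suc n)" for n
    using cINF_less_iff[OF ne bdd, of "d + 1 / real (Suc n)"] unfolding d_def by simp
  then obtain X where X: "\<And>n. X n \<in> S" and XQ: "\<And>n. Q (X n) < d + 1 / real (Suc n)"
    by metis
  have XH: "X n \<in> H" for n using X SH by auto
  have diff: "ip (X m - X n) (X m - X n) \<le> 2 / real (Suc m) + 2 / real (Suc n)" for m n
  proof -
    \<comment> \<open>The midpoint lies in S, so its squared distance to x is at least d. The
      parallelogram identity then bounds the squared distance of two members of the sequence by
      their excesses over d.\<close>
    have mid: "(1/2) *\<^sub>R (X m + X n) \<in> S"
      using X subS by (auto simp: subspace_def)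
    have "ip (X m - X n) (X m - X n) = 2 * Q (X m) + 2 * Q (X n) - 4 * Q ((1/2) *\<^sub>R (X m + X n))"
      unfolding Q_def using x XH by (simp add: ip_simps ip_commute algebra_simps)
    then show ?thesis using dle[OF mid] XQ[of m] XQ[of n] by linarith
  qed
  have "\<exists>N. \<forall>m\<ge>N. \<forall>n\<ge>N. nm (X m - X n) < e" if "e > 0" for e
  proof -
    have "e\<^sup>2 / 4 > 0" using that by simp
    then obtain N where N: "1 / real (Suc N) < e\<^sup>2 / 4"
      using nat_approx_posE by blast
    have "nm (X m - X n) < e" if mn: "m \<ge> N" "n \<ge> N" for m n
    proof (rule power2_less_imp_less)
      have "1 / real (Suc m) \<le> 1 / real (Suc N)" "1 / real (Suc n) \<le> 1 / real (Suc N)"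
        using mn by (auto intro!: divide_left_mono)
      then show "(nm (X m - X n))\<^sup>2 < e\<^sup>2"
        using diff[of m n] N XH by (simp add: nm_sq)
    qed (use \<open>e > 0\<close> in simp)
    then show ?thesis by blast
  qed
  from closed_subspace_limit[OF S X this]
  obtain p where p: "p \<in> S" and lim: "(\<lambda>n. nm (X n - p)) \<longlonglongrightarrow> 0" by blast
  have pH: "p \<in> H" using p SH by auto
  have "nm (x - p) \<le> sqrt d"
  proof (rule LIMSEQ_le_const)
    have "(\<lambda>n. sqrt (d + 1 / real (Suc n)) + nm (X n - p)) \<longlonglongrightarrow> sqrt (d + 0) + 0"
      by (intro tendsto_add tendsto_real_sqrt tendsto_const lim LIMSEQ_Suc[OF lim_1_over_n])
    then show "(\<lambda>n. sqrt (d + 1 / real (Suc n)) + nm (X n - p)) \<longlonglongrightarrow> sqrt d" by simp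
    have "nm (x - p) \<le> sqrt (d + 1 / real (Suc n)) + nm (X n - p)" for n
    proof -
      have "nm (x - X n) \<le> sqrt (d + 1 / real (Suc n))"
        using XQ[of n] unfolding nm_def Q_def by simp
      then show ?thesis using nm_triangle_diff[of x "X n" p] x XH pH by fastforce
    qed
    then show "\<exists>N. \<forall>n\<ge>N. nm (x - p) \<le> sqrt (d + 1 / real (Suc n)) + nm (X n - p)" by blast
  qed
  then have Qp: "Q p \<le> d"
    unfolding nm_def Q_def by simp
  have "ip (x - p) q = 0" if q: "q \<in> S" for q
  proof -
    \<comment> \<open>Minimality in the direction q, written with constant term 0 so that
      \<open>quadratic_bound\<close> gives \<open>(ip (x - p) q)\<^sup>2 \<le> 0\<close>.\<close>
    have "0 \<le> 0 + 2 * t * ip (x - p) q + t\<^sup>2 * ip q q" for t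
    proof -
      have "p - t *\<^sub>R q \<in> S" using p q subS by (simp add: subspace_diff subspace_scale)
      then have "Q p \<le> Q (p - t *\<^sub>R q)" using dle Qp by fastforce
      also have "Q (p - t *\<^sub>R q) = ip (x - p + t *\<^sub>R q) (x - p + t *\<^sub>R q)"
        unfolding Q_def by (simp add: algebra_simps)
      also have "\<dots> = Q p + 2 * t * ip (x - p) q + t\<^sup>2 * ip q q"
        unfolding Q_def using ip_quadratic[of "x - p" q t] x pH SH[OF q] by simp
      finally show ?thesis by simp
    qed
    from quadratic_bound[OF this] show ?thesis by simp
  qed
  with p show ?thesis by blast
qed

text \<open>Banach's iteration, started at 0. In a seminorm the limit is fixed only up to norm zero,
  which is enough wherever Cauchy-Schwarz applies.\<close>

lemma contraction_fixed_point:
  assumes S: "closed_subspace S" and T: "\<And>x. x \<in> S \<Longrightarrow> T x \<in> S" and c: "0 \<le> c" "c < 1"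
    and contr: "\<And>x y. x \<in> S \<Longrightarrow> y \<in> S \<Longrightarrow> nm (T x - T y) \<le> c * nm (x - y)"
  shows "\<exists>p\<in>S. nm (T p - p) = 0"
proof -
  have SH: "\<And>s. s \<in> S \<Longrightarrow> s \<in> H" and S0: "0 \<in> S"
    using S unfolding closed_subspace_def by (auto simp: subspace_def)
  define X where "X n = (T ^^ n) 0" for n
  have XS: "X n \<in> S" for n unfolding X_def by (induction n) (auto simp: S0 T)
  have XH: "X n \<in> H" for n using XS SH by auto
  have XSuc: "X (Suc n) = T (X n)" for n by (simp add: X_def)
  define D where "D = nm (X 1 - X 0)"
  have D0: "D \<ge> 0" unfolding D_def using XH by simp
  have step: "nm (X (Suc n) - X n) \<le> c ^ n * D" for n
  proof (induction n)
    case (Suc n)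
    have "nm (X (Suc (Suc n)) - X (Suc n)) \<le> c * nm (X (Suc n) - X n)"
      using contr[OF XS[of "Suc n"] XS[of n]] by (simp add: XSuc)
    also have "\<dots> \<le> c * (c ^ n * D)" using Suc c by (simp add: mult_left_mono)
    finally show ?case by (simp add: mult.assoc)
  qed (simp add: D_def)
  \<comment> \<open>The factor \<open>1 - c\<close> turns the partial geometric sum into
    \<open>1 - c ^ k\<close>, so the induction carries no sum.\<close>
  have tele: "(1 - c) * nm (X (n + k) - X n) \<le> c ^ n * D * (1 - c ^ k)" for n k
  proof (induction k)
    case 0
    then show ?case by simp
  next
    case (Suc k)
    have "nm (X (n + Suc k) - X n) \<le> nm (X (Suc (n + k)) - X (n + k)) + nm (X (n + k) - X n)"
      using nm_triangle_diff[OF XH XH XH] by simp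
    then have "(1 - c) * nm (X (n + Suc k) - X n)
        \<le> (1 - c) * (c ^ (n + k) * D + nm (X (n + k) - X n))"
      using step[of "n + k"] c by (intro mult_left_mono) auto
    also have "\<dots> \<le> (1 - c) * (c ^ (n + k) * D) + c ^ n * D * (1 - c ^ k)"
      using Suc by (simp add: distrib_left)
    also have "\<dots> = c ^ n * D * (1 - c ^ Suc k)"
      by (simp add: algebra_simps power_add)
    finally show ?case .
  qed
  have dist: "nm (X m - X n) \<le> c ^ n * D / (1 - c)" if "n \<le> m" for m n
  proof -
    have "(1 - c) * nm (X m - X n) \<le> c ^ n * D * (1 - c ^ (m - n))"
      using tele[of n "m - n"] that by simp
    also have "\<dots> \<le> c ^ n * D * 1" using c D0 by (intro mult_left_mono) auto
    finally show ?thesis using c by (simp add: field_simps)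
  qed
  have "(\<lambda>n. c ^ n * (D / (1 - c))) \<longlonglongrightarrow> 0 * (D / (1 - c))"
    using c by (intro tendsto_mult LIMSEQ_realpow_zero tendsto_const)
  then have lim0: "(\<lambda>n. c ^ n * D / (1 - c)) \<longlonglongrightarrow> 0" by simp
  have "\<exists>N. \<forall>m\<ge>N. \<forall>n\<ge>N. nm (X m - X n) < e" if "e > 0" for e
  proof -
    from LIMSEQ_D[OF lim0 that] obtain N where N: "\<And>n. n \<ge> N \<Longrightarrow> \<bar>c ^ n * D / (1 - c)\<bar> < e"
      by auto
    have "nm (X m - X n) < e" if "m \<ge> N" "n \<ge> N" for m n
    proof (cases "n \<le> m")
      case True
      then show ?thesis using dist[of n m] N[of n] that by linarith
    next
      case False
      then have "m \<le> n" by simp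
      then show ?thesis using dist[of m n] N[OF that(1)] nm_minus_commute[OF XH XH, of m n] by linarith
    qed
    then show ?thesis by blast
  qed
  from closed_subspace_limit[OF S XS this]
  obtain p where p: "p \<in> S" and lim: "(\<lambda>n. nm (X n - p)) \<longlonglongrightarrow> 0" by blast
  have pH: "p \<in> H" "T p \<in> H" using p SH T by auto
  have "nm (T p - p) \<le> 0"
  proof (rule LIMSEQ_le_const)
    have "(\<lambda>n. c * nm (X n - p) + nm (X (Suc n) - p)) \<longlonglongrightarrow> c * 0 + 0"
      by (intro tendsto_intros lim LIMSEQ_Suc[OF lim])
    then show "(\<lambda>n. c * nm (X n - p) + nm (X (Suc n) - p)) \<longlonglongrightarrow> 0" by simp
    have "nm (T p - p) \<le> c * nm (X n - p) + nm (X (Suc n) - p)" for n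
    proof -
      have "nm (T p - p) \<le> nm (T p - X (Suc n)) + nm (X (Suc n) - p)"
        using nm_triangle_diff[OF pH(2) XH pH(1)] by simp
      moreover have "nm (T p - X (Suc n)) \<le> c * nm (X n - p)"
        using contr[OF p XS, of n] nm_minus_commute[OF pH(1) XH, of n] by (simp add: XSuc)
      ultimately show ?thesis by linarith
    qed
    then show "\<exists>N. \<forall>n\<ge>N. nm (T p - p) \<le> c * nm (X n - p) + nm (X (Suc n) - p)" by blast
  qed
  then show ?thesis using p nm_nonneg[OF H_diff[OF pH(2,1)]] by (intro bexI[of _ p]) auto
qed

text \<open>A solution is, up to norm zero, a fixed point of projecting
  \<open>p - \<rho> *\<^sub>R (A p - g)\<close> onto S. For a suitable positive \<rho>, coercivity
  makes this map a contraction.\<close>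

lemma lax_milgram:
  assumes S: "closed_subspace S"
    and A: "\<And>x. x \<in> S \<Longrightarrow> A x \<in> H" and Adiff: "\<And>x y. x \<in> S \<Longrightarrow> y \<in> S \<Longrightarrow> A (x - y) = A x - A y"
    and bound: "\<And>x. x \<in> S \<Longrightarrow> nm (A x) \<le> M * nm x"
    and coercive: "\<And>x. x \<in> S \<Longrightarrow> l * ip x x \<le> ip x (A x)" and l: "l > 0" and g: "g \<in> H"
  shows "\<exists>p\<in>S. \<forall>q\<in>S. ip q (A p) = ip q g"
proof -
  have SH: "\<And>s. s \<in> S \<Longrightarrow> s \<in> H" and Sdiff: "\<And>x y. x \<in> S \<Longrightarrow> y \<in> S \<Longrightarrow> x - y \<in> S"
    using S unfolding closed_subspace_def by (auto intro: subspace_diff)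
  obtain P where PS: "\<And>x. x \<in> H \<Longrightarrow> P x \<in> S" and Porth: "\<And>x q. x \<in> H \<Longrightarrow> q \<in> S \<Longrightarrow> ip (x - P x) q = 0"
    using projection_exists[OF S] by metis
  \<comment> \<open>This N bounds A, is positive and is at least l, so that
    \<open>1 - l\<^sup>2 / N\<^sup>2\<close> lies between 0 and 1.\<close>
  define N where "N = \<bar>M\<bar> + l"
  have N: "N > 0" "N \<ge> l" using l unfolding N_def by auto
  \<comment> \<open>The minimiser of \<open>1 - 2 * \<rho> * l + \<rho>\<^sup>2 * N\<^sup>2\<close>,
    which bounds the squared Lipschitz constant of U; the minimum is
    \<open>1 - l\<^sup>2 / N\<^sup>2\<close>.\<close>
  define \<rho> where "\<rho> = l / N\<^sup>2"
  have \<rho>: "\<rho> > 0" using l N unfolding \<rho>_def by simp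
  define U where "U p = p - \<rho> *\<^sub>R (A p - g)" for p
  have UH: "U p \<in> H" if "p \<in> S" for p
    unfolding U_def using that SH A g by auto
  define T where "T p = P (U p)" for p
  define c where "c = sqrt (1 - l\<^sup>2 / N\<^sup>2)"
  have lN: "l\<^sup>2 / N\<^sup>2 \<le> 1" "l\<^sup>2 / N\<^sup>2 > 0" using l N by (auto simp: power_mono)
  have contr: "nm (T x - T y) \<le> c * nm (x - y)" if xy: "x \<in> S" "y \<in> S" for x y
  proof -
    define d where "d = x - y"
    have dS: "d \<in> S" and dH: "d \<in> H" and AdH: "A d \<in> H"
      using xy Sdiff SH A unfolding d_def by auto
    have TS: "T x \<in> S" "T y \<in> S" using xy UH PS unfolding T_def by auto
    have "U x - U y = d + (- \<rho>) *\<^sub>R A d"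
      unfolding U_def d_def Adiff[OF xy] by (simp add: algebra_simps)
    then have "ip (U x - U y) (U x - U y) = ip d d + 2 * (- \<rho>) * ip d (A d) + (- \<rho>)\<^sup>2 * ip (A d) (A d)"
      using ip_quadratic[OF dH AdH, of "- \<rho>"] by simp
    moreover have "ip (A d) (A d) \<le> N\<^sup>2 * ip d d"
    proof -
      have "nm (A d) \<le> N * nm d"
        using bound[OF dS] mult_right_mono[of M N "nm d"] dH l unfolding N_def by force
      then have "(nm (A d))\<^sup>2 \<le> (N * nm d)\<^sup>2" using AdH by (intro power_mono) auto
      then show ?thesis using dH AdH by (simp add: power_mult_distrib nm_sq)
    qed
    then have "(- \<rho>)\<^sup>2 * ip (A d) (A d) \<le> \<rho>\<^sup>2 * (N\<^sup>2 * ip d d)" by (simp add: mult_left_mono)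
    moreover have "2 * \<rho> * (l * ip d d) \<le> 2 * \<rho> * ip d (A d)"
      using coercive[OF dS] \<rho> by (intro mult_left_mono) auto
    moreover have "ip d d - 2 * \<rho> * (l * ip d d) + \<rho>\<^sup>2 * (N\<^sup>2 * ip d d) = (1 - l\<^sup>2 / N\<^sup>2) * ip d d"
      using N unfolding \<rho>_def by (simp add: field_simps power2_eq_square)
    ultimately have "ip (U x - U y) (U x - U y) \<le> (1 - l\<^sup>2 / N\<^sup>2) * ip d d"
      by linarith
    then have "nm (U x - U y) \<le> c * nm d"
      unfolding nm_def c_def by (simp flip: real_sqrt_mult)
    moreover have "nm (T x - T y) \<le> nm (U x - U y)"
    proof -
      \<comment> \<open>The difference \<open>?e\<close> of the two projection errors is orthogonal
        to S, which contains \<open>?p\<close>; by Pythagoras projecting does not increase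
        distances.\<close>
      let ?p = "T x - T y" and ?e = "(U x - T x) - (U y - T y)"
      have "ip ?e ?p = ip (U x - T x) ?p - ip (U y - T y) ?p"
        using TS SH UH xy by (intro ip_diff) auto
      also have "\<dots> = 0"
        using Porth[OF UH[OF xy(1)] Sdiff[OF TS]] Porth[OF UH[OF xy(2)] Sdiff[OF TS]] by (simp add: T_def)
      finally have "nm ?p \<le> nm (?p + ?e)"
        using TS SH UH xy by (intro nm_orthogonal_le) auto
      moreover have "?p + ?e = U x - U y" by simp
      ultimately show ?thesis by simp
    qed
    ultimately show ?thesis by (simp add: d_def)
  qed
  have "\<exists>p\<in>S. nm (T p - p) = 0"
  proof (rule contraction_fixed_point[OF S _ _ _ contr])
    show "T x \<in> S" if "x \<in> S" for x using that UH PS unfolding T_def by auto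
    show "0 \<le> c" "c < 1" using lN unfolding c_def by auto
  qed auto
  then obtain p where p: "p \<in> S" and fix0: "nm (T p - p) = 0" by blast
  have TS: "T p \<in> S" using p UH PS unfolding T_def by auto
  have "ip q (A p) = ip q g" if q: "q \<in> S" for q
  proof -
    note HH = SH[OF p] SH[OF q] A[OF p] g SH[OF TS] UH[OF p]
    \<comment> \<open>Being fixed up to norm zero suffices: by Cauchy-Schwarz \<open>T p - p\<close>
      is orthogonal to q, hence so is \<open>U p - p\<close>, a nonzero multiple of the
      residual.\<close>
    have "ip (T p - p) q = 0"
      using cauchy_schwarz[of "T p - p" q] fix0 HH by simp
    moreover have "ip (U p - T p) q = 0" using Porth[OF UH[OF p] q] by (simp add: T_def)
    moreover have "ip (U p - p) q = - \<rho> * (ip q (A p) - ip q g)"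
      unfolding U_def using HH by (simp add: ip_simps ip_commute[of q] algebra_simps)
    ultimately show ?thesis using HH \<rho> by (simp add: ip_diff)
  qed
  then show ?thesis using p by blast
qed

end

section \<open>The Galerkin estimate\<close>

text \<open>Models multiplication of fields by the matrix a. The bounds l and L are assumed for the
  quadratic form; a bound for the operator is derived from them and from symmetry.\<close>

locale elliptic_operator = semi_inner +
  fixes A :: "'a \<Rightarrow> 'a" and l L :: real
  assumes A_H [simp]: "x \<in> H \<Longrightarrow> A x \<in> H"
    and A_add: "x \<in> H \<Longrightarrow> y \<in> H \<Longrightarrow> A (x + y) = A x + A y"
    and A_scale: "x \<in> H \<Longrightarrow> A (c *\<^sub>R x) = c *\<^sub>R A x"
    and A_sym: "x \<in> H \<Longrightarrow> y \<in> H \<Longrightarrow> ip x (A y) = ip y (A x)"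
    and A_lower: "x \<in> H \<Longrightarrow> l * ip x x \<le> ip x (A x)"
    and A_upper: "x \<in> H \<Longrightarrow> ip x (A x) \<le> L * ip x x"
    and l_pos: "0 < l" and l_le_L: "l \<le> L"
begin

lemma A_diff: "x \<in> H \<Longrightarrow> y \<in> H \<Longrightarrow> A (x - y) = A x - A y"
  using A_add[of "x - y" y] by simp

text \<open>By symmetry and coercivity \<open>ip x (A y)\<close> is itself a semi-inner product,
  whose norm is at most \<open>sqrt L\<close> times the original one. Its Cauchy-Schwarz inequality
  yields the constant L.\<close>

lemma ip_A_le:
  assumes "x \<in> H" "y \<in> H"
  shows "\<bar>ip x (A y)\<bar> \<le> L * (nm x * nm y)"
proof -
  interpret B: semi_inner H "\<lambda>x y. ip x (A y)"
  proof
    show "0 \<le> ip x (A x)" if "x \<in> H" for x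
      using A_lower[OF that] ip_nonneg[OF that] l_pos by (meson less_imp_le mult_nonneg_nonneg order_trans)
    show "ip x (A y) = ip y (A x)" if "x \<in> H" "y \<in> H" for x y
      using A_sym that .
  qed (simp_all add: subspace_H ip_simps)
  have le: "B.nm z \<le> sqrt L * nm z" if "z \<in> H" for z
    using A_upper[OF that] unfolding B.nm_def nm_def by (simp flip: real_sqrt_mult)
  have "\<bar>ip x (A y)\<bar> \<le> B.nm x * B.nm y" using B.cauchy_schwarz assms by simp
  also have "\<dots> \<le> (sqrt L * nm x) * (sqrt L * nm y)"
    using le assms l_pos l_le_L by (intro mult_mono) auto
  also have "\<dots> = L * (nm x * nm y)" using l_pos l_le_L by (simp add: algebra_simps)
  finally show ?thesis .
qed

text \<open>Coercivity against Cauchy-Schwarz, divided by the norm of z. It is the a priori bound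
  for the exact and for the discrete solution.\<close>

lemma galerkin_bound:
  assumes z: "z \<in> H" and g: "g \<in> H" and eq: "ip z (A z) = ip z g"
  shows "nm z \<le> nm g / l"
proof -
  have "nm z * (l * nm z) \<le> nm z * nm g"
    using A_lower[OF z] eq cauchy_schwarz[OF z g] nm_sq[OF z] by (simp add: power2_eq_square mult.left_commute)
  then have "l * nm z \<le> nm g"
    using nm_nonneg[OF z] nm_nonneg[OF g] by (cases "nm z = 0") (auto simp: mult_le_cancel_left)
  then show ?thesis using l_pos by (simp add: field_simps)
qed

text \<open>Testing the equation with \<open>gu - p\<close>, where \<open>p\<close> is the potential part of \<open>z\<close>, bounds \<open>gu - z\<close> by the
  residual \<open>r\<close> and \<open>z - p\<close>; the latter is at most \<open>K * nm z\<close> and is absorbed because \<open>K\<close> is small.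
  Testing with \<open>zV - z\<close> then bounds the distance from \<open>z\<close> to the Galerkin solution.\<close>

lemma galerkin_estimate:
  assumes SH: "S \<subseteq> H" and gu: "gu \<in> S" and gw: "gw \<in> S"
    and weak: "\<And>q. q \<in> S \<Longrightarrow> ip q (A gu) = ip q gw"
    and VH: "V \<subseteq> H" and Vdiff: "\<And>x y. x \<in> V \<Longrightarrow> y \<in> V \<Longrightarrow> x - y \<in> V"
    and zV: "zV \<in> V" and gal: "\<And>\<eta>. \<eta> \<in> V \<Longrightarrow> ip \<eta> (A zV) = ip \<eta> gw"
    and split: "\<And>\<eta>. \<eta> \<in> V \<Longrightarrow> \<exists>p\<in>S. (\<forall>q\<in>S. ip (\<eta> - p) q = 0) \<and> nm (\<eta> - p) \<le> K * nm \<eta>"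
    and K: "0 \<le> K" "L * K \<le> l / 2" and Sdiff: "\<And>x y. x \<in> S \<Longrightarrow> y \<in> S \<Longrightarrow> x - y \<in> S"
    and z: "z \<in> V" and r: "r \<in> S" and res: "\<And>q. q \<in> S \<Longrightarrow> ip (A (gu - z) - r) q = 0"
  shows "nm (gu - zV) \<le> ((1 + L / l) * (2 / l + 2 * L / l\<^sup>2) + L / l\<^sup>2) * (nm r + K * nm gw)"
proof -
  have L: "L > 0" using l_pos l_le_L by simp
  have mem: "gu \<in> H" "gw \<in> H" "zV \<in> H" "z \<in> H" "r \<in> H" using assms by auto
  define e where "e = gu - z"
  have e: "e \<in> H" using mem by (simp add: e_def)
  have gu_le: "nm gu \<le> nm gw / l" using galerkin_bound[of gu gw] weak gu mem by auto
  obtain p where p: "p \<in> S" and porth: "\<And>q. q \<in> S \<Longrightarrow> ip (z - p) q = 0" and pK: "nm (z - p) \<le> K * nm z"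
    using split[OF z] by blast
  have pH: "p \<in> H" using p SH by auto
  have z_le: "nm z \<le> nm gu + nm e"
    using nm_triangle_diff[of 0 gu z] nm_triangle[of gu "- e"] nm_scale[of e "-1"] mem e by (simp add: e_def)
  have e_le: "nm e \<le> (2 / l) * nm r + (2 * L / l\<^sup>2) * (K * nm gw)"
  proof -
    \<comment> \<open>The error \<open>gu - z\<close> is no admissible test field, because z need
      not lie in S; replacing z by its potential part p repairs this.\<close>
    have s: "gu - p \<in> S" and sH: "gu - p \<in> H" using gu p Sdiff SH by auto
    have "ip (p - z) (gu - p) = 0"
      using porth[OF s] ip_diff[of p z "gu - p"] ip_diff[of z p "gu - p"] mem pH by simp
    \<comment> \<open>\<open>p - z\<close> is orthogonal to S, hence to \<open>gu - p\<close>, and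
      the two add up to e.\<close>
    then have "nm (gu - p) \<le> nm ((gu - p) + (p - z))"
      using sH pH mem by (intro nm_orthogonal_le) auto
    then have s_le: "nm (gu - p) \<le> nm e" by (simp add: e_def)
    have "ip (A e - r) (gu - p) = 0" using res[OF s] by (simp add: e_def)
    then have "ip (gu - p) (A e) = ip (gu - p) r"
      using e mem sH ip_diff[of "A e" r "gu - p"] ip_commute[OF sH, of "A e"] ip_commute[OF sH, of r] by simp
    also have "\<dots> \<le> nm (gu - p) * nm r" using cauchy_schwarz[of "gu - p" r] sH mem by simp
    also have "\<dots> \<le> nm e * nm r" using s_le mem by (intro mult_right_mono) auto
    finally have 1: "ip (gu - p) (A e) \<le> nm e * nm r" .
    have "\<bar>ip (z - p) (A e)\<bar> \<le> L * (nm (z - p) * nm e)" using mem pH e by (intro ip_A_le) auto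
    also have "\<dots> \<le> L * (K * nm z * nm e)"
      using pK L e by (intro mult_left_mono mult_right_mono) auto
    finally have 2: "\<bar>ip (z - p) (A e)\<bar> \<le> nm e * (L * K * nm z)" by (simp add: mult_ac)
    have "ip e (A e) = ip (gu - p) (A e) - ip (z - p) (A e)"
      using mem pH e ip_diff[of "gu - p" "z - p" "A e"] by (simp add: e_def)
    then have "ip e (A e) \<le> nm e * nm r + nm e * (L * K * nm z)" using 1 2 by linarith
    then have "nm e * (l * nm e) \<le> nm e * (nm r + L * K * nm z)"
      using A_lower[OF e] nm_sq[OF e] by (simp add: power2_eq_square algebra_simps)
    moreover have "0 \<le> nm r + L * K * nm z" using mem K L by simp
    ultimately have "l * nm e \<le> nm r + L * K * nm z"
      using nm_nonneg[OF e] by (cases "nm e = 0") (auto simp: mult_le_cancel_left)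
    also have "L * K * nm z \<le> L * K * nm gu + L * K * nm e"
      using mult_left_mono[OF z_le, of "L * K"] K L by (simp add: algebra_simps)
    also have "L * K * nm e \<le> l / 2 * nm e" using K e by (intro mult_right_mono) auto
    finally have "l / 2 * nm e \<le> nm r + L * K * nm gu" by (simp add: algebra_simps)
    also have "L * K * nm gu \<le> L * K * (nm gw / l)" using gu_le K L by (intro mult_left_mono) auto
    finally have "(2 / l) * (l / 2 * nm e) \<le> (2 / l) * (nm r + L * K * (nm gw / l))"
      using l_pos by (intro mult_left_mono) auto
    then show ?thesis using l_pos by (simp add: field_simps power2_eq_square)
  qed
  define h where "h = zV - z"
  have h: "h \<in> V" "h \<in> H" using Vdiff[OF zV z] VH by (auto simp: h_def)
  obtain c where c: "c \<in> S" and corth: "\<And>q. q \<in> S \<Longrightarrow> ip (h - c) q = 0" and cK: "nm (h - c) \<le> K * nm h"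
    using split[OF h(1)] by blast
  have cH: "c \<in> H" using c SH by auto
  \<comment> \<open>In the Galerkin equation h may be replaced by its potential part c on the right
    side, since gw lies in S, and on c the weak equation for gu applies. The term in
    \<open>h - c\<close> is the defect of Galerkin orthogonality.\<close>
  have "ip h (A zV) = ip c gw"
    using gal[OF h(1)] corth[OF gw] ip_diff[of h c gw] h cH mem by simp
  also have "\<dots> = ip c (A gu)" using weak[OF c] by simp
  also have "\<dots> = ip h (A gu) - ip (h - c) (A gu)"
    using ip_diff[of h c "A gu"] h cH mem by simp
  finally have "ip h (A h) = ip h (A e) - ip (h - c) (A gu)"
    using mem h by (simp add: h_def e_def A_diff ip_diff_right)
  moreover have "\<bar>ip h (A e)\<bar> \<le> L * (nm h * nm e)" using h e by (intro ip_A_le)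
  moreover have "\<bar>ip (h - c) (A gu)\<bar> \<le> L * (nm h * (K * nm gw / l))"
  proof -
    have "\<bar>ip (h - c) (A gu)\<bar> \<le> L * (nm (h - c) * nm gu)" using h cH mem by (intro ip_A_le) auto
    also have "\<dots> \<le> L * ((K * nm h) * (nm gw / l))"
      using cK gu_le L K h cH mem by (intro mult_left_mono mult_mono) auto
    finally show ?thesis by (simp add: mult_ac)
  qed
  ultimately have "nm h * (l * nm h) \<le> nm h * (L * nm e + L * (K * nm gw / l))"
    using A_lower[OF h(2)] nm_sq[OF h(2)] by (simp add: power2_eq_square algebra_simps)
  moreover have "0 \<le> L * nm e + L * (K * nm gw / l)" using L K e mem l_pos by simp
  ultimately have "l * nm h \<le> L * nm e + L * (K * nm gw / l)"
    using nm_nonneg[OF h(2)] by (cases "nm h = 0") (auto simp: mult_le_cancel_left)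
  then have h_le: "nm h \<le> (L / l) * nm e + (L / l\<^sup>2) * (K * nm gw)"
    using l_pos by (simp add: field_simps power2_eq_square)
  have "nm (gu - zV) \<le> nm e + nm h"
    using nm_triangle_diff[of gu z zV] nm_minus_commute[of z zV] mem by (simp add: e_def h_def)
  also have "\<dots> \<le> (1 + L / l) * nm e + (L / l\<^sup>2) * (K * nm gw)"
    using h_le by (simp add: algebra_simps)
  also have "\<dots> \<le> (1 + L / l) * ((2 / l) * nm r + (2 * L / l\<^sup>2) * (K * nm gw)) + (L / l\<^sup>2) * (K * nm gw)"
    using e_le L l_pos by (intro add_right_mono mult_left_mono) auto
  \<comment> \<open>The two coefficients are enlarged to their sum so that a single factor can be
    taken out.\<close>
  also have "\<dots> \<le> (1 + L / l) * ((2 / l + 2 * L / l\<^sup>2) * (nm r + K * nm gw)) + (L / l\<^sup>2) * (nm r + K * nm gw)"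
  proof (intro add_mono mult_left_mono)
    have "0 \<le> (2 * L / l\<^sup>2) * nm r + (2 / l) * (K * nm gw)" using L l_pos K mem by simp
    then show "(2 / l) * nm r + (2 * L / l\<^sup>2) * (K * nm gw) \<le> (2 / l + 2 * L / l\<^sup>2) * (nm r + K * nm gw)"
      unfolding distrib_left distrib_right by linarith
  qed (use L l_pos K mem in auto)
  also have "\<dots> = ((1 + L / l) * (2 / l + 2 * L / l\<^sup>2) + L / l\<^sup>2) * (nm r + K * nm gw)"
    unfolding distrib_right[of "(1 + L / l) * (2 / l + 2 * L / l\<^sup>2)"] by simp
  finally show ?thesis .
qed

end

text \<open>With pointwise scalar multiplication, spaces of functions become instances of the locales above.\<close>

instantiation "fun" :: (type, scaleR) scaleR
begin

definition scaleR_fun_def: "c *\<^sub>R f = (\<lambda>x. c *\<^sub>R f x)"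

instance ..

end

instance "fun" :: (type, real_vector) real_vector
  by standard (simp_all add: scaleR_fun_def fun_eq_iff scaleR_add_right scaleR_add_left)

section \<open>The space of square integrable functions\<close>

lemma borel_measurable_L2: "f \<in> L2 \<Omega> \<Longrightarrow> f \<in> borel_measurable (lebesgue_on \<Omega>)"
  by (simp add: L2_def)

lemma norm_add_sq_le: "(norm (x + y :: 'b::real_inner))\<^sup>2 \<le> 2 * (norm x)\<^sup>2 + 2 * (norm y)\<^sup>2"
proof -
  have "(norm (x + y))\<^sup>2 + (norm (x - y))\<^sup>2 = 2 * (norm x)\<^sup>2 + 2 * (norm y)\<^sup>2"
    by (simp add: power2_norm_eq_inner inner_simps inner_commute)
  then show ?thesis by (metis add.commute le_add_same_cancel2 zero_le_power2)
qed

lemma subspace_L2: "subspace (L2 \<Omega> :: (real^'n::finite \<Rightarrow> 'b::euclidean_space) set)"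
  unfolding subspace_def
proof (intro conjI ballI allI)
  show "0 \<in> (L2 \<Omega> :: (real^'n \<Rightarrow> 'b) set)" by (simp add: L2_def zero_fun_def)
next
  fix f g :: "real^'n \<Rightarrow> 'b" assume f: "f \<in> L2 \<Omega>" and g: "g \<in> L2 \<Omega>"
  have [measurable]: "f \<in> borel_measurable (lebesgue_on \<Omega>)" "g \<in> borel_measurable (lebesgue_on \<Omega>)"
    using f g by (simp_all add: L2_def)
  have "integrable (lebesgue_on \<Omega>) (\<lambda>x. (norm (f x + g x))\<^sup>2)"
  proof (rule Bochner_Integration.integrable_bound)
    show "integrable (lebesgue_on \<Omega>) (\<lambda>x. 2 * (norm (f x))\<^sup>2 + 2 * (norm (g x))\<^sup>2)"
      using f g by (simp add: L2_def)
    show "AE x in lebesgue_on \<Omega>. norm ((norm (f x + g x))\<^sup>2) \<le> norm (2 * (norm (f x))\<^sup>2 + 2 * (norm (g x))\<^sup>2)"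
      using norm_add_sq_le by auto
  qed measurable
  then show "f + g \<in> L2 \<Omega>" by (simp add: L2_def plus_fun_def)
next
  fix c and f :: "real^'n \<Rightarrow> 'b" assume f: "f \<in> L2 \<Omega>"
  then show "c *\<^sub>R f \<in> L2 \<Omega>"
    by (auto simp: L2_def scaleR_fun_def power_mult_distrib)
qed

lemma integrable_inner_L2:
  fixes f g :: "real^'n::finite \<Rightarrow> 'b::euclidean_space"
  assumes "f \<in> L2 \<Omega>" "g \<in> L2 \<Omega>"
  shows "integrable (lebesgue_on \<Omega>) (\<lambda>x. f x \<bullet> g x)"
proof (rule Bochner_Integration.integrable_bound)
  show "integrable (lebesgue_on \<Omega>) (\<lambda>x. (norm (f x))\<^sup>2 + (norm (g x))\<^sup>2)"
    using assms by (simp add: L2_def)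
  show "(\<lambda>x. f x \<bullet> g x) \<in> borel_measurable (lebesgue_on \<Omega>)"
    using assms by (auto simp: L2_def)
  have "\<bar>f x \<bullet> g x\<bar> \<le> (norm (f x))\<^sup>2 + (norm (g x))\<^sup>2" for x
  proof -
    have "\<bar>f x \<bullet> g x\<bar> \<le> norm (f x) * norm (g x)" by (rule Cauchy_Schwarz_ineq2)
    also have "2 * \<dots> \<le> (norm (f x))\<^sup>2 + (norm (g x))\<^sup>2"
      using sum_squares_bound[of "norm (f x)" "norm (g x)"] by simp
    moreover have "0 \<le> norm (f x) * norm (g x)" by simp
    ultimately show ?thesis by linarith
  qed
  then show "AE x in lebesgue_on \<Omega>. norm (f x \<bullet> g x) \<le> norm ((norm (f x))\<^sup>2 + (norm (g x))\<^sup>2)"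
    by auto
qed

lemma l2norm_eq_sqrt_l2inner: "l2norm \<Omega> f = sqrt (l2inner \<Omega> f f)"
  by (simp add: l2norm_def l2inner_def power2_norm_eq_inner)

lemma semi_inner_L2: "semi_inner (L2 \<Omega> :: (real^'n::finite \<Rightarrow> 'b::euclidean_space) set) (l2inner \<Omega>)"
proof
  fix f g h :: "real^'n \<Rightarrow> 'b" and c :: real
  show "subspace (L2 \<Omega> :: (real^'n \<Rightarrow> 'b) set)" by (rule subspace_L2)
  show "l2inner \<Omega> (f + g) h = l2inner \<Omega> f h + l2inner \<Omega> g h" if "f \<in> L2 \<Omega>" "g \<in> L2 \<Omega>" "h \<in> L2 \<Omega>"
    using that by (simp add: l2inner_def inner_add_left integrable_inner_L2)
  show "l2inner \<Omega> (c *\<^sub>R f) h = c * l2inner \<Omega> f h"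
    by (simp add: l2inner_def scaleR_fun_def)
  show "l2inner \<Omega> f g = l2inner \<Omega> g f"
    by (simp add: l2inner_def inner_commute)
  show "0 \<le> l2inner \<Omega> f f"
    by (simp add: l2inner_def)
qed

lemma nm_l2inner: "semi_inner.nm (l2inner \<Omega>) = (l2norm \<Omega> :: (real^'n::finite \<Rightarrow> 'b::euclidean_space) \<Rightarrow> real)"
  by (rule ext) (simp add: semi_inner.nm_def[OF semi_inner_L2] l2norm_eq_sqrt_l2inner)

text \<open>Interpreted for every \<Omega> and every value type. Completeness is proved below for
  domains of finite measure and is invoked through \<open>semi_hilbert_L2\<close>.\<close>

interpretation L2: semi_inner "L2 \<Omega> :: (real^'n::finite \<Rightarrow> 'b::euclidean_space) set" "l2inner \<Omega>"
  rewrites "semi_inner.nm (l2inner \<Omega>) = (l2norm \<Omega> :: (real^'n \<Rightarrow> 'b) \<Rightarrow> real)"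
  for \<Omega>
  by (rule semi_inner_L2, rule nm_l2inner)

lemma l2norm_nonneg [simp]: "0 \<le> l2norm \<Omega> f"
  by (simp add: l2norm_def)

lemma l2inner_cong_AE:
  assumes "f \<in> L2 \<Omega>" "f' \<in> L2 \<Omega>" "g \<in> L2 \<Omega>" "g' \<in> L2 \<Omega>"
    and "AE x in lebesgue_on \<Omega>. f x = f' x" "AE x in lebesgue_on \<Omega>. g x = g' x"
  shows "l2inner \<Omega> f g = l2inner \<Omega> f' g'"
  unfolding l2inner_def
proof (rule integral_cong_AE)
  show "(\<lambda>x. f x \<bullet> g x) \<in> borel_measurable (lebesgue_on \<Omega>)" "(\<lambda>x. f' x \<bullet> g' x) \<in> borel_measurable (lebesgue_on \<Omega>)"
    using integrable_inner_L2 assms by blast+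
  show "AE x in lebesgue_on \<Omega>. f x \<bullet> g x = f' x \<bullet> g' x"
    using assms(5,6) by eventually_elim simp
qed

lemma l2norm_cong_AE:
  assumes "f \<in> L2 \<Omega>" "g \<in> L2 \<Omega>" "AE x in lebesgue_on \<Omega>. f x = g x"
  shows "l2norm \<Omega> f = l2norm \<Omega> g"
  using l2inner_cong_AE[of f \<Omega> g f g] assms by (simp add: l2norm_eq_sqrt_l2inner)

lemma l2norm_eq_0_iff:
  assumes "f \<in> L2 \<Omega>"
  shows "l2norm \<Omega> f = 0 \<longleftrightarrow> (AE x in lebesgue_on \<Omega>. f x = 0)"
  using integral_nonneg_eq_0_iff_AE[of "lebesgue_on \<Omega>" "\<lambda>x. (norm (f x))\<^sup>2"] assms
  by (simp add: l2norm_def L2_def)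

text \<open>Serves for components of fields, products with a coordinate and multiplication by a
  bounded matrix; hence the two value types may differ.\<close>

lemma L2_mono:
  fixes f :: "real^'n::finite \<Rightarrow> 'b::euclidean_space" and g :: "real^'n \<Rightarrow> 'c::euclidean_space"
  assumes f: "f \<in> borel_measurable (lebesgue_on \<Omega>)" and g: "g \<in> L2 \<Omega>" and C: "0 \<le> C"
    and le: "AE x in lebesgue_on \<Omega>. norm (f x) \<le> C * norm (g x)"
  shows "f \<in> L2 \<Omega>" "l2norm \<Omega> f \<le> C * l2norm \<Omega> g"
proof -
  have int: "integrable (lebesgue_on \<Omega>) (\<lambda>x. C\<^sup>2 * (norm (g x))\<^sup>2)" using g by (simp add: L2_def)
  have le2: "AE x in lebesgue_on \<Omega>. (norm (f x))\<^sup>2 \<le> C\<^sup>2 * (norm (g x))\<^sup>2"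
    using le by eventually_elim (metis norm_ge_zero power_mono power_mult_distrib)
  have "integrable (lebesgue_on \<Omega>) (\<lambda>x. (norm (f x))\<^sup>2)"
    by (rule Bochner_Integration.integrable_bound[OF int]) (use f le2 in auto)
  with f show fL: "f \<in> L2 \<Omega>" by (simp add: L2_def)
  have "(\<integral>x. (norm (f x))\<^sup>2 \<partial>lebesgue_on \<Omega>) \<le> (\<integral>x. C\<^sup>2 * (norm (g x))\<^sup>2 \<partial>lebesgue_on \<Omega>)"
    using fL int le2 by (intro integral_mono_AE) (auto simp: L2_def)
  then have "l2norm \<Omega> f \<le> sqrt (C\<^sup>2 * (\<integral>x. (norm (g x))\<^sup>2 \<partial>lebesgue_on \<Omega>))"
    by (simp add: l2norm_def)
  then show "l2norm \<Omega> f \<le> C * l2norm \<Omega> g"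
    using C by (simp add: l2norm_def real_sqrt_mult)
qed

lemma bounded_in_L2:
  fixes f :: "real^'n::finite \<Rightarrow> 'b::euclidean_space"
  assumes "\<Omega> \<in> lmeasurable" "f \<in> borel_measurable (lebesgue_on \<Omega>)" "\<And>x. norm (f x) \<le> C"
  shows "f \<in> L2 \<Omega>"
proof -
  interpret finite_measure "lebesgue_on \<Omega>" using assms(1) by (rule finite_measure_lebesgue_on)
  have "integrable (lebesgue_on \<Omega>) (\<lambda>x. (norm (f x))\<^sup>2)"
    using assms by (intro integrable_const_bound[of _ "C\<^sup>2"]) (auto intro!: power_mono)
  then show ?thesis using assms by (simp add: L2_def)
qed

text \<open>Cauchy-Schwarz against the constant 1, which is square integrable on a domain of finite
  measure.\<close>

lemma L2_imp_integrable:
  fixes f :: "real^'n::finite \<Rightarrow> 'b::euclidean_space"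
  assumes \<Omega>: "\<Omega> \<in> lmeasurable" and f: "f \<in> L2 \<Omega>"
  shows "integrable (lebesgue_on \<Omega>) f"
    "(\<integral>x. norm (f x) \<partial>lebesgue_on \<Omega>) \<le> l2norm \<Omega> f * l2norm \<Omega> (\<lambda>x. 1::real)"
proof -
  have 1: "(\<lambda>x. 1::real) \<in> L2 \<Omega>" using \<Omega> by (intro bounded_in_L2[where C = 1]) auto
  have n: "(\<lambda>x. norm (f x)) \<in> L2 \<Omega>"
    using f measurable_compose[OF borel_measurable_L2[OF f] borel_measurable_norm] by (simp add: L2_def)
  show "integrable (lebesgue_on \<Omega>) f"
    using integrable_inner_L2[OF n 1] borel_measurable_L2[OF f]
    by (simp add: integrable_norm_iff)
  show "(\<integral>x. norm (f x) \<partial>lebesgue_on \<Omega>) \<le> l2norm \<Omega> f * l2norm \<Omega> (\<lambda>x. 1::real)"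
    using L2.cauchy_schwarz[OF n 1] by (simp add: l2inner_def l2norm_def)
qed

text \<open>On a domain of finite measure the sequence is Cauchy in the mean, so a subsequence
  converges almost everywhere. Fatou's lemma shows that the pointwise limit is the limit of the
  whole sequence in norm.\<close>

lemma L2_complete:
  fixes X :: "nat \<Rightarrow> real^'n::finite \<Rightarrow> 'b::euclidean_space"
  assumes \<Omega>: "\<Omega> \<in> lmeasurable" and X: "\<And>n. X n \<in> L2 \<Omega>"
    and C: "\<And>e. e > 0 \<Longrightarrow> \<exists>N. \<forall>m\<ge>N. \<forall>n\<ge>N. l2norm \<Omega> (X m - X n) < e"
  shows "\<exists>f\<in>L2 \<Omega>. (\<lambda>n. l2norm \<Omega> (X n - f)) \<longlonglongrightarrow> 0"
proof -
  let ?M = "lebesgue_on \<Omega>"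
  have [measurable]: "X n \<in> borel_measurable ?M" for n using X by (simp add: L2_def)
  \<comment> \<open>The summand 1 keeps D positive even if \<Omega> is a null set.\<close>
  define D where "D = l2norm \<Omega> (\<lambda>x::real^'n. 1::real) + 1"
  have D: "D > 0" unfolding D_def by (simp add: add_nonneg_pos)
  obtain r where r: "strict_mono r" and cau: "AE x in ?M. Cauchy (\<lambda>i. X (r i) x)"
  proof (rule cauchy_L1_AE_cauchy_subseq[of ?M X])
    show "integrable ?M (X n)" for n using L2_imp_integrable \<Omega> X by blast
    fix e :: real assume e: "0 < e"
    then obtain N where N: "\<And>m n. m \<ge> N \<Longrightarrow> n \<ge> N \<Longrightarrow> l2norm \<Omega> (X m - X n) < e / D"
      using C[of "e / D"] D by auto
    have "(\<integral>x. norm (X i x - X j x) \<partial>?M) < e" if "i \<ge> N" "j \<ge> N" for i j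
    proof -
      have "(\<integral>x. norm (X i x - X j x) \<partial>?M) \<le> l2norm \<Omega> (X i - X j) * l2norm \<Omega> (\<lambda>x::real^'n. 1::real)"
        using L2_imp_integrable(2)[OF \<Omega> L2.H_diff[OF X X], of i j] by simp
      also have "\<dots> \<le> l2norm \<Omega> (X i - X j) * D"
        unfolding D_def by (intro mult_left_mono) auto
      also have "\<dots> < e" using N[OF that] D by (simp add: field_simps)
      finally show ?thesis .
    qed
    then show "\<exists>N. \<forall>i\<ge>N. \<forall>j\<ge>N. (\<integral>x. norm (X i x - X j x) \<partial>?M) < e" by blast
  qed blast
  define f where "f x = lim (\<lambda>i. X (r i) x)" for x
  have [measurable]: "f \<in> borel_measurable ?M"
    unfolding f_def by (rule borel_measurable_lim_metric) simp
  have lim: "AE x in ?M. (\<lambda>i. X (r i) x) \<longlonglongrightarrow> f x"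
    using cau by eventually_elim (simp add: f_def Cauchy_convergent_iff convergent_LIMSEQ_iff)
  \<comment> \<open>Membership of f in \<open>L2\<close> is not yet known and is read off from this
    bound, which is Fatou's lemma along the subsequence with n fixed.\<close>
  have close: "X n - f \<in> L2 \<Omega> \<and> l2norm \<Omega> (X n - f) \<le> e"
    if e: "e > 0" and N: "\<And>m n. m \<ge> N \<Longrightarrow> n \<ge> N \<Longrightarrow> l2norm \<Omega> (X m - X n) < e" and n: "n \<ge> N" for e N n
  proof -
    have "(\<integral>\<^sup>+x. (norm (X n x - f x))\<^sup>2 \<partial>?M) \<le> (\<integral>\<^sup>+x. liminf (\<lambda>i. ennreal ((norm (X n x - X (r i) x))\<^sup>2)) \<partial>?M)"
    proof (rule nn_integral_mono_AE)
      show "AE x in ?M. ennreal ((norm (X n x - f x))\<^sup>2) \<le> liminf (\<lambda>i. ennreal ((norm (X n x - X (r i) x))\<^sup>2))"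
        using lim
      proof eventually_elim
        case (elim x)
        then have "(\<lambda>i. ennreal ((norm (X n x - X (r i) x))\<^sup>2)) \<longlonglongrightarrow> ennreal ((norm (X n x - f x))\<^sup>2)"
          by (intro tendsto_intros)
        from lim_imp_Liminf[OF trivial_limit_sequentially this] show ?case by (rule eq_refl[OF sym])
      qed
    qed
    also have "\<dots> \<le> liminf (\<lambda>i. \<integral>\<^sup>+x. ennreal ((norm (X n x - X (r i) x))\<^sup>2) \<partial>?M)"
      by (rule nn_integral_liminf) measurable
    also have "\<dots> \<le> ennreal (e\<^sup>2)"
    proof (rule Liminf_le)
      have "(\<integral>\<^sup>+x. ennreal ((norm (X n x - X (r i) x))\<^sup>2) \<partial>?M) \<le> ennreal (e\<^sup>2)" if "i \<ge> N" for i
      proof -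
        have L: "X n - X (r i) \<in> L2 \<Omega>" using X by simp
        have "r i \<ge> N" using that seq_suble[OF r, of i] by simp
        then have "(l2norm \<Omega> (X n - X (r i)))\<^sup>2 \<le> e\<^sup>2" using N[OF n] by (intro power_mono) (auto intro: less_imp_le)
        then show ?thesis using L
          by (subst nn_integral_eq_integral) (auto simp: L2_def l2norm_def)
      qed
      then show "\<forall>\<^sub>F i in sequentially. (\<integral>\<^sup>+x. ennreal ((norm (X n x - X (r i) x))\<^sup>2) \<partial>?M) \<le> ennreal (e\<^sup>2)"
        by (auto simp: eventually_sequentially)
    qed simp
    finally have le: "(\<integral>\<^sup>+x. (norm (X n x - f x))\<^sup>2 \<partial>?M) \<le> ennreal (e\<^sup>2)" .
    then have int: "integrable ?M (\<lambda>x. (norm (X n x - f x))\<^sup>2)"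
      by (intro integrableI_bounded) (auto simp: le_less_trans[OF _ ennreal_less_top])
    then have "(\<integral>x. (norm (X n x - f x))\<^sup>2 \<partial>?M) \<le> e\<^sup>2"
      using le by (simp add: nn_integral_eq_integral)
    then have "l2norm \<Omega> (X n - f) \<le> e"
      unfolding l2norm_def using e real_le_lsqrt by (simp add: real_sqrt_le_iff' less_imp_le)
    with int show ?thesis by (simp add: L2_def fun_diff_def)
  qed
  have "f \<in> L2 \<Omega>"
  proof -
    obtain N where "\<And>m n. m \<ge> N \<Longrightarrow> n \<ge> N \<Longrightarrow> l2norm \<Omega> (X m - X n) < 1"
      using C[of 1] by auto
    then have "X N - f \<in> L2 \<Omega>" using close[of 1 N N] by simp
    from L2.H_diff[OF X[of N] this] show ?thesis by simp
  qed
  moreover have "(\<lambda>n. l2norm \<Omega> (X n - f)) \<longlonglongrightarrow> 0"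
  proof (rule LIMSEQ_I)
    fix e :: real assume e: "0 < e"
    obtain N where "\<And>m n. m \<ge> N \<Longrightarrow> n \<ge> N \<Longrightarrow> l2norm \<Omega> (X m - X n) < e / 2"
      using C[of "e / 2"] e by auto
    then have "l2norm \<Omega> (X n - f) < e" if "n \<ge> N" for n
      using close[of "e / 2" N n] that e by fastforce
    then show "\<exists>N. \<forall>n\<ge>N. norm (l2norm \<Omega> (X n - f) - 0) < e" by auto
  qed
  ultimately show ?thesis by blast
qed

lemma semi_hilbert_L2:
  assumes "\<Omega> \<in> lmeasurable"
  shows "semi_hilbert (L2 \<Omega> :: (real^'n::finite \<Rightarrow> 'b::euclidean_space) set) (l2inner \<Omega>)"
proof -
  interpret semi_inner "L2 \<Omega> :: (real^'n \<Rightarrow> 'b) set" "l2inner \<Omega>" by (rule semi_inner_L2)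
  show ?thesis
    by unfold_locales (unfold nm_l2inner, rule L2_complete[OF assms])
qed

section \<open>Calculus of test functions\<close>

lemma has_real_derivative_line:
  assumes "g differentiable (at (x + t *\<^sub>R axis i 1))"
  shows "((\<lambda>t. g (x + t *\<^sub>R axis i 1)) has_real_derivative partial i g (x + t *\<^sub>R axis i 1)) (at t)"
proof -
  let ?y = "x + t *\<^sub>R axis i 1 :: real^'a"
  have "(g has_derivative frechet_derivative g (at ?y)) (at ?y)"
    using assms frechet_derivative_works by blast
  then have "((\<lambda>t. g (x + t *\<^sub>R axis i 1)) has_derivative (\<lambda>s. frechet_derivative g (at ?y) (s *\<^sub>R axis i 1))) (at t)"
    by (rule has_derivative_compose[rotated]) (auto intro!: derivative_eq_intros)
  moreover have "frechet_derivative g (at ?y) (s *\<^sub>R axis i 1) = partial i g ?y * s" for s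
    using linear_frechet_derivative[OF assms] by (simp add: linear_scale partial_def)
  ultimately show ?thesis by (simp add: has_field_derivative_def)
qed

lemma partial_eq_frechet:
  "(g has_derivative g') (at x) \<Longrightarrow> partial i g x = g' (axis i 1)"
  by (metis frechet_derivative_at partial_def)

lemma partial_add:
  assumes "f differentiable (at x)" "g differentiable (at x)"
  shows "partial i (\<lambda>x. f x + g x) x = partial i f x + partial i g x"
  using partial_eq_frechet[OF has_derivative_add[OF assms[unfolded frechet_derivative_works]]]
  by (simp add: partial_def)

lemma partial_scale:
  assumes "f differentiable (at x)"
  shows "partial i (\<lambda>x. c * f x) x = c * partial i f x"
  using partial_eq_frechet[OF has_derivative_mult_right[OF assms[unfolded frechet_derivative_works]]]
  by (simp add: partial_def)

lemma partial_mult: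
  assumes "f differentiable (at x)" "g differentiable (at x)"
  shows "partial i (\<lambda>x. f x * g x) x = f x * partial i g x + partial i f x * g x"
  using partial_eq_frechet[OF has_derivative_mult[OF assms[unfolded frechet_derivative_works]]]
  by (simp add: partial_def)

lemma partial_coord: "partial i (\<lambda>x. x $ j) x = (if i = j then 1 else 0)"
  using partial_eq_frechet[OF bounded_linear_imp_has_derivative[OF bounded_linear_vec_nth], of i j x]
  by (simp add: axis_def)

text \<open>Off the closed set K the function vanishes on a whole neighbourhood of the
  point.\<close>

lemma partial_zero_outside:
  assumes "closed K" "\<And>y. y \<notin> K \<Longrightarrow> g y = 0" "x \<notin> K"
  shows "partial i g x = 0"
proof -
  have "open (- K)" using assms by auto
  then have "(g has_derivative (\<lambda>_. 0)) (at x)"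
    using assms by (intro has_derivative_transform_within_open[OF has_derivative_const[of 0], of "-K"]) auto
  then show ?thesis by (simp add: partial_eq_frechet)
qed

lemma bounded_compact_support:
  fixes g :: "'a::topological_space \<Rightarrow> 'b::real_normed_vector"
  assumes "compact K" "continuous_on UNIV g" "\<And>y. y \<notin> K \<Longrightarrow> g y = 0"
  shows "\<exists>B\<ge>0. \<forall>x. norm (g x) \<le> B"
proof -
  have "bounded (g ` K)"
    using assms compact_continuous_image continuous_on_subset compact_imp_bounded by (metis subset_UNIV)
  then obtain B where "\<forall>x\<in>K. norm (g x) \<le> B" by (auto simp: bounded_iff)
  then have "norm (g x) \<le> \<bar>B\<bar>" for x using assms(3)[of x] by (cases "x \<in> K") force+
  then show ?thesis by (intro exI[of _ "\<bar>B\<bar>"]) auto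
qed

text \<open>The integrals of the difference quotients vanish by translation invariance, so Fubini is not needed.\<close>

lemma integral_partial_eq_0:
  fixes g :: "real^'n::finite \<Rightarrow> real"
  assumes diff: "\<And>x. g differentiable (at x)" and cont: "continuous_on UNIV (partial i g)"
    and K: "compact K" "\<And>x. x \<notin> K \<Longrightarrow> g x = 0"
  shows "(\<integral>x. partial i g x \<partial>lborel) = 0"
proof -
  let ?e = "axis i 1 :: real^'n"
  define h :: "nat \<Rightarrow> real" where "h k = 1 / real (Suc k)" for k
  have h: "0 < h k" "h k \<le> 1" for k by (auto simp: h_def)
  have h0: "h \<longlonglongrightarrow> 0" unfolding h_def by (rule LIMSEQ_Suc[OF lim_1_over_n])
  define s where "s k x = (g (x + h k *\<^sub>R ?e) - g x) / h k" for k x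
  have contg: "continuous_on UNIV g"
    using diff by (simp add: continuous_on_eq_continuous_at differentiable_imp_continuous_within)
  then have [measurable]: "g \<in> borel_measurable borel" by (rule borel_measurable_continuous_onI)
  have [measurable]: "partial i g \<in> borel_measurable borel" using cont by (rule borel_measurable_continuous_onI)
  obtain R where R: "\<And>x. x \<in> K \<Longrightarrow> norm x \<le> R"
    using K(1) compact_imp_bounded bounded_iff by metis
  obtain B where B: "B \<ge> 0" "\<And>x. \<bar>partial i g x\<bar> \<le> B"
    using bounded_compact_support[OF K(1) cont] partial_zero_outside[OF compact_imp_closed[OF K(1)] K(2)] by auto
  obtain Bg where Bg: "Bg \<ge> 0" "\<And>x. \<bar>g x\<bar> \<le> Bg"
    using bounded_compact_support[OF K(1) contg K(2)] by auto
  have intg: "integrable lborel g"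
  proof (rule Bochner_Integration.integrable_bound[of _ "\<lambda>x. Bg * indicator K x"])
    show "integrable lborel (\<lambda>x. Bg * indicator K x :: real)"
      using borel_compact[OF K(1)] emeasure_compact_finite[OF K(1)]
      by (intro integrable_mult_right integrable_real_indicator) simp_all
    show "AE x in lborel. norm (g x) \<le> norm (Bg * indicator K x :: real)"
      using Bg K(2) by (auto simp: indicator_def)
  qed measurable
  have lim: "(\<lambda>k. s k x) \<longlonglongrightarrow> partial i g x" for x
  proof -
    have "((\<lambda>t. (g (x + t *\<^sub>R ?e) - g x) / t) \<longlongrightarrow> partial i g x) (at 0)"
      using has_real_derivative_line[of g x 0 i] diff by (simp add: has_field_derivative_iff)
    moreover have "filterlim h (at 0) sequentially"
      using h0 h by (auto simp: filterlim_at eventually_sequentially less_imp_neq[symmetric] intro!: exI[of _ 0])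
    ultimately show ?thesis unfolding s_def by (rule filterlim_compose)
  qed
  \<comment> \<open>The dominating function: the mean value theorem bounds the quotients by the
    supremum of the partial derivative, and steps of length at most 1 keep their support in the ball
    of radius \<open>R + 1\<close>.\<close>
  have bound: "\<bar>s k x\<bar> \<le> B * indicator (cball 0 (R + 1)) x" for k x
  proof (cases "x \<in> cball 0 (R + 1)")
    case True
    obtain z where "g (x + h k *\<^sub>R ?e) - g (x + 0 *\<^sub>R ?e) = (h k - 0) * partial i g (x + z *\<^sub>R ?e)"
      using MVT2[of 0 "h k" "\<lambda>t. g (x + t *\<^sub>R ?e)" "\<lambda>t. partial i g (x + t *\<^sub>R ?e)"] h
        has_real_derivative_line[of g x _ i] diff by blast
    then have "s k x = partial i g (x + z *\<^sub>R ?e)" using h[of k] by (simp add: s_def)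
    then show ?thesis using B True by simp
  next
    case False
    have "norm x \<le> norm (x + h k *\<^sub>R ?e) + 1"
      using norm_triangle_ineq4[of "x + h k *\<^sub>R ?e" "h k *\<^sub>R ?e"] h[of k] by simp
    then have "x \<notin> K" "x + h k *\<^sub>R ?e \<notin> K" using False R[of x] R[of "x + h k *\<^sub>R ?e"] by auto
    then show ?thesis using K(2) B by (simp add: s_def)
  qed
  have "(\<lambda>k. \<integral>x. s k x \<partial>lborel) \<longlonglongrightarrow> (\<integral>x. partial i g x \<partial>lborel)"
  proof (rule integral_dominated_convergence)
    show "integrable lborel (\<lambda>x::real^'n. B * indicator (cball 0 (R + 1)) x :: real)"
      using emeasure_bounded_finite[OF bounded_cball, of "0::real^'n" "R + 1"]
      by (intro integrable_mult_right integrable_real_indicator) simp_all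
    show "s k \<in> borel_measurable lborel" for k unfolding s_def by measurable
  qed (use lim bound in auto)
  moreover have "(\<integral>x. s k x \<partial>lborel) = 0" for k
  proof -
    let ?c = "h k *\<^sub>R ?e"
    have d: "distr lborel borel ((+) ?c) = (lborel :: (real^'n) measure)" by (rule lborel_distr_plus)
    have 1: "integrable lborel (\<lambda>x. g (?c + x))"
      using intg integrable_distr_eq[of "(+) ?c" lborel borel g] d by simp
    have 2: "(\<integral>x. g (?c + x) \<partial>lborel) = (\<integral>x. g x \<partial>lborel)"
      using integral_distr[of "(+) ?c" lborel borel g] d by simp
    show ?thesis using 1 2 intg by (simp add: s_def add.commute)
  qed
  ultimately show ?thesis by (simp add: LIMSEQ_const_iff)
qed

section \<open>The space of test functions\<close>

lemma differentiable_iter_partial: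
  "\<phi> \<in> test_functions \<Omega> \<Longrightarrow> iter_partial is \<phi> differentiable (at x)"
  by (auto simp: test_functions_def Ck_on_def)

text \<open>Differentiability of every iterated partial derivative already gives continuity of all
  of them, so smoothness can be checked by induction on the list of directions.\<close>

lemma test_functionI:
  assumes "\<And>is x. iter_partial is \<phi> differentiable (at x)" "compact K" "K \<subseteq> \<Omega>" "\<And>x. x \<notin> K \<Longrightarrow> \<phi> x = 0"
  shows "\<phi> \<in> test_functions \<Omega>"
proof -
  have "closure {x. \<phi> x \<noteq> 0} \<subseteq> K"
    using assms compact_imp_closed by (intro closure_minimal) auto
  moreover from this have "compact (closure {x. \<phi> x \<noteq> 0})"
    using assms(2) compact_closure bounded_subset compact_imp_bounded closure_subset by (metis order_trans)
  ultimately show ?thesis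
    using assms by (auto simp: test_functions_def Ck_on_def continuous_on_eq_continuous_at
        differentiable_imp_continuous_within)
qed

lemma test_function_support:
  assumes "\<phi> \<in> test_functions \<Omega>"
  obtains K where "compact K" "K \<subseteq> \<Omega>" "\<And>x. x \<notin> K \<Longrightarrow> \<phi> x = 0" "\<And>x i. x \<notin> K \<Longrightarrow> partial i \<phi> x = 0"
proof
  let ?K = "closure {x. \<phi> x \<noteq> 0}"
  show "compact ?K" "?K \<subseteq> \<Omega>" using assms by (auto simp: test_functions_def)
  show z: "\<phi> x = 0" if "x \<notin> ?K" for x using that closure_subset[of "{x. \<phi> x \<noteq> 0}"] by auto
  show "partial i \<phi> x = 0" if "x \<notin> ?K" for x i by (rule partial_zero_outside[OF closed_closure z that])
qed

lemma test_function_differentiable: "\<phi> \<in> test_functions \<Omega> \<Longrightarrow> \<phi> differentiable (at x)"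
  using differentiable_iter_partial[of \<phi> \<Omega> "[]"] by simp

lemma test_function_continuous: "\<phi> \<in> test_functions \<Omega> \<Longrightarrow> continuous_on UNIV \<phi>"
  by (simp add: continuous_on_eq_continuous_at differentiable_imp_continuous_within test_function_differentiable)

lemma test_function_partial_continuous: "\<phi> \<in> test_functions \<Omega> \<Longrightarrow> continuous_on UNIV (partial i \<phi>)"
  using differentiable_iter_partial[of \<phi> \<Omega> "[i]"]
  by (simp add: continuous_on_eq_continuous_at differentiable_imp_continuous_within)

lemma iter_partial_add:
  assumes "\<And>is x. iter_partial is f differentiable (at x)" "\<And>is x. iter_partial is g differentiable (at x)"
  shows "iter_partial is (\<lambda>x. f x + g x) = (\<lambda>x. iter_partial is f x + iter_partial is g x)"
  by (induction "is") (auto simp: partial_add assms)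

lemma iter_partial_scale:
  assumes "\<And>is x. iter_partial is f differentiable (at x)"
  shows "iter_partial is (\<lambda>x. c * f x) = (\<lambda>x. c * iter_partial is f x)"
  by (induction "is") (auto simp: partial_scale assms)

lemma test_function_add:
  assumes "\<phi> \<in> test_functions \<Omega>" "\<psi> \<in> test_functions \<Omega>"
  shows "(\<lambda>x. \<phi> x + \<psi> x) \<in> test_functions \<Omega>"
proof -
  obtain K where K: "compact K" "K \<subseteq> \<Omega>" "\<And>x. x \<notin> K \<Longrightarrow> \<phi> x = 0" using test_function_support[OF assms(1)] by metis
  obtain L where L: "compact L" "L \<subseteq> \<Omega>" "\<And>x. x \<notin> L \<Longrightarrow> \<psi> x = 0" using test_function_support[OF assms(2)] by metis
  show ?thesis
    using K L differentiable_iter_partial[OF assms(1)] differentiable_iter_partial[OF assms(2)]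
    by (intro test_functionI[of _ "K \<union> L"]) (auto simp: iter_partial_add intro!: differentiable_add)
qed

lemma test_function_scale:
  assumes "\<phi> \<in> test_functions \<Omega>"
  shows "(\<lambda>x. c * \<phi> x) \<in> test_functions \<Omega>"
proof -
  obtain K where K: "compact K" "K \<subseteq> \<Omega>" "\<And>x. x \<notin> K \<Longrightarrow> \<phi> x = 0" using test_function_support[OF assms(1)] by metis
  show ?thesis
    using K differentiable_iter_partial[OF assms(1)]
    by (intro test_functionI[of _ K]) (auto simp: iter_partial_scale intro!: differentiable_mult)
qed

lemma test_function_zero: "(\<lambda>x. 0) \<in> test_functions \<Omega>"
proof -
  have "partial i (\<lambda>x. 0) = (\<lambda>x. 0)" for i :: 'a
    using partial_zero_outside[of "{}" "\<lambda>x. 0" _ i] by auto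
  then have "iter_partial is (\<lambda>x. 0) = (\<lambda>x. 0)" for "is" :: "'a list"
    by (induction "is") auto
  then show ?thesis by (intro test_functionI[of _ "{}"]) auto
qed

lemma grad_add:
  assumes "\<phi> \<in> test_functions \<Omega>" "\<psi> \<in> test_functions \<Omega>"
  shows "grad (\<lambda>x. \<phi> x + \<psi> x) = (\<lambda>x. grad \<phi> x + grad \<psi> x)"
  using partial_add[OF test_function_differentiable[OF assms(1)] test_function_differentiable[OF assms(2)]]
  by (simp add: grad_def vec_eq_iff fun_eq_iff)

lemma grad_scale:
  assumes "\<phi> \<in> test_functions \<Omega>"
  shows "grad (\<lambda>x. c * \<phi> x) = (\<lambda>x. c *\<^sub>R grad \<phi> x)"
  using partial_scale[OF test_function_differentiable[OF assms]]
  by (simp add: grad_def vec_eq_iff fun_eq_iff)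

lemma continuous_imp_measurable_lebesgue_on:
  fixes g :: "real^'n::finite \<Rightarrow> 'b::euclidean_space"
  assumes "continuous_on UNIV g"
  shows "g \<in> borel_measurable (lebesgue_on \<Omega>)"
proof (rule measurable_restrict_space1, rule measurable_completion)
  show "g \<in> borel_measurable lborel" using borel_measurable_continuous_onI[OF assms] by simp
qed

lemma compact_support_in_L2:
  fixes g :: "real^'n::finite \<Rightarrow> 'b::euclidean_space"
  assumes "\<Omega> \<in> lmeasurable" "compact K" "continuous_on UNIV g" "\<And>y. y \<notin> K \<Longrightarrow> g y = 0"
  shows "g \<in> L2 \<Omega>"
proof -
  obtain B where "\<And>x. norm (g x) \<le> B" using bounded_compact_support[OF assms(2-4)] by auto
  then show ?thesis by (rule bounded_in_L2[OF assms(1) continuous_imp_measurable_lebesgue_on[OF assms(3)]])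
qed

lemma continuous_grad:
  assumes "\<phi> \<in> test_functions \<Omega>"
  shows "continuous_on UNIV (grad \<phi>)"
  unfolding grad_def using test_function_partial_continuous[OF assms] by (intro continuous_on_vec_lambda) auto

lemma test_function_L2:
  fixes \<phi> :: "real^'n::finite \<Rightarrow> real"
  assumes "\<Omega> \<in> lmeasurable" "\<phi> \<in> test_functions \<Omega>"
  shows "\<phi> \<in> L2 \<Omega>" "partial i \<phi> \<in> L2 \<Omega>" "grad \<phi> \<in> L2 \<Omega>"
proof -
  obtain K where K: "compact K" "\<And>x. x \<notin> K \<Longrightarrow> \<phi> x = 0" "\<And>x i. x \<notin> K \<Longrightarrow> partial i \<phi> x = 0"
    using test_function_support[OF assms(2)] by metis
  show "\<phi> \<in> L2 \<Omega>" using compact_support_in_L2 K test_function_continuous assms by metis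
  show "partial i \<phi> \<in> L2 \<Omega>" using compact_support_in_L2 K test_function_partial_continuous assms by metis
  have "grad \<phi> x = 0" if "x \<notin> K" for x using K that by (simp add: grad_def vec_eq_iff)
  then show "grad \<phi> \<in> L2 \<Omega>" using compact_support_in_L2 K continuous_grad assms by metis
qed

section \<open>Integration by parts and the Poincare inequality\<close>

lemma integral_lebesgue_on_eq_lborel:
  fixes g :: "real^'n::finite \<Rightarrow> real"
  assumes "\<Omega> \<in> sets lebesgue" "continuous_on UNIV g" "\<And>y. y \<notin> \<Omega> \<Longrightarrow> g y = 0"
  shows "(\<integral>x. g x \<partial>lebesgue_on \<Omega>) = (\<integral>x. g x \<partial>lborel)"
proof -
  have "(\<integral>x. g x \<partial>lebesgue_on \<Omega>) = (\<integral>x. indicator \<Omega> x *\<^sub>R g x \<partial>lebesgue)"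
    using assms(1) by (intro integral_restrict_space) simp
  also have "(\<lambda>x. indicator \<Omega> x *\<^sub>R g x) = g" using assms(3) by (auto simp: fun_eq_iff indicator_def)
  also have "(\<integral>x. g x \<partial>lebesgue) = (\<integral>x. g x \<partial>lborel)"
    using borel_measurable_continuous_onI[OF assms(2)] by (intro integral_completion) simp
  finally show ?thesis .
qed

text \<open>The integrand is the partial derivative of the product of f and \<phi>, which has
  compact support because \<phi> has. Below, f is either a test function or a coordinate times a
  test function.\<close>

lemma test_function_by_parts:
  fixes \<phi> :: "real^'n::finite \<Rightarrow> real"
  assumes \<Omega>: "\<Omega> \<in> lmeasurable" and \<phi>: "\<phi> \<in> test_functions \<Omega>" and f: "\<And>x. f differentiable (at x)"
    and f': "continuous_on UNIV (partial i f)"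
  shows "(\<integral>x. f x * partial i \<phi> x + partial i f x * \<phi> x \<partial>lebesgue_on \<Omega>) = 0"
proof -
  obtain K where K: "compact K" "K \<subseteq> \<Omega>" "\<And>x. x \<notin> K \<Longrightarrow> \<phi> x = 0" "\<And>x i. x \<notin> K \<Longrightarrow> partial i \<phi> x = 0"
    using test_function_support[OF \<phi>] by metis
  have eq: "partial i (\<lambda>x. f x * \<phi> x) = (\<lambda>x. f x * partial i \<phi> x + partial i f x * \<phi> x)"
    using f test_function_differentiable[OF \<phi>] by (intro ext partial_mult)
  have cf: "continuous_on UNIV f"
    using f by (simp add: continuous_on_eq_continuous_at differentiable_imp_continuous_within)
  have cont: "continuous_on UNIV (\<lambda>x. f x * partial i \<phi> x + partial i f x * \<phi> x)"
    using test_function_continuous[OF \<phi>] test_function_partial_continuous[OF \<phi>] f' cf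
    by (intro continuous_intros) auto
  have "(\<integral>x. f x * partial i \<phi> x + partial i f x * \<phi> x \<partial>lebesgue_on \<Omega>)
      = (\<integral>x. f x * partial i \<phi> x + partial i f x * \<phi> x \<partial>lborel)"
    using \<Omega> K cont by (intro integral_lebesgue_on_eq_lborel) (auto simp: fmeasurableD subset_eq)
  also have "\<dots> = (\<integral>x. partial i (\<lambda>x. f x * \<phi> x) x \<partial>lborel)" by (simp add: eq)
  also have "\<dots> = 0"
    using K cont f test_function_differentiable[OF \<phi>]
    by (intro integral_partial_eq_0[of _ _ K]) (auto simp: eq intro!: differentiable_mult)
  finally show ?thesis .
qed

lemma test_function_weak_partial:
  fixes \<phi> :: "real^'n::finite \<Rightarrow> real"
  assumes \<Omega>: "\<Omega> \<in> lmeasurable" and \<phi>: "\<phi> \<in> test_functions \<Omega>"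
  shows "is_weak_partial \<Omega> i \<phi> (partial i \<phi>)"
  unfolding is_weak_partial_def
proof
  fix \<psi> assume \<psi>: "\<psi> \<in> test_functions \<Omega>"
  have "0 = (\<integral>x. \<phi> x * partial i \<psi> x + partial i \<phi> x * \<psi> x \<partial>lebesgue_on \<Omega>)"
    using test_function_by_parts[OF \<Omega> \<psi>] test_function_differentiable[OF \<phi>] test_function_partial_continuous[OF \<phi>]
    by metis
  also have "\<dots> = l2inner \<Omega> \<phi> (partial i \<psi>) + l2inner \<Omega> (partial i \<phi>) \<psi>"
    unfolding l2inner_def inner_real_def
    using integrable_inner_L2[OF test_function_L2(1)[OF \<Omega> \<phi>] test_function_L2(2)[OF \<Omega> \<psi>]]
      integrable_inner_L2[OF test_function_L2(2)[OF \<Omega> \<phi>] test_function_L2(1)[OF \<Omega> \<psi>]]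
    by (intro Bochner_Integration.integral_add) simp_all
  finally show "l2inner \<Omega> \<phi> (partial i \<psi>) = - l2inner \<Omega> (partial i \<phi>) \<psi>" by simp
qed

text \<open>Integrate \<open>\<partial>\<^sub>i (x\<^sub>i \<phi>\<^sup>2) = \<phi>\<^sup>2 + 2 x\<^sub>i \<phi> \<partial>\<^sub>i \<phi>\<close> for an arbitrary coordinate \<open>i\<close>.\<close>

lemma poincare_test_function:
  fixes \<phi> :: "real^'n::finite \<Rightarrow> real"
  assumes \<Omega>: "\<Omega> \<in> lmeasurable" and R: "\<And>x. x \<in> \<Omega> \<Longrightarrow> norm x \<le> R" "0 \<le> R" and \<phi>: "\<phi> \<in> test_functions \<Omega>"
  shows "l2norm \<Omega> \<phi> \<le> 2 * R * l2norm \<Omega> (grad \<phi>)"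
proof -
  obtain i :: 'n where True by simp
  note L = test_function_L2[OF \<Omega> \<phi>]
  define \<theta> where "\<theta> x = x $ i * partial i \<phi> x" for x
  have le: "norm (\<theta> x) \<le> R * norm (grad \<phi> x)" if "x \<in> \<Omega>" for x
  proof -
    have "\<bar>x $ i\<bar> \<le> R" using R(1)[OF that] component_le_norm_cart[of x i] by linarith
    moreover have "\<bar>partial i \<phi> x\<bar> \<le> norm (grad \<phi> x)"
      using component_le_norm_cart[of "grad \<phi> x" i] by (simp add: grad_def)
    ultimately show ?thesis unfolding \<theta>_def by (simp add: abs_mult mult_mono)
  qed
  have \<theta>: "\<theta> \<in> L2 \<Omega>" "l2norm \<Omega> \<theta> \<le> R * l2norm \<Omega> (grad \<phi>)"
  proof -
    have "\<theta> \<in> borel_measurable (lebesgue_on \<Omega>)"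
      unfolding \<theta>_def using test_function_partial_continuous[OF \<phi>]
      by (intro continuous_imp_measurable_lebesgue_on continuous_intros) auto
    moreover have "AE x in lebesgue_on \<Omega>. norm (\<theta> x) \<le> R * norm (grad \<phi> x)"
      using le by (intro AE_I2) (simp add: space_restrict_space)
    ultimately show "\<theta> \<in> L2 \<Omega>" "l2norm \<Omega> \<theta> \<le> R * l2norm \<Omega> (grad \<phi>)"
      using L2_mono[OF _ L(3) R(2)] by blast+
  qed
  have d: "(\<lambda>x. x $ i * \<phi> x) differentiable (at x)" for x
    by (rule differentiable_mult[OF bounded_linear_imp_differentiable[OF bounded_linear_vec_nth]
          test_function_differentiable[OF \<phi>]])
  have dp: "partial i (\<lambda>x. x $ i * \<phi> x) = (\<lambda>x. x $ i * partial i \<phi> x + \<phi> x)"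
    using partial_mult[OF bounded_linear_imp_differentiable[OF bounded_linear_vec_nth[of i]]
        test_function_differentiable[OF \<phi>]]
    by (simp add: partial_coord fun_eq_iff)
  have "0 = (\<integral>x. (x $ i * \<phi> x) * partial i \<phi> x + (x $ i * partial i \<phi> x + \<phi> x) * \<phi> x \<partial>lebesgue_on \<Omega>)"
    using test_function_by_parts[OF \<Omega> \<phi> d, of i] unfolding dp
    using test_function_continuous[OF \<phi>] test_function_partial_continuous[OF \<phi>] by (simp add: continuous_intros)
  also have "\<dots> = (\<integral>x. 2 * (\<phi> x \<bullet> \<theta> x) + \<phi> x \<bullet> \<phi> x \<partial>lebesgue_on \<Omega>)"
    by (simp add: \<theta>_def algebra_simps)
  also have "\<dots> = 2 * l2inner \<Omega> \<phi> \<theta> + l2inner \<Omega> \<phi> \<phi>"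
    unfolding l2inner_def using integrable_inner_L2[OF L(1) \<theta>(1)] integrable_inner_L2[OF L(1) L(1)]
    by (subst Bochner_Integration.integral_add) auto
  finally have "(l2norm \<Omega> \<phi>)\<^sup>2 = - 2 * l2inner \<Omega> \<phi> \<theta>" using L2.nm_sq[OF L(1)] by simp
  also have "\<dots> \<le> 2 * (l2norm \<Omega> \<phi> * l2norm \<Omega> \<theta>)" using L2.cauchy_schwarz[OF L(1) \<theta>(1)] by simp
  also have "\<dots> \<le> l2norm \<Omega> \<phi> * (2 * R * l2norm \<Omega> (grad \<phi>))"
    using \<theta>(2) mult_left_mono[OF \<theta>(2), of "2 * l2norm \<Omega> \<phi>"] by (simp add: mult_ac)
  finally have "l2norm \<Omega> \<phi> * l2norm \<Omega> \<phi> \<le> l2norm \<Omega> \<phi> * (2 * R * l2norm \<Omega> (grad \<phi>))"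
    by (simp add: power2_eq_square)
  then show ?thesis
    using R(2) by (cases "l2norm \<Omega> \<phi> = 0") (auto simp: mult_le_cancel_left dual_order.strict_iff_order)
qed

section \<open>The fundamental lemma of the calculus of variations\<close>

lemma power_times_exp_le:
  fixes x c :: real
  assumes "0 < x" "0 < c" "0 < n"
  shows "x ^ n * exp (- c * x) \<le> (real n / c) ^ n"
proof -
  \<comment> \<open>The estimate rests on \<open>(1 + y / n) ^ n \<le> exp y\<close> with
    \<open>y = c * x\<close>; the summand 1 is dropped on the left.\<close>
  have "(c / real n) ^ n * x ^ n = (c * x / real n) ^ n"
    by (simp add: power_mult_distrib power_divide)
  also have "\<dots> \<le> (1 + c * x / real n) ^ n"
    using assms by (intro power_mono) auto
  also have "\<dots> \<le> exp (c * x)"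
    using assms mult_pos_pos[of c x] by (intro exp_ge_one_plus_x_over_n_power_n) linarith+
  finally have "(c / real n) ^ n * x ^ n \<le> exp (c * x)" .
  then have "(real n / c) ^ n * ((c / real n) ^ n * x ^ n) \<le> (real n / c) ^ n * exp (c * x)"
    using assms by (intro mult_left_mono) auto
  moreover have "(real n / c) ^ n * (c / real n) ^ n = 1"
    using assms by (simp flip: power_mult_distrib)
  ultimately have "x ^ n \<le> (real n / c) ^ n * exp (c * x)" by (simp add: mult.assoc[symmetric])
  then have "x ^ n * exp (- c * x) \<le> (real n / c) ^ n * exp (c * x) * exp (- c * x)"
    by (intro mult_right_mono) auto
  also have "\<dots> = (real n / c) ^ n" by (simp add: mult.assoc flip: exp_add)
  finally show ?thesis .
qed

text \<open>The functions \<open>p s\<^sup>m exp (- c s)\<close> on \<open>(a, b)\<close>, where \<open>s = 1 / ((t - a) (b - t))\<close> and \<open>p\<close> is a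
  polynomial, extended by 0, form a class that is closed under differentiation: the exponent \<open>m\<close> is
  raised by 2 to bring the three terms of the derivative over a common denominator.\<close>

definition bump :: "real \<Rightarrow> real \<Rightarrow> real \<Rightarrow> real poly \<Rightarrow> nat \<Rightarrow> real \<Rightarrow> real" where
  "bump a b c p m t = (if a < t \<and> t < b
     then poly p t * (1 / ((t - a) * (b - t))) ^ m * exp (- c * (1 / ((t - a) * (b - t)))) else 0)"

text \<open>With \<open>r = (t - a) * (b - t)\<close> and \<open>s = 1 / r\<close>, the polynomial q
  is \<open>- r'\<close>, so \<open>s' = q * s\<^sup>2\<close>. The three summands come from
  differentiating p, the power of s and the exponential, after \<open>s ^ (m + 2)\<close> is
  factored out.\<close>

definition bump_pderiv :: "real \<Rightarrow> real \<Rightarrow> real \<Rightarrow> real poly \<Rightarrow> nat \<Rightarrow> real poly" where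
  "bump_pderiv a b c p m = (let r = [:- a, 1:] * [:b, - 1:]; q = [:- (a + b), 2:] in
     pderiv p * r\<^sup>2 + smult (real m) (p * q * r) - smult c (p * q))"

text \<open>This yields differentiability, with derivative 0, at the points \<open>t0\<close> outside \<open>(a, b)\<close>.\<close>

lemma bump_quadratic_bound:
  assumes c: "c > 0"
  shows "\<exists>K\<ge>0. \<forall>t t0. \<not> (a < t0 \<and> t0 < b) \<longrightarrow> \<bar>bump a b c p m t\<bar> \<le> K * (t - t0)\<^sup>2"
proof -
  have "bounded (poly p ` {a..b})"
    by (intro compact_imp_bounded compact_continuous_image continuous_intros) auto
  then obtain B where "\<forall>y\<in>poly p ` {a..b}. norm y \<le> B"
    unfolding bounded_iff by blast
  then have B: "\<bar>poly p t\<bar> \<le> B" if "t \<in> {a..b}" for t using that by simp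
  define E where "E = (real (m + 2) / c) ^ (m + 2)"
  have E: "E \<ge> 0" using c unfolding E_def by simp
  have "\<bar>bump a b c p m t\<bar> \<le> \<bar>B\<bar> * E * (b - a)\<^sup>2 * (t - t0)\<^sup>2" if t0: "\<not> (a < t0 \<and> t0 < b)" for t t0
  proof (cases "a < t \<and> t < b")
    case True
    define r where "r = (t - a) * (b - t)"
    have r: "r > 0" using True by (simp add: r_def)
    \<comment> \<open>Since t0 lies outside the open interval, one factor of r is at most
      \<open>|t - t0|\<close> and the other at most \<open>b - a\<close>.\<close>
    have rle: "r \<le> (b - a) * \<bar>t - t0\<bar>"
    proof (cases "t0 \<le> a")
      case True
      have "(b - t) * (t - a) \<le> (b - a) * \<bar>t - t0\<bar>"
        using True \<open>a < t \<and> t < b\<close> by (intro mult_mono) auto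
      then show ?thesis by (simp add: r_def mult.commute)
    next
      case False
      then show ?thesis unfolding r_def using t0 \<open>a < t \<and> t < b\<close> by (intro mult_mono) auto
    qed
    \<comment> \<open>The exponential still controls two extra powers of \<open>1 / r\<close>; they
      leave the factor \<open>r\<^sup>2\<close> that makes the bound quadratic.\<close>
    have "(1 / r) ^ m * exp (- c * (1 / r)) = (1 / r) ^ (m + 2) * exp (- c * (1 / r)) * r\<^sup>2"
      using r by (simp add: power_add power2_eq_square field_simps)
    also have "\<dots> \<le> E * r\<^sup>2"
      unfolding E_def using r c by (intro mult_right_mono power_times_exp_le) auto
    also have "\<dots> \<le> E * ((b - a) * \<bar>t - t0\<bar>)\<^sup>2"
      using E r rle by (intro mult_left_mono power_mono) auto
    finally have 1: "(1 / r) ^ m * exp (- c * (1 / r)) \<le> E * (b - a)\<^sup>2 * (t - t0)\<^sup>2"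
      by (simp add: power_mult_distrib)
    have "\<bar>bump a b c p m t\<bar> = \<bar>poly p t\<bar> * ((1 / r) ^ m * exp (- c * (1 / r)))"
      using True r by (simp add: bump_def r_def[symmetric] abs_mult)
    also have "\<dots> \<le> \<bar>B\<bar> * (E * (b - a)\<^sup>2 * (t - t0)\<^sup>2)"
    proof (rule mult_mono[OF _ 1])
      show "\<bar>poly p t\<bar> \<le> \<bar>B\<bar>" using B[of t] True by simp
    qed (use r in auto)
    finally show ?thesis by (simp add: mult.assoc)
  next
    case False
    then have "bump a b c p m t = 0" by (simp only: bump_def if_False)
    then show ?thesis using E by simp
  qed
  then show ?thesis using E by (intro exI[of _ "\<bar>B\<bar> * E * (b - a)\<^sup>2"]) auto
qed

text \<open>Inside the interval this is the product rule. Elsewhere, end points included, the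
  quadratic bound makes the difference quotients tend to 0.\<close>

lemma bump_has_derivative:
  assumes c: "c > 0"
  shows "(bump a b c p m has_real_derivative bump a b c (bump_pderiv a b c p m) (m + 2) t) (at t)"
proof (cases "a < t \<and> t < b")
  case True
  define r where "r x = (x - a) * (b - x)" for x
  have r: "r t \<noteq> 0" using True by (simp add: r_def)
  have dr: "(r has_real_derivative - (2 * t - (a + b))) (at t)"
    unfolding r_def by (auto intro!: derivative_eq_intros)
  have "((\<lambda>x. poly p x * (1 / r x) ^ m * exp (- c * (1 / r x))) has_real_derivative
     (poly (pderiv p) t * (r t)\<^sup>2 + real m * (poly p t * (2 * t - (a + b)) * r t) - c * (poly p t * (2 * t - (a + b))))
       * (1 / r t) ^ (m + 2) * exp (- c * (1 / r t))) (at t)"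
    using r
    by (auto intro!: derivative_eq_intros dr simp: power_add power2_eq_square)
      (cases m; simp add: field_simps power2_eq_square)
  then have "((\<lambda>x. poly p x * (1 / r x) ^ m * exp (- c * (1 / r x))) has_real_derivative
     bump a b c (bump_pderiv a b c p m) (m + 2) t) (at t)"
    using True by (simp add: bump_def bump_pderiv_def Let_def r_def algebra_simps)
  then show ?thesis
  proof (rule has_field_derivative_transform_within_open[of _ _ _ "{a<..<b}"])
    show "poly p x * (1 / r x) ^ m * exp (- c * (1 / r x)) = bump a b c p m x" if "x \<in> {a<..<b}" for x
      using that by (simp add: bump_def r_def)
  qed (use True in auto)
next
  case False
  then have z: "bump a b c q n t = 0" for q n by (simp only: bump_def if_False)
  obtain K where K: "K \<ge> 0" "\<And>x. \<bar>bump a b c p m x\<bar> \<le> K * (x - t)\<^sup>2"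
    using bump_quadratic_bound[OF c, of a b p m] False by blast
  have "((\<lambda>x. (bump a b c p m x - bump a b c p m t) / (x - t)) \<longlongrightarrow> 0) (at t)"
  proof (rule Lim_null_comparison)
    show "\<forall>\<^sub>F x in at t. norm ((bump a b c p m x - bump a b c p m t) / (x - t)) \<le> K * \<bar>x - t\<bar>"
    proof (rule always_eventually, rule allI)
      fix x
      show "norm ((bump a b c p m x - bump a b c p m t) / (x - t)) \<le> K * \<bar>x - t\<bar>"
      proof (cases "x = t")
        case False
        have "\<bar>bump a b c p m x\<bar> \<le> K * \<bar>x - t\<bar> * \<bar>x - t\<bar>"
          using K(2)[of x] by (simp add: power2_eq_square mult.assoc flip: abs_mult)
        then show ?thesis using False by (simp add: z divide_le_eq)
      qed simp
    qed
    have "((\<lambda>x. K * \<bar>x - t\<bar>) \<longlongrightarrow> K * \<bar>t - t\<bar>) (at t)" by (intro tendsto_intros)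
    then show "((\<lambda>x. K * \<bar>x - t\<bar>) \<longlongrightarrow> 0) (at t)" by simp
  qed
  then show ?thesis by (simp add: has_field_derivative_iff z)
qed

text \<open>Polynomial and exponent may vary with the coordinate, because a partial derivative
  changes them in one coordinate only.\<close>

definition box_bump ::
  "real^'n::finite \<Rightarrow> real^'n \<Rightarrow> real \<Rightarrow> ('n \<Rightarrow> real poly) \<Rightarrow> ('n \<Rightarrow> nat) \<Rightarrow> real^'n \<Rightarrow> real" where
  "box_bump a b c p m x = (\<Prod>j\<in>UNIV. bump (a $ j) (b $ j) c (p j) (m j) (x $ j))"

lemma box_bump_has_derivative:
  fixes a b :: "real^'n::finite"
  assumes c: "c > 0"
  shows "(box_bump a b c p m has_derivative
    (\<lambda>h. \<Sum>i\<in>UNIV. bump (a $ i) (b $ i) c (bump_pderiv (a $ i) (b $ i) c (p i) (m i)) (m i + 2) (x $ i) * h $ i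
         * (\<Prod>j\<in>UNIV - {i}. bump (a $ j) (b $ j) c (p j) (m j) (x $ j)))) (at x)"
  unfolding box_bump_def
proof (rule has_derivative_prod)
  fix i :: 'n
  show "((\<lambda>x. bump (a $ i) (b $ i) c (p i) (m i) (x $ i)) has_derivative
      (\<lambda>h. bump (a $ i) (b $ i) c (bump_pderiv (a $ i) (b $ i) c (p i) (m i)) (m i + 2) (x $ i) * h $ i)) (at x)"
    using has_derivative_compose[OF bounded_linear_imp_has_derivative[OF bounded_linear_vec_nth]
        bump_has_derivative[OF c, THEN has_field_derivative_imp_has_derivative]] .
qed

lemma partial_box_bump:
  fixes a b :: "real^'n::finite"
  assumes c: "c > 0"
  shows "partial i (box_bump a b c p m) =
    box_bump a b c (p(i := bump_pderiv (a $ i) (b $ i) c (p i) (m i))) (m(i := m i + 2))"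
proof
  fix x
  let ?d = "bump (a $ i) (b $ i) c (bump_pderiv (a $ i) (b $ i) c (p i) (m i)) (m i + 2) (x $ i)"
  let ?P = "\<lambda>i. \<Prod>j\<in>UNIV - {i}. bump (a $ j) (b $ j) c (p j) (m j) (x $ j)"
  have "partial i (box_bump a b c p m) x = (\<Sum>k\<in>UNIV. if k = i then ?d * ?P i else 0)"
    unfolding partial_eq_frechet[OF box_bump_has_derivative[OF c]]
    by (intro sum.cong) (auto simp: axis_def)
  also have "\<dots> = ?d * ?P i" by simp
  also have "\<dots> = box_bump a b c (p(i := bump_pderiv (a $ i) (b $ i) c (p i) (m i))) (m(i := m i + 2)) x"
    unfolding box_bump_def by (subst prod.remove[of _ i]) (auto intro!: prod.cong)
  finally show "partial i (box_bump a b c p m) x = \<dots>" .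
qed

text \<open>Every iterated partial derivative is again a \<open>box_bump\<close>, so
  differentiability within this class amounts to smoothness.\<close>

lemma box_bump_test_function:
  fixes a b :: "real^'n::finite"
  assumes c: "c > 0" and sub: "cbox a b \<subseteq> \<Omega>"
  shows "box_bump a b c p m \<in> test_functions \<Omega>"
proof (rule test_functionI[OF _ compact_cbox sub])
  have ex: "\<exists>p' m'. iter_partial is (box_bump a b c p m) = box_bump a b c p' m'" for "is"
  proof (induction "is")
    case (Cons i "is")
    then obtain p' m' where "iter_partial is (box_bump a b c p m) = box_bump a b c p' m'" by blast
    then have "iter_partial (i # is) (box_bump a b c p m) = partial i (box_bump a b c p' m')" by simp
    then show ?case using partial_box_bump[OF c] by metis
  qed auto
  show "iter_partial is (box_bump a b c p m) differentiable (at x)" for "is" x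
  proof -
    obtain p' m' where "iter_partial is (box_bump a b c p m) = box_bump a b c p' m'" using ex by blast
    then show ?thesis using differentiableI[OF box_bump_has_derivative[OF c]] by simp
  qed
  show "box_bump a b c p m x = 0" if x: "x \<notin> cbox a b" for x
  proof -
    obtain j where "\<not> (a $ j \<le> x $ j \<and> x $ j \<le> b $ j)"
      using x unfolding mem_box_cart by blast
    then have "\<not> (a $ j < x $ j \<and> x $ j < b $ j)" by linarith
    then have "bump (a $ j) (b $ j) c (p j) (m j) (x $ j) = 0" by (simp only: bump_def if_False)
    then show ?thesis unfolding box_bump_def by (intro prod_zero) auto
  qed
qed

text \<open>With \<open>p = 1\<close> and \<open>m = 0\<close> only the exponential is left; it
  tends to 1 inside the interval as c tends to 0, while outside every bump is 0.\<close>

lemma box_bump_tendsto_indicator: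
  fixes a b :: "real^'n::finite"
  shows "(\<lambda>k. box_bump a b (1 / real (Suc k)) (\<lambda>_. 1) (\<lambda>_. 0) x) \<longlonglongrightarrow> indicator (box a b) x"
proof -
  have "(\<lambda>k. bump (a $ j) (b $ j) (1 / real (Suc k)) 1 0 (x $ j)) \<longlonglongrightarrow> (if a $ j < x $ j \<and> x $ j < b $ j then 1 else 0)" for j
  proof (cases "a $ j < x $ j \<and> x $ j < b $ j")
    case True
    let ?s = "1 / ((x $ j - a $ j) * (b $ j - x $ j))"
    have "(\<lambda>k. exp (- (1 / real (Suc k)) * ?s)) \<longlonglongrightarrow> exp (- 0 * ?s)"
      by (intro tendsto_intros LIMSEQ_Suc[OF lim_1_over_n])
    then show ?thesis using True by (simp add: bump_def)
  next
    case False
    then show ?thesis by (simp only: bump_def if_False tendsto_const)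
  qed
  then have "(\<lambda>k. box_bump a b (1 / real (Suc k)) (\<lambda>_. 1) (\<lambda>_. 0) x) \<longlonglongrightarrow>
      (\<Prod>j\<in>UNIV. if a $ j < x $ j \<and> x $ j < b $ j then 1 else 0)"
    unfolding box_bump_def by (intro tendsto_prod) auto
  also have "(\<Prod>j\<in>UNIV. if a $ j < x $ j \<and> x $ j < b $ j then 1 else 0 :: real) = indicator (box a b) x"
  proof (cases "x \<in> box a b")
    case False
    then obtain j where "\<not> (a $ j < x $ j \<and> x $ j < b $ j)" by (auto simp: mem_box_cart)
    then have "(\<Prod>j\<in>UNIV. if a $ j < x $ j \<and> x $ j < b $ j then 1 else 0 :: real) = 0"
      by (intro prod_zero) auto
    then show ?thesis using False by simp
  qed (simp add: mem_box_cart)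
  finally show ?thesis .
qed

lemma box_bump_bounds:
  assumes "c > 0"
  shows "0 \<le> box_bump a b c (\<lambda>_. 1) (\<lambda>_. 0) x" "box_bump a b c (\<lambda>_. 1) (\<lambda>_. 0) x \<le> 1"
proof -
  have "0 \<le> bump l u c 1 0 t" "bump l u c 1 0 t \<le> 1" for l u t
    using assms by (auto simp: bump_def)
  then show "0 \<le> box_bump a b c (\<lambda>_. 1) (\<lambda>_. 0) x" "box_bump a b c (\<lambda>_. 1) (\<lambda>_. 0) x \<le> 1"
    unfolding box_bump_def by (auto intro: prod_nonneg prod_le_1)
qed

section \<open>Vanishing integrals over boxes\<close>

lemma integral_box_eq_0:
  fixes v :: "real^'n::finite \<Rightarrow> real"
  assumes \<Omega>: "\<Omega> \<in> lmeasurable" and v: "v \<in> L2 \<Omega>"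
    and orth: "\<And>\<phi>. \<phi> \<in> test_functions \<Omega> \<Longrightarrow> l2inner \<Omega> v \<phi> = 0" and sub: "cbox a b \<subseteq> \<Omega>"
  shows "(\<integral>x. v x * indicator (box a b) x \<partial>lebesgue_on \<Omega>) = 0"
proof -
  define \<phi> where "\<phi> k = box_bump a b (1 / real (Suc k)) (\<lambda>_. 1) (\<lambda>_. 0)" for k
  have \<phi>: "\<phi> k \<in> test_functions \<Omega>" for k
    unfolding \<phi>_def using sub by (intro box_bump_test_function) auto
  have [measurable]: "v \<in> borel_measurable (lebesgue_on \<Omega>)" using v by (rule borel_measurable_L2)
  have \<phi>m: "\<phi> k \<in> borel_measurable (lebesgue_on \<Omega>)" for k
    using borel_measurable_L2[OF test_function_L2(1)[OF \<Omega> \<phi>]] .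
  \<comment> \<open>The bumps lie between 0 and 1, so the absolute value of v dominates; it is
    integrable because \<Omega> has finite measure.\<close>
  have "(\<lambda>k. \<integral>x. v x * \<phi> k x \<partial>lebesgue_on \<Omega>) \<longlonglongrightarrow> (\<integral>x. v x * indicator (box a b) x \<partial>lebesgue_on \<Omega>)"
  proof (rule integral_dominated_convergence[where w="\<lambda>x. norm (v x)"])
    show "AE x in lebesgue_on \<Omega>. (\<lambda>k. v x * \<phi> k x) \<longlonglongrightarrow> v x * indicator (box a b) x"
      unfolding \<phi>_def by (intro AE_I2 tendsto_intros box_bump_tendsto_indicator)
    show "AE x in lebesgue_on \<Omega>. norm (v x * \<phi> k x) \<le> norm (v x)" for k
    proof (rule AE_I2)
      fix x
      have "\<bar>\<phi> k x\<bar> \<le> 1" unfolding \<phi>_def using box_bump_bounds[of "1 / real (Suc k)" a b x] by simp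
      then show "norm (v x * \<phi> k x) \<le> norm (v x)" by (simp add: abs_mult mult_left_le)
    qed
    show "integrable (lebesgue_on \<Omega>) (\<lambda>x. norm (v x))" using L2_imp_integrable(1)[OF \<Omega> v] by simp
    show "(\<lambda>x. v x * indicator (box a b) x) \<in> borel_measurable (lebesgue_on \<Omega>)"
    proof (rule borel_measurable_times[OF borel_measurable_L2[OF v]])
      show "indicat_real (box a b) \<in> borel_measurable (lebesgue_on \<Omega>)"
        by (rule measurable_restrict_space1, rule measurable_completion) simp
    qed
    show "(\<lambda>x. v x * \<phi> k x) \<in> borel_measurable (lebesgue_on \<Omega>)" for k
      using \<phi>m by measurable
  qed
  moreover have "(\<integral>x. v x * \<phi> k x \<partial>lebesgue_on \<Omega>) = 0" for k
    using orth[OF \<phi>] by (simp add: l2inner_def)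
  ultimately show ?thesis by (simp add: LIMSEQ_const_iff)
qed

text \<open>The positive and the negative part of g are densities of finite measures that agree on
  boxes. Boxes form an intersection-stable generator of the Borel sets, so the measures agree, and
  with them the densities.\<close>

lemma AE_zero_if_box_integrals_zero:
  fixes g :: "'a::euclidean_space \<Rightarrow> real"
  assumes int: "integrable lborel g" and box: "\<And>a b. (\<integral>x. g x * indicator (box a b) x \<partial>lborel) = 0"
  shows "AE x in lborel. g x = 0"
proof -
  have [measurable]: "g \<in> borel_measurable borel" using int by (auto dest: borel_measurable_integrable)
  \<comment> \<open>\<open>f 1\<close> and \<open>f (-1)\<close> are the positive and the negative
    part of g.\<close>
  define f where "f s x = max 0 (s * g x)" for s x :: "_"
  have fint: "integrable lborel (f s)" for s unfolding f_def using int by auto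
  have [measurable]: "f s \<in> borel_measurable borel" for s unfolding f_def by measurable
  have boxint: "integrable lborel (\<lambda>x. f s x * indicator (box a b) x)" for s a b
    using integrable_mult_indicator[OF _ fint[of s], of "box a b"] by (simp add: mult.commute)
  have em: "emeasure (density lborel (\<lambda>x. ennreal (f s x))) (box a b)
      = ennreal (\<integral>x. f s x * indicator (box a b) x \<partial>lborel)" for s a b
  proof -
    have "emeasure (density lborel (\<lambda>x. ennreal (f s x))) (box a b)
        = (\<integral>\<^sup>+x. ennreal (f s x * indicator (box a b) x) \<partial>lborel)"
      by (subst emeasure_density) (auto intro!: nn_integral_cong simp: indicator_def)
    also have "\<dots> = ennreal (\<integral>x. f s x * indicator (box a b) x \<partial>lborel)"
      using boxint by (intro nn_integral_eq_integral) (auto simp: f_def)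
    finally show ?thesis .
  qed
  have eqbox: "emeasure (density lborel (\<lambda>x. ennreal (f 1 x))) (box a b)
      = emeasure (density lborel (\<lambda>x. ennreal (f (-1) x))) (box a b)" for a b
  proof -
    have "(\<integral>x. f 1 x * indicator (box a b) x \<partial>lborel) - (\<integral>x. f (-1) x * indicator (box a b) x \<partial>lborel)
        = (\<integral>x. f 1 x * indicator (box a b) x - f (-1) x * indicator (box a b) x \<partial>lborel)"
      using boxint by (intro Bochner_Integration.integral_diff[symmetric])
    also have "\<dots> = (\<integral>x. g x * indicator (box a b) x \<partial>lborel)"
      by (intro Bochner_Integration.integral_cong) (auto simp: f_def indicator_def max_def)
    finally show ?thesis unfolding em using box by simp
  qed
  have "density lborel (\<lambda>x. ennreal (f 1 x)) = density lborel (\<lambda>x. ennreal (f (-1) x))"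
  proof (rule measure_eqI_generator_eq)
    let ?E = "range (\<lambda>(a, b). box a b::'a set)"
    show "Int_stable ?E" by (auto simp: Int_stable_def box_Int_box)
    show "?E \<subseteq> Pow UNIV" "sets (density lborel (\<lambda>x. ennreal (f 1 x))) = sigma_sets UNIV ?E"
      "sets (density lborel (\<lambda>x. ennreal (f (-1) x))) = sigma_sets UNIV ?E"
      by (simp_all add: borel_eq_box)
    let ?A = "\<lambda>n::nat. box (- (real n *\<^sub>R One)) (real n *\<^sub>R One) :: 'a set"
    show "range ?A \<subseteq> ?E" "(\<Union>i. ?A i) = UNIV" unfolding UN_box_eq_UNIV by auto
    show "emeasure (density lborel (\<lambda>x. ennreal (f 1 x))) (?A i) \<noteq> \<infinity>" for i by (simp add: em)
    show "emeasure (density lborel (\<lambda>x. ennreal (f 1 x))) X = emeasure (density lborel (\<lambda>x. ennreal (f (-1) x))) X"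
      if "X \<in> ?E" for X using that eqbox by auto
  qed
  moreover have "(\<integral>\<^sup>+x. ennreal (f 1 x) \<partial>lborel) \<noteq> \<infinity>"
    using fint by (subst nn_integral_eq_integral) (auto simp: f_def)
  ultimately have "AE x in lborel. ennreal (f 1 x) = ennreal (f (-1) x)"
    using finite_density_unique[of "\<lambda>x. ennreal (f 1 x)" lborel "\<lambda>x. ennreal (f (-1) x)"] by simp
  then show ?thesis
    by eventually_elim (auto simp: f_def max_def split: if_splits)
qed

text \<open>Bumps are available for boxes whose closed version lies in \<Omega>. So v is shown to
  vanish on each of these, and countably many of them cover \<Omega>.\<close>

lemma orthogonal_test_functions_imp_AE_zero:
  fixes v :: "real^'n::finite \<Rightarrow> real"
  assumes \<Omega>: "open \<Omega>" "\<Omega> \<in> lmeasurable" and v: "v \<in> L2 \<Omega>"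
    and orth: "\<And>\<phi>. \<phi> \<in> test_functions \<Omega> \<Longrightarrow> l2inner \<Omega> v \<phi> = 0"
  shows "AE x in lebesgue_on \<Omega>. v x = 0"
proof -
  define V where "V x = v x * indicator \<Omega> x" for x
  have "integrable lebesgue (\<lambda>x. indicator \<Omega> x *\<^sub>R v x)"
    using L2_imp_integrable(1)[OF \<Omega>(2) v] \<Omega>(2) by (subst (asm) integrable_restrict_space) auto
  moreover have "V = (\<lambda>x. indicator \<Omega> x *\<^sub>R v x)" by (simp add: V_def fun_eq_iff)
  ultimately have Vint: "integrable lebesgue V" by simp
  then have "V \<in> borel_measurable lebesgue" by auto
  \<comment> \<open>v is only Lebesgue measurable on \<Omega>; its extension by zero is replaced by
    a Borel version, to which the comparison of Borel measures applies.\<close>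
  from completion_ex_borel_measurable_real[OF this]
  obtain V' where [measurable]: "V' \<in> borel_measurable lborel" and V': "AE x in lborel. V x = V' x" by blast
  have V'leb: "AE x in lebesgue. V x = V' x" using V' by (rule AE_completion)
  have V'int: "integrable lborel V'"
  proof -
    have "integrable lebesgue V'"
      by (rule integrable_cong_AE_imp[OF Vint _ V'leb]) (rule measurable_completion, simp)
    then show ?thesis by (simp add: integrable_completion)
  qed
  have box0: "(\<integral>x. V' x * indicator (box a b) x \<partial>lborel) = 0" if ab: "cbox a b \<subseteq> \<Omega>" for a b
  proof -
    have "(\<integral>x. V' x * indicator (box a b) x \<partial>lborel) = (\<integral>x. V' x * indicator (box a b) x \<partial>lebesgue)"
      by (intro integral_completion[symmetric]) measurable
    also have "\<dots> = (\<integral>x. V x * indicator (box a b) x \<partial>lebesgue)"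
    proof (rule integral_cong_AE)
      show "(\<lambda>x. V' x * indicator (box a b) x) \<in> borel_measurable lebesgue"
        by (intro measurable_completion) measurable
      show "(\<lambda>x. V x * indicator (box a b) x) \<in> borel_measurable lebesgue"
        using Vint by (intro borel_measurable_times borel_measurable_indicator) auto
      show "AE x in lebesgue. V' x * indicator (box a b) x = V x * indicator (box a b) x"
        using V'leb by eventually_elim simp
    qed
    also have "\<dots> = (\<integral>x. indicator \<Omega> x *\<^sub>R (v x * indicator (box a b) x) \<partial>lebesgue)"
      by (simp add: V_def mult_ac)
    also have "\<dots> = (\<integral>x. v x * indicator (box a b) x \<partial>lebesgue_on \<Omega>)"
      using \<Omega>(2) by (intro integral_restrict_space[symmetric]) auto
    also have "\<dots> = 0" using integral_box_eq_0[OF \<Omega>(2) v orth ab] by simp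
    finally show ?thesis .
  qed
  have local: "AE x in lborel. x \<in> cbox a b \<longrightarrow> V' x = 0" if ab: "cbox a b \<subseteq> \<Omega>" for a b
  proof -
    have "AE x in lborel. V' x * indicator (box a b) x = 0"
    proof (rule AE_zero_if_box_integrals_zero)
      show "integrable lborel (\<lambda>x. V' x * indicator (box a b) x)"
        using integrable_mult_indicator[OF _ V'int, of "box a b"] by (simp add: mult.commute)
      fix l u :: "real^'n"
      \<comment> \<open>One pair of corners describes the intersection of the open and that of the
        closed boxes, so the closed version of the new box still lies in \<Omega>.\<close>
      obtain l' u' where I: "box a b \<inter> box l u = box l' u'" and C: "cbox a b \<inter> cbox l u = cbox l' u'"
        unfolding box_Int_box Int_interval by blast
      have "V' x * indicator (box a b) x * indicator (box l u) x = V' x * indicator (box l' u') x" for x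
        unfolding I[symmetric] by (simp add: indicator_def)
      then show "(\<integral>x. V' x * indicator (box a b) x * indicator (box l u) x \<partial>lborel) = 0"
        using box0[of l' u'] C ab by (metis (no_types, lifting) Bochner_Integration.integral_cong inf.coboundedI1)
    qed
    moreover have "AE x in lborel. x \<notin> cbox a b - box a b"
      by (rule AE_not_in) (rule null_sets_cbox_Diff_box)
    ultimately show ?thesis by eventually_elim (auto simp: indicator_def)
  qed
  obtain \<D> where \<D>: "countable \<D>" "\<And>X. X \<in> \<D> \<Longrightarrow> X \<subseteq> \<Omega>" "\<And>X. X \<in> \<D> \<Longrightarrow> \<exists>a b. X = cbox a b" "\<Union>\<D> = \<Omega>"
    using open_countable_Union_open_cbox[OF \<Omega>(1)] by (metis Pow_iff subset_iff)
  have "AE x in lborel. \<forall>X\<in>\<D>. x \<in> X \<longrightarrow> V' x = 0"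
    using \<D>(1)
  proof (rule AE_ball_countable[THEN iffD2], intro ballI)
    fix X assume "X \<in> \<D>"
    then show "AE x in lborel. x \<in> X \<longrightarrow> V' x = 0" using \<D>(2,3) local by metis
  qed
  then have "AE x in lborel. x \<in> \<Omega> \<longrightarrow> v x = 0"
    using V' by eventually_elim (use \<D>(4) in \<open>auto simp: V_def indicator_def split: if_splits\<close>)
  then have "AE x in lebesgue. x \<in> \<Omega> \<longrightarrow> v x = 0" by (rule AE_completion)
  then show ?thesis using \<Omega>(2) by (subst AE_restrict_space_iff) auto
qed

section \<open>Weak gradients and potential fields\<close>

lemma L2_component:
  fixes f :: "real^'n::finite \<Rightarrow> real^'m::finite"
  assumes "f \<in> L2 \<Omega>"
  shows "(\<lambda>x. f x $ i) \<in> L2 \<Omega>" "l2norm \<Omega> (\<lambda>x. f x $ i) \<le> l2norm \<Omega> f"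
proof -
  have m: "(\<lambda>x. f x $ i) \<in> borel_measurable (lebesgue_on \<Omega>)"
    using borel_measurable_L2[OF assms] by (rule measurable_compose) simp
  have le: "AE x in lebesgue_on \<Omega>. norm (f x $ i) \<le> 1 * norm (f x)"
    by (simp add: component_le_norm_cart)
  show "(\<lambda>x. f x $ i) \<in> L2 \<Omega>" "l2norm \<Omega> (\<lambda>x. f x $ i) \<le> l2norm \<Omega> f"
    using L2_mono[OF m assms _ le] by simp_all
qed

lemma L2_vecI:
  fixes f :: "'m::finite \<Rightarrow> real^'n::finite \<Rightarrow> real"
  assumes "\<And>i. f i \<in> L2 \<Omega>"
  shows "(\<lambda>x. \<chi> i. f i x) \<in> L2 \<Omega>"
proof -
  have "(\<lambda>x. \<chi> i. f i x) \<in> borel_measurable (lebesgue_on \<Omega>)"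
    using borel_measurable_L2[OF assms]
    by (subst borel_measurable_euclidean_space) (auto simp: Basis_vec_def inner_axis)
  moreover have "(norm (\<chi> i. f i x))\<^sup>2 = (\<Sum>i\<in>UNIV. (f i x)\<^sup>2)" for x
    unfolding power2_norm_eq_inner inner_vec_def by (simp add: power2_eq_square)
  then have "integrable (lebesgue_on \<Omega>) (\<lambda>x. (norm (\<chi> i. f i x))\<^sup>2)"
    using assms by (simp add: L2_def)
  ultimately show ?thesis by (simp add: L2_def)
qed

lemma l2inner_vec_sum:
  fixes f g :: "real^'n::finite \<Rightarrow> real^'m::finite"
  assumes "f \<in> L2 \<Omega>" "g \<in> L2 \<Omega>"
  shows "l2inner \<Omega> f g = (\<Sum>i\<in>UNIV. l2inner \<Omega> (\<lambda>x. f x $ i) (\<lambda>x. g x $ i))"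
  unfolding l2inner_def inner_vec_def
  using integrable_inner_L2[OF L2_component(1)[OF assms(1)] L2_component(1)[OF assms(2)]]
  by (intro Bochner_Integration.integral_sum) auto

text \<open>The difference of two weak derivatives is orthogonal to all test functions. This makes
  the choice in \<open>wpartial\<close> immaterial up to null sets.\<close>

lemma weak_partial_unique:
  fixes u :: "real^'n::finite \<Rightarrow> real"
  assumes \<Omega>: "open \<Omega>" "\<Omega> \<in> lmeasurable" and v: "v \<in> L2 \<Omega>" "is_weak_partial \<Omega> i u v"
    and v': "v' \<in> L2 \<Omega>" "is_weak_partial \<Omega> i u v'"
  shows "AE x in lebesgue_on \<Omega>. v x = v' x"
proof -
  have "AE x in lebesgue_on \<Omega>. (v - v') x = 0"
  proof (rule orthogonal_test_functions_imp_AE_zero[OF \<Omega>])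
    show "v - v' \<in> L2 \<Omega>" using v v' by simp
    show "l2inner \<Omega> (v - v') \<phi> = 0" if "\<phi> \<in> test_functions \<Omega>" for \<phi>
      using v v' that test_function_L2(1)[OF \<Omega>(2) that]
      by (auto simp: L2.ip_diff is_weak_partial_def)
  qed
  then show ?thesis by simp
qed

lemma wpartial_props:
  assumes "v \<in> L2 \<Omega>" "is_weak_partial \<Omega> i u v"
  shows "wpartial \<Omega> i u \<in> L2 \<Omega>" "is_weak_partial \<Omega> i u (wpartial \<Omega> i u)"
proof -
  have "wpartial \<Omega> i u \<in> L2 \<Omega> \<and> is_weak_partial \<Omega> i u (wpartial \<Omega> i u)"
    unfolding wpartial_def by (rule someI[of _ v]) (use assms in simp)
  then show "wpartial \<Omega> i u \<in> L2 \<Omega>" "is_weak_partial \<Omega> i u (wpartial \<Omega> i u)" by auto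
qed

lemma wpartial_H1:
  assumes "u \<in> H1 \<Omega>"
  shows "wpartial \<Omega> i u \<in> L2 \<Omega>" "is_weak_partial \<Omega> i u (wpartial \<Omega> i u)"
  using assms wpartial_props unfolding H1_def by blast+

lemma wgrad_L2: "u \<in> H1 \<Omega> \<Longrightarrow> wgrad \<Omega> u \<in> L2 \<Omega>"
  unfolding wgrad_def by (intro L2_vecI wpartial_H1)

text \<open>Identifies the chosen representative \<open>wgrad\<close> with a field that arises
  otherwise, for instance as a limit; uniqueness is applied to each component.\<close>

lemma wgrad_eqI:
  fixes u :: "real^'n::finite \<Rightarrow> real"
  assumes \<Omega>: "open \<Omega>" "\<Omega> \<in> lmeasurable" and k: "k \<in> L2 \<Omega>"
    and weak: "\<And>i. is_weak_partial \<Omega> i u (\<lambda>x. k x $ i)"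
  shows "AE x in lebesgue_on \<Omega>. wgrad \<Omega> u x = k x"
proof -
  have "AE x in lebesgue_on \<Omega>. wpartial \<Omega> i u x = k x $ i" for i
    using weak_partial_unique[OF \<Omega> wpartial_props[OF L2_component(1)[OF k] weak] L2_component(1)[OF k] weak] .
  then have "AE x in lebesgue_on \<Omega>. \<forall>i. wpartial \<Omega> i u x = k x $ i"
    by (simp add: AE_all_countable)
  then show ?thesis by eventually_elim (simp add: wgrad_def vec_eq_iff)
qed

lemma H10_imp_H1: "u \<in> H10 \<Omega> \<Longrightarrow> u \<in> H1 \<Omega>"
  by (simp add: H10_def)

lemma H1_imp_L2: "u \<in> H1 \<Omega> \<Longrightarrow> u \<in> L2 \<Omega>"
  by (simp add: H1_def)

section \<open>Potential fields as a closed subspace\<close>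

lemma wgrad_pot_space: "u \<in> H10 \<Omega> \<Longrightarrow> wgrad \<Omega> u \<in> pot_space \<Omega>"
  using wgrad_L2 unfolding H10_def pot_space_def by blast

lemma pot_space_subset_L2: "pot_space \<Omega> \<subseteq> L2 \<Omega>"
  by (auto simp: pot_space_def)

lemma pot_space_approx:
  assumes "k \<in> pot_space \<Omega>" "e > 0"
  obtains g where "g \<in> test_functions \<Omega>" "l2norm \<Omega> (\<lambda>x. k x - grad g x) < e"
  using assms by (auto simp: pot_space_def)

lemma subspace_pot_space:
  fixes \<Omega> :: "(real^'n::finite) set"
  assumes \<Omega>: "\<Omega> \<in> lmeasurable"
  shows "subspace (pot_space \<Omega>)"
  unfolding subspace_def
proof (intro conjI ballI allI)
  have "l2norm \<Omega> (\<lambda>x. 0 x - grad (\<lambda>x::real^'n. 0) x) = 0"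
    using grad_scale[OF test_function_zero[of \<Omega>], of 0] by (simp add: l2norm_def)
  then show "0 \<in> pot_space \<Omega>"
    using test_function_zero[of \<Omega>] unfolding pot_space_def
    by (intro CollectI conjI allI impI bexI[of _ "\<lambda>x. 0"]) auto
next
  fix k l :: "real^'n \<Rightarrow> real^'n" assume k: "k \<in> pot_space \<Omega>" and l: "l \<in> pot_space \<Omega>"
  show "k + l \<in> pot_space \<Omega>"
    unfolding pot_space_def
  proof (intro CollectI conjI allI impI)
    show "k + l \<in> L2 \<Omega>" using k l by (simp add: pot_space_def)
    fix e :: real assume "e > 0"
    then have e2: "e / 2 > 0" by simp
    obtain g where g: "g \<in> test_functions \<Omega>" "l2norm \<Omega> (\<lambda>x. k x - grad g x) < e / 2"
      by (rule pot_space_approx[OF k e2])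
    obtain h where h: "h \<in> test_functions \<Omega>" "l2norm \<Omega> (\<lambda>x. l x - grad h x) < e / 2"
      by (rule pot_space_approx[OF l e2])
    have "l2norm \<Omega> (\<lambda>x. (k + l) x - grad (\<lambda>x. g x + h x) x) = l2norm \<Omega> ((k - grad g) + (l - grad h))"
      using grad_add[OF g(1) h(1)] by (intro arg_cong[where f="l2norm \<Omega>"]) (simp add: fun_eq_iff)
    also have "\<dots> \<le> l2norm \<Omega> (k - grad g) + l2norm \<Omega> (l - grad h)"
      using k l test_function_L2(3)[OF \<Omega>] g h by (intro L2.nm_triangle) (auto simp: pot_space_def)
    also have "\<dots> < e" using g h by (simp add: fun_diff_def)
    finally show "\<exists>g\<in>test_functions \<Omega>. l2norm \<Omega> (\<lambda>x. (k + l) x - grad g x) < e"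
      using test_function_add[OF g(1) h(1)] by blast
  qed
next
  fix c and k :: "real^'n \<Rightarrow> real^'n" assume k: "k \<in> pot_space \<Omega>"
  show "c *\<^sub>R k \<in> pot_space \<Omega>"
    unfolding pot_space_def
  proof (intro CollectI conjI allI impI)
    show "c *\<^sub>R k \<in> L2 \<Omega>" using k by (simp add: pot_space_def)
    fix e :: real assume "e > 0"
    \<comment> \<open>The summand 1 covers the case \<open>c = 0\<close>.\<close>
    then have ec: "e / (\<bar>c\<bar> + 1) > 0" by simp
    obtain g where g: "g \<in> test_functions \<Omega>" "l2norm \<Omega> (\<lambda>x. k x - grad g x) < e / (\<bar>c\<bar> + 1)"
      by (rule pot_space_approx[OF k ec])
    have "l2norm \<Omega> (\<lambda>x. (c *\<^sub>R k) x - grad (\<lambda>x. c * g x) x) = l2norm \<Omega> (c *\<^sub>R (k - grad g))"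
      using grad_scale[OF g(1), of c]
      by (intro arg_cong[where f="l2norm \<Omega>"]) (simp add: fun_eq_iff scaleR_fun_def scaleR_diff_right)
    also have "\<dots> = \<bar>c\<bar> * l2norm \<Omega> (k - grad g)"
      using k test_function_L2(3)[OF \<Omega> g(1)] by (intro L2.nm_scale) (auto simp: pot_space_def)
    also have "\<dots> \<le> (\<bar>c\<bar> + 1) * l2norm \<Omega> (k - grad g)" by (intro mult_right_mono) auto
    also have "\<dots> < (\<bar>c\<bar> + 1) * (e / (\<bar>c\<bar> + 1))"
      using g by (intro mult_strict_left_mono) (auto simp: fun_diff_def)
    finally have "l2norm \<Omega> (\<lambda>x. (c *\<^sub>R k) x - grad (\<lambda>x. c * g x) x) < e" by (simp add: add_nonneg_eq_0_iff)
    then show "\<exists>g\<in>test_functions \<Omega>. l2norm \<Omega> (\<lambda>x. (c *\<^sub>R k) x - grad g x) < e"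
      using test_function_scale[OF g(1)] by blast
  qed
qed

lemma closed_pot_space:
  assumes \<Omega>: "\<Omega> \<in> lmeasurable" and k: "k \<in> L2 \<Omega>"
    and approx: "\<And>e. e > 0 \<Longrightarrow> \<exists>s\<in>pot_space \<Omega>. l2norm \<Omega> (k - s) < e"
  shows "k \<in> pot_space \<Omega>"
  unfolding pot_space_def
proof (intro CollectI conjI allI impI k)
  fix e :: real assume e: "e > 0"
  obtain s where s: "s \<in> pot_space \<Omega>" "l2norm \<Omega> (k - s) < e / 2" using approx[of "e / 2"] e by auto
  obtain g where g: "g \<in> test_functions \<Omega>" "l2norm \<Omega> (\<lambda>x. s x - grad g x) < e / 2"
    by (rule pot_space_approx[OF s(1), of "e / 2"]) (use e in auto)
  have "l2norm \<Omega> (k - grad g) \<le> l2norm \<Omega> (k - s) + l2norm \<Omega> (s - grad g)"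
    using k s test_function_L2(3)[OF \<Omega> g(1)] by (intro L2.nm_triangle_diff) (auto simp: pot_space_def)
  also have "\<dots> < e" using s g by (simp add: fun_diff_def)
  finally have "l2norm \<Omega> (\<lambda>x. k x - grad g x) < e" by (simp add: fun_diff_def)
  then show "\<exists>g\<in>test_functions \<Omega>. l2norm \<Omega> (\<lambda>x. k x - grad g x) < e" using g by blast
qed

lemma closed_subspace_pot_space:
  assumes "\<Omega> \<in> lmeasurable"
  shows "semi_hilbert.closed_subspace (L2 \<Omega>) (l2inner \<Omega>) (pot_space \<Omega>)"
  unfolding semi_hilbert.closed_subspace_def[OF semi_hilbert_L2[OF assms]] nm_l2inner
  using subspace_pot_space[OF assms] pot_space_subset_L2 closed_pot_space[OF assms] by blast

text \<open>The projection theorem supplies the witness for the choice in \<open>pot_part\<close>.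
  These two properties are all that is used of the potential part.\<close>

lemma pot_part_props:
  assumes \<Omega>: "\<Omega> \<in> lmeasurable" and k: "k \<in> L2 \<Omega>"
  shows "pot_part \<Omega> k \<in> pot_space \<Omega>" "\<And>q. q \<in> pot_space \<Omega> \<Longrightarrow> l2inner \<Omega> (k - pot_part \<Omega> k) q = 0"
proof -
  obtain p where p: "p \<in> pot_space \<Omega>" "\<forall>q\<in>pot_space \<Omega>. l2inner \<Omega> (k - p) q = 0"
    using semi_hilbert.projection_exists[OF semi_hilbert_L2[OF \<Omega>] closed_subspace_pot_space[OF \<Omega>] k] by blast
  have "pot_part \<Omega> k \<in> pot_space \<Omega> \<and> (\<forall>q\<in>pot_space \<Omega>. l2inner \<Omega> (\<lambda>x. k x - pot_part \<Omega> k x) q = 0)"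
    unfolding pot_part_def by (rule someI[of _ p]) (use p in \<open>simp add: fun_diff_def\<close>)
  then show "pot_part \<Omega> k \<in> pot_space \<Omega>" "\<And>q. q \<in> pot_space \<Omega> \<Longrightarrow> l2inner \<Omega> (k - pot_part \<Omega> k) q = 0"
    by (auto simp: fun_diff_def)
qed

section \<open>Functions in \<open>H10\<close> as limits of test functions\<close>

lemma H10_approx_sequence:
  fixes u :: "real^'n::finite \<Rightarrow> real"
  assumes u: "u \<in> H10 \<Omega>"
  obtains \<phi> where "\<And>n. \<phi> n \<in> test_functions \<Omega>" "(\<lambda>n. l2norm \<Omega> (u - \<phi> n)) \<longlonglongrightarrow> 0"
    "(\<lambda>n. l2norm \<Omega> (wgrad \<Omega> u - grad (\<phi> n))) \<longlonglongrightarrow> 0"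
proof -
  have "\<exists>\<phi>\<in>test_functions \<Omega>. l2norm \<Omega> (u - \<phi>) < 1 / real (Suc n) \<and> l2norm \<Omega> (wgrad \<Omega> u - grad \<phi>) < 1 / real (Suc n)" for n
    using u unfolding H10_def fun_diff_def by auto
  then obtain \<phi> where \<phi>: "\<And>n. \<phi> n \<in> test_functions \<Omega>" "\<And>n. l2norm \<Omega> (u - \<phi> n) < 1 / real (Suc n)"
    "\<And>n. l2norm \<Omega> (wgrad \<Omega> u - grad (\<phi> n)) < 1 / real (Suc n)" by metis
  have "(\<lambda>n. l2norm \<Omega> (u - \<phi> n)) \<longlonglongrightarrow> 0" "(\<lambda>n. l2norm \<Omega> (wgrad \<Omega> u - grad (\<phi> n))) \<longlonglongrightarrow> 0"
    by (rule Lim_null_comparison[OF always_eventually LIMSEQ_Suc[OF lim_1_over_n]];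
        use \<phi> in \<open>simp add: less_imp_le\<close>)+
  then show ?thesis using that \<phi>(1) by blast
qed

lemma poincare_H10:
  fixes u :: "real^'n::finite \<Rightarrow> real"
  assumes \<Omega>: "\<Omega> \<in> lmeasurable" and R: "\<And>x. x \<in> \<Omega> \<Longrightarrow> norm x \<le> R" "0 \<le> R" and u: "u \<in> H10 \<Omega>"
  shows "l2norm \<Omega> u \<le> 2 * R * l2norm \<Omega> (wgrad \<Omega> u)"
proof -
  obtain \<phi> where \<phi>: "\<And>n. \<phi> n \<in> test_functions \<Omega>" and lim: "(\<lambda>n. l2norm \<Omega> (u - \<phi> n)) \<longlonglongrightarrow> 0"
    "(\<lambda>n. l2norm \<Omega> (wgrad \<Omega> u - grad (\<phi> n))) \<longlonglongrightarrow> 0" using H10_approx_sequence[OF u] by blast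
  note L = H1_imp_L2[OF H10_imp_H1[OF u]] wgrad_L2[OF H10_imp_H1[OF u]]
  note T = test_function_L2[OF \<Omega> \<phi>]
  show ?thesis
  proof (rule LIMSEQ_le_const)
    let ?f = "\<lambda>n. l2norm \<Omega> (u - \<phi> n) + 2 * R * (l2norm \<Omega> (wgrad \<Omega> u) + l2norm \<Omega> (wgrad \<Omega> u - grad (\<phi> n)))"
    have "?f \<longlonglongrightarrow> 0 + 2 * R * (l2norm \<Omega> (wgrad \<Omega> u) + 0)" by (intro tendsto_intros lim)
    then show "?f \<longlonglongrightarrow> 2 * R * l2norm \<Omega> (wgrad \<Omega> u)" by simp
    have "l2norm \<Omega> u \<le> ?f n" for n
    proof -
      have 1: "l2norm \<Omega> u \<le> l2norm \<Omega> (u - \<phi> n) + l2norm \<Omega> (\<phi> n)"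
        using L2.nm_triangle[of "u - \<phi> n" \<Omega> "\<phi> n"] L T by simp
      have 2: "l2norm \<Omega> (\<phi> n) \<le> 2 * R * l2norm \<Omega> (grad (\<phi> n))"
        using poincare_test_function[OF \<Omega> R \<phi>] .
      have "l2norm \<Omega> (grad (\<phi> n)) \<le> l2norm \<Omega> (wgrad \<Omega> u) + l2norm \<Omega> (wgrad \<Omega> u - grad (\<phi> n))"
        using L2.nm_triangle[of "wgrad \<Omega> u" \<Omega> "grad (\<phi> n) - wgrad \<Omega> u"]
          L2.nm_minus_commute[of "wgrad \<Omega> u" \<Omega> "grad (\<phi> n)"] L T by simp
      then have "2 * R * l2norm \<Omega> (grad (\<phi> n))
          \<le> 2 * R * (l2norm \<Omega> (wgrad \<Omega> u) + l2norm \<Omega> (wgrad \<Omega> u - grad (\<phi> n)))"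
        using R(2) by (intro mult_left_mono) auto
      with 1 2 show ?thesis by linarith
    qed
    then show "\<exists>N. \<forall>n\<ge>N. l2norm \<Omega> u \<le> ?f n" by blast
  qed
qed

text \<open>By the Poincare inequality, test functions \<open>g n\<close> whose gradients converge
  to k are themselves Cauchy. Integration by parts survives the limit, so their limit has weak
  gradient k, and the same \<open>g n\<close> witness its membership in \<open>H10\<close>.\<close>

lemma pot_space_imp_wgrad:
  fixes k :: "real^'n::finite \<Rightarrow> real^'n"
  assumes \<Omega>: "open \<Omega>" "bounded \<Omega>" and k: "k \<in> pot_space \<Omega>"
  shows "\<exists>u\<in>H10 \<Omega>. AE x in lebesgue_on \<Omega>. wgrad \<Omega> u x = k x"
proof -
  have m: "\<Omega> \<in> lmeasurable" using \<Omega> by (intro lmeasurable_open)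
  obtain R where R: "\<And>x. x \<in> \<Omega> \<Longrightarrow> norm x \<le> R" "0 \<le> R"
    using \<Omega>(2) bounded_pos less_imp_le by metis
  have kL: "k \<in> L2 \<Omega>" using k by (simp add: pot_space_def)
  have "\<exists>g\<in>test_functions \<Omega>. l2norm \<Omega> (k - grad g) < 1 / real (Suc n)" for n
    using k unfolding pot_space_def fun_diff_def by auto
  then obtain g where g: "\<And>n. g n \<in> test_functions \<Omega>" and gk: "\<And>n. l2norm \<Omega> (k - grad (g n)) < 1 / real (Suc n)"
    by metis
  note T = test_function_L2[OF m g]
  have lim: "(\<lambda>n. l2norm \<Omega> (k - grad (g n))) \<longlonglongrightarrow> 0"
    by (rule Lim_null_comparison[OF always_eventually LIMSEQ_Suc[OF lim_1_over_n]])
      (use gk in \<open>simp add: less_imp_le\<close>)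
  have dist: "l2norm \<Omega> (g i - g j) \<le> 2 * R * (l2norm \<Omega> (k - grad (g i)) + l2norm \<Omega> (k - grad (g j)))" for i j
  proof -
    have t: "g i - g j \<in> test_functions \<Omega>"
      using test_function_add[OF g test_function_scale[OF g, of "-1"], of i j] by (simp add: fun_diff_def)
    have eq: "grad (g i - g j) = grad (g i) - grad (g j)"
      using grad_add[OF g test_function_scale[OF g, of "-1"], of i j] grad_scale[OF g[of j], of "-1"]
      by (simp add: fun_diff_def)
    have "l2norm \<Omega> (grad (g i) - grad (g j)) \<le> l2norm \<Omega> (k - grad (g i)) + l2norm \<Omega> (k - grad (g j))"
      using L2.nm_triangle_diff[of "grad (g i)" \<Omega> k "grad (g j)"] L2.nm_minus_commute[of "grad (g i)" \<Omega> k] T kL by simp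
    then have "2 * R * l2norm \<Omega> (grad (g i) - grad (g j)) \<le> 2 * R * (l2norm \<Omega> (k - grad (g i)) + l2norm \<Omega> (k - grad (g j)))"
      using R(2) by (intro mult_left_mono) auto
    then show ?thesis using poincare_test_function[OF m R t] eq by simp
  qed
  have cauchy: "\<exists>N. \<forall>i\<ge>N. \<forall>j\<ge>N. l2norm \<Omega> (g i - g j) < e" if e: "e > 0" for e
  proof -
    have "(\<lambda>n. 4 * R * l2norm \<Omega> (k - grad (g n))) \<longlonglongrightarrow> 4 * R * 0" by (intro tendsto_intros lim)
    from LIMSEQ_D[OF this e] obtain N where N: "\<And>n. n \<ge> N \<Longrightarrow> \<bar>4 * R * l2norm \<Omega> (k - grad (g n))\<bar> < e" by auto
    have "l2norm \<Omega> (g i - g j) < e" if "i \<ge> N" "j \<ge> N" for i j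
      using dist[of i j] N[OF that(1)] N[OF that(2)] by (simp add: distrib_left)
    then show ?thesis by blast
  qed
  obtain u where u: "u \<in> L2 \<Omega>" and ulim: "(\<lambda>n. l2norm \<Omega> (g n - u)) \<longlonglongrightarrow> 0"
    using L2_complete[OF m T(1) cauchy] by blast
  have weak: "is_weak_partial \<Omega> i u (\<lambda>x. k x $ i)" for i
    unfolding is_weak_partial_def
  proof
    fix \<phi> assume \<phi>: "\<phi> \<in> test_functions \<Omega>"
    note P = test_function_L2[OF m \<phi>]
    have 1: "(\<lambda>n. l2inner \<Omega> (g n) (partial i \<phi>)) \<longlonglongrightarrow> l2inner \<Omega> u (partial i \<phi>)"
      by (rule L2.tendsto_ip[OF T(1) u P(2) ulim])
    have "(\<lambda>n. l2norm \<Omega> (partial i (g n) - (\<lambda>x. k x $ i))) \<longlonglongrightarrow> 0"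
    proof (rule Lim_null_comparison[OF always_eventually lim], rule allI)
      fix n
      have "l2norm \<Omega> (\<lambda>x. (grad (g n) - k) x $ i) \<le> l2norm \<Omega> (grad (g n) - k)"
        using L2_component(2)[OF L2.H_diff[OF T(3) kL]] .
      then show "norm (l2norm \<Omega> (partial i (g n) - (\<lambda>x. k x $ i))) \<le> l2norm \<Omega> (k - grad (g n))"
        using L2.nm_minus_commute[OF T(3) kL, of n] by (simp add: grad_def fun_diff_def)
    qed
    from L2.tendsto_ip[OF T(2) L2_component(1)[OF kL] P(1) this]
    have "(\<lambda>n. - l2inner \<Omega> (partial i (g n)) \<phi>) \<longlonglongrightarrow> - l2inner \<Omega> (\<lambda>x. k x $ i) \<phi>"
      by (rule tendsto_minus)
    moreover have "l2inner \<Omega> (g n) (partial i \<phi>) = - l2inner \<Omega> (partial i (g n)) \<phi>" for n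
      using test_function_weak_partial[OF m g] \<phi> unfolding is_weak_partial_def by blast
    ultimately show "l2inner \<Omega> u (partial i \<phi>) = - l2inner \<Omega> (\<lambda>x. k x $ i) \<phi>"
      using 1 LIMSEQ_unique by force
  qed
  have H1: "u \<in> H1 \<Omega>" using u weak L2_component(1)[OF kL] unfolding H1_def by blast
  have eq: "AE x in lebesgue_on \<Omega>. wgrad \<Omega> u x = k x" by (rule wgrad_eqI[OF \<Omega>(1) m kL weak])
  have "\<exists>\<phi>\<in>test_functions \<Omega>. l2norm \<Omega> (\<lambda>x. u x - \<phi> x) < e \<and> l2norm \<Omega> (\<lambda>x. wgrad \<Omega> u x - grad \<phi> x) < e"
    if e: "e > 0" for e
  proof -
    obtain N where N: "\<And>n. n \<ge> N \<Longrightarrow> l2norm \<Omega> (g n - u) < e" using LIMSEQ_D[OF ulim e] by auto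
    obtain N' where N': "\<And>n. n \<ge> N' \<Longrightarrow> l2norm \<Omega> (k - grad (g n)) < e" using LIMSEQ_D[OF lim e] by auto
    let ?n = "max N N'"
    have "l2norm \<Omega> (u - g ?n) < e" using N[of ?n] L2.nm_minus_commute[OF u T(1), of ?n] by simp
    moreover have "l2norm \<Omega> (wgrad \<Omega> u - grad (g ?n)) = l2norm \<Omega> (k - grad (g ?n))"
      using eq by (intro l2norm_cong_AE L2.H_diff wgrad_L2 H1 T kL) auto
    ultimately show ?thesis using g N'[of ?n] by (intro bexI[of _ "g ?n"]) (auto simp: fun_diff_def)
  qed
  then show ?thesis using H1 eq unfolding H10_def by blast
qed

text \<open>Potential fields are, up to null sets, the gradients of \<open>H10\<close> functions.
  Weak equations and equality of divergences thus become identities tested on a closed subspace of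
  \<open>L2\<close>.\<close>

lemma orthogonal_pot_space_iff:
  fixes k l :: "real^'n::finite \<Rightarrow> real^'n"
  assumes \<Omega>: "open \<Omega>" "bounded \<Omega>" and kl: "k \<in> L2 \<Omega>" "l \<in> L2 \<Omega>"
  shows "(\<forall>\<phi>\<in>H10 \<Omega>. l2inner \<Omega> (wgrad \<Omega> \<phi>) k = l2inner \<Omega> (wgrad \<Omega> \<phi>) l)
     \<longleftrightarrow> (\<forall>q\<in>pot_space \<Omega>. l2inner \<Omega> q k = l2inner \<Omega> q l)" (is "?L \<longleftrightarrow> ?R")
proof
  assume L: ?L
  show ?R
  proof
    fix q assume q: "q \<in> pot_space \<Omega>"
    obtain u where u: "u \<in> H10 \<Omega>" "AE x in lebesgue_on \<Omega>. wgrad \<Omega> u x = q x"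
      using pot_space_imp_wgrad[OF \<Omega> q] by blast
    have "l2inner \<Omega> q h = l2inner \<Omega> (wgrad \<Omega> u) h" if "h \<in> L2 \<Omega>" for h
      using u q that wgrad_L2[OF H10_imp_H1[OF u(1)]]
      by (intro l2inner_cong_AE) (auto simp: pot_space_def)
    then show "l2inner \<Omega> q k = l2inner \<Omega> q l" using L u kl by simp
  qed
qed (use wgrad_pot_space in blast)

section \<open>Green's formula and the coefficient operator\<close>

lemma sum_fun_apply: "(\<Sum>i\<in>I. f i) x = (\<Sum>i\<in>I. f i x)" for f :: "_ \<Rightarrow> _ \<Rightarrow> _::comm_monoid_add"
  by (induction I rule: infinite_finite_induct) auto

lemma wlaplacian_L2:
  assumes "w \<in> H2 \<Omega>"
  shows "wlaplacian \<Omega> w \<in> L2 \<Omega>"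
proof -
  have "(\<Sum>i\<in>UNIV. wpartial \<Omega> i (wpartial \<Omega> i w)) \<in> L2 \<Omega>"
    using assms by (intro subspace_sum[OF subspace_L2] wpartial_H1(1)) (auto simp: H2_def)
  moreover have "(\<Sum>i\<in>UNIV. wpartial \<Omega> i (wpartial \<Omega> i w)) = wlaplacian \<Omega> w"
    by (simp add: wlaplacian_def fun_eq_iff sum_fun_apply)
  ultimately show ?thesis by simp
qed

text \<open>For a test function this is the definition of the weak derivatives of the components of
  grad w; density extends it to \<open>H10\<close>, without a boundary term.\<close>

lemma green_formula:
  fixes \<phi> w :: "real^'n::finite \<Rightarrow> real"
  assumes \<Omega>: "\<Omega> \<in> lmeasurable" and w: "w \<in> H2 \<Omega>" and \<phi>: "\<phi> \<in> H10 \<Omega>"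
  shows "l2inner \<Omega> (wgrad \<Omega> \<phi>) (wgrad \<Omega> w) = - l2inner \<Omega> \<phi> (wlaplacian \<Omega> w)"
proof -
  have w1: "w \<in> H1 \<Omega>" and wp: "\<And>i. wpartial \<Omega> i w \<in> H1 \<Omega>" using w by (auto simp: H2_def)
  obtain \<psi> where \<psi>: "\<And>n. \<psi> n \<in> test_functions \<Omega>" and lim: "(\<lambda>n. l2norm \<Omega> (\<phi> - \<psi> n)) \<longlonglongrightarrow> 0"
    "(\<lambda>n. l2norm \<Omega> (wgrad \<Omega> \<phi> - grad (\<psi> n))) \<longlonglongrightarrow> 0" using H10_approx_sequence[OF \<phi>] by blast
  note L = H1_imp_L2[OF H10_imp_H1[OF \<phi>]] wgrad_L2[OF H10_imp_H1[OF \<phi>]]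
  note T = test_function_L2[OF \<Omega> \<psi>]
  have test: "l2inner \<Omega> (grad \<psi>) (wgrad \<Omega> w) = - l2inner \<Omega> \<psi> (wlaplacian \<Omega> w)"
    if \<psi>: "\<psi> \<in> test_functions \<Omega>" for \<psi>
  proof -
    note T = test_function_L2[OF \<Omega> \<psi>]
    have "l2inner \<Omega> (grad \<psi>) (wgrad \<Omega> w) = (\<Sum>i\<in>UNIV. l2inner \<Omega> (partial i \<psi>) (wpartial \<Omega> i w))"
      using l2inner_vec_sum[OF T(3) wgrad_L2[OF w1]] by (simp add: grad_def wgrad_def)
    also have "\<dots> = (\<Sum>i\<in>UNIV. - l2inner \<Omega> \<psi> (wpartial \<Omega> i (wpartial \<Omega> i w)))"
    proof (rule sum.cong[OF refl])
      fix i
      show "l2inner \<Omega> (partial i \<psi>) (wpartial \<Omega> i w) = - l2inner \<Omega> \<psi> (wpartial \<Omega> i (wpartial \<Omega> i w))"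
        using wpartial_H1(2)[OF wp[of i], of i] \<psi>
        by (simp add: is_weak_partial_def l2inner_def inner_commute mult.commute)
    qed
    also have "\<dots> = - (\<Sum>i\<in>UNIV. l2inner \<Omega> \<psi> (wpartial \<Omega> i (wpartial \<Omega> i w)))"
      by (simp add: sum_negf)
    also have "(\<Sum>i\<in>UNIV. l2inner \<Omega> \<psi> (wpartial \<Omega> i (wpartial \<Omega> i w))) = l2inner \<Omega> \<psi> (wlaplacian \<Omega> w)"
      unfolding l2inner_def wlaplacian_def inner_sum_right
      using integrable_inner_L2[OF T(1) wpartial_H1(1)[OF wp]]
      by (intro Bochner_Integration.integral_sum[symmetric]) auto
    finally show ?thesis .
  qed
  have "(\<lambda>n. l2inner \<Omega> (grad (\<psi> n)) (wgrad \<Omega> w)) \<longlonglongrightarrow> l2inner \<Omega> (wgrad \<Omega> \<phi>) (wgrad \<Omega> w)"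
    using lim(2) L2.nm_tendsto_0_commute[OF T(3) L(2)] L2.tendsto_ip[OF T(3) L(2) wgrad_L2[OF w1]] by simp
  moreover have "(\<lambda>n. l2inner \<Omega> (\<psi> n) (wlaplacian \<Omega> w)) \<longlonglongrightarrow> l2inner \<Omega> \<phi> (wlaplacian \<Omega> w)"
    using lim(1) L2.nm_tendsto_0_commute[OF T(1) L(1)] L2.tendsto_ip[OF T(1) L(1) wlaplacian_L2[OF w]] by simp
  then have "(\<lambda>n. l2inner \<Omega> (grad (\<psi> n)) (wgrad \<Omega> w)) \<longlonglongrightarrow> - l2inner \<Omega> \<phi> (wlaplacian \<Omega> w)"
    using test[OF \<psi>] by (simp add: tendsto_minus)
  ultimately show ?thesis by (rule LIMSEQ_unique)
qed

text \<open>M sums up the bounds of the entries. It gives square integrability and feeds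
  Lax-Milgram; the error estimate takes its constant from \<open>ip_A_le\<close> instead.\<close>

lemma mult_field_L2:
  fixes a :: "real^'n::finite \<Rightarrow> real^'n^'n"
  assumes a: "Linf_matrix \<Omega> a"
  obtains M where "0 \<le> M" "\<And>k. k \<in> L2 \<Omega> \<Longrightarrow> mult_field a k \<in> L2 \<Omega>"
    "\<And>k. k \<in> L2 \<Omega> \<Longrightarrow> l2norm \<Omega> (mult_field a k) \<le> M * l2norm \<Omega> k"
proof -
  obtain B where B: "\<And>i j. AE x in lebesgue_on \<Omega>. \<bar>a x $ i $ j\<bar> \<le> B i j"
    using a unfolding Linf_matrix_def by metis
  define M where "M = (\<Sum>i\<in>UNIV. \<Sum>j\<in>UNIV. \<bar>B i j\<bar>)"
  have M: "0 \<le> M" unfolding M_def by (intro sum_nonneg) auto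
  have "AE x in lebesgue_on \<Omega>. \<forall>i j. \<bar>a x $ i $ j\<bar> \<le> B i j"
    using B by (simp add: AE_all_countable)
  then have bound: "AE x in lebesgue_on \<Omega>. \<forall>\<xi>. norm (a x *v \<xi>) \<le> M * norm \<xi>"
  proof eventually_elim
    case (elim x)
    show ?case
    proof
      fix \<xi> :: "real^'n"
      have "norm (a x *v \<xi>) \<le> (\<Sum>i\<in>UNIV. \<bar>(a x *v \<xi>) $ i\<bar>)" by (rule norm_le_l1_cart)
      also have "\<dots> \<le> (\<Sum>i\<in>UNIV. \<Sum>j\<in>UNIV. \<bar>B i j\<bar> * norm \<xi>)"
      proof (rule sum_mono)
        fix i
        have "\<bar>(a x *v \<xi>) $ i\<bar> \<le> (\<Sum>j\<in>UNIV. \<bar>a x $ i $ j * \<xi> $ j\<bar>)"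
          by (simp add: matrix_vector_mult_def sum_abs)
        also have "\<dots> \<le> (\<Sum>j\<in>UNIV. \<bar>B i j\<bar> * norm \<xi>)"
          unfolding abs_mult using elim
          by (intro sum_mono mult_mono component_le_norm_cart) (auto intro: order_trans[OF _ abs_ge_self])
        finally show "\<bar>(a x *v \<xi>) $ i\<bar> \<le> (\<Sum>j\<in>UNIV. \<bar>B i j\<bar> * norm \<xi>)" .
      qed
      also have "\<dots> = M * norm \<xi>" by (simp add: M_def sum_distrib_right)
      finally show "norm (a x *v \<xi>) \<le> M * norm \<xi>" .
    qed
  qed
  have meas: "mult_field a k \<in> borel_measurable (lebesgue_on \<Omega>)" if k: "k \<in> L2 \<Omega>" for k
  proof -
    have [measurable]: "(\<lambda>x. a x $ i $ j) \<in> borel_measurable (lebesgue_on \<Omega>)" for i j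
      using a unfolding Linf_matrix_def by blast
    have [measurable]: "(\<lambda>x. k x $ j) \<in> borel_measurable (lebesgue_on \<Omega>)" for j
      using borel_measurable_L2[OF L2_component(1)[OF k]] .
    have "(\<lambda>x. \<Sum>j\<in>UNIV. a x $ i $ j * k x $ j) \<in> borel_measurable (lebesgue_on \<Omega>)" for i
      by measurable
    then show ?thesis
      by (subst borel_measurable_euclidean_space)
        (auto simp: mult_field_def Basis_vec_def inner_axis matrix_vector_mult_def)
  qed
  have le: "AE x in lebesgue_on \<Omega>. norm (mult_field a k x) \<le> M * norm (k x)" for k
    using bound by eventually_elim (simp add: mult_field_def)
  show ?thesis
  proof (rule that[OF M])
    fix k :: "real^'n \<Rightarrow> real^'n" assume k: "k \<in> L2 \<Omega>"
    show "mult_field a k \<in> L2 \<Omega>" "l2norm \<Omega> (mult_field a k) \<le> M * l2norm \<Omega> k"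
      by (rule L2_mono[OF meas[OF k] k M le])+
  qed
qed

lemma mult_field_elliptic:
  assumes \<Omega>: "\<Omega> \<in> lmeasurable" and ell: "elliptic_with \<Omega> l L a" and a: "Linf_matrix \<Omega> a" and k: "k \<in> L2 \<Omega>"
  shows "l * l2inner \<Omega> k k \<le> l2inner \<Omega> k (mult_field a k)" "l2inner \<Omega> k (mult_field a k) \<le> L * l2inner \<Omega> k k"
proof -
  obtain M where "mult_field a k \<in> L2 \<Omega>" using mult_field_L2[OF a] k by metis
  note I = integrable_inner_L2[OF k this] integrable_inner_L2[OF k k]
  have "l * (k x \<bullet> k x) \<le> k x \<bullet> mult_field a k x \<and> k x \<bullet> mult_field a k x \<le> L * (k x \<bullet> k x)" if "x \<in> \<Omega>" for x
    using ell that unfolding elliptic_with_def mult_field_def by (simp add: power2_norm_eq_inner)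
  note pw = this
  have "(\<integral>x. l * (k x \<bullet> k x) \<partial>lebesgue_on \<Omega>) \<le> (\<integral>x. k x \<bullet> mult_field a k x \<partial>lebesgue_on \<Omega>)"
    "(\<integral>x. k x \<bullet> mult_field a k x \<partial>lebesgue_on \<Omega>) \<le> (\<integral>x. L * (k x \<bullet> k x) \<partial>lebesgue_on \<Omega>)"
    by (rule integral_mono; use I pw in \<open>simp add: space_restrict_space\<close>)+
  then show "l * l2inner \<Omega> k k \<le> l2inner \<Omega> k (mult_field a k)" "l2inner \<Omega> k (mult_field a k) \<le> L * l2inner \<Omega> k k"
    by (simp_all add: l2inner_def)
qed

text \<open>Lax-Milgram among potential fields, with right side grad w, which represents the
  Laplacian of w by Green's formula; the solution is then realised as a gradient. The lemma supplies
  the u' that lets w count in the supremum of \<open>D_const\<close>.\<close>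

lemma weak_solution_exists:
  fixes a :: "real^'n::finite \<Rightarrow> real^'n^'n"
  assumes \<Omega>: "open \<Omega>" "bounded \<Omega>" and a: "Linf_matrix \<Omega> a" and ell: "elliptic_with \<Omega> l L a"
    and w: "w \<in> H2 \<Omega>"
  shows "\<exists>u. weak_solution \<Omega> a (wlaplacian \<Omega> w) u"
proof -
  have m: "\<Omega> \<in> lmeasurable" using \<Omega> by (intro lmeasurable_open)
  obtain M where M: "\<And>k. k \<in> L2 \<Omega> \<Longrightarrow> mult_field a k \<in> L2 \<Omega>"
    "\<And>k. k \<in> L2 \<Omega> \<Longrightarrow> l2norm \<Omega> (mult_field a k) \<le> M * l2norm \<Omega> k" using mult_field_L2[OF a] by metis
  have gw: "wgrad \<Omega> w \<in> L2 \<Omega>" using w by (intro wgrad_L2) (simp add: H2_def)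
  have S: "x \<in> L2 \<Omega>" if "x \<in> pot_space \<Omega>" for x :: "real^'n \<Rightarrow> real^'n"
    using that by (simp add: pot_space_def)
  have "\<exists>p\<in>pot_space \<Omega>. \<forall>q\<in>pot_space \<Omega>. l2inner \<Omega> q (mult_field a p) = l2inner \<Omega> q (wgrad \<Omega> w)"
  proof (rule semi_hilbert.lax_milgram[OF semi_hilbert_L2[OF m] closed_subspace_pot_space[OF m], where M=M and l=l])
    show "mult_field a (x - y) = mult_field a x - mult_field a y" for x y
      by (simp add: mult_field_def fun_eq_iff matrix_vector_mult_diff_distrib)
    show "0 < l" using ell by (simp add: elliptic_with_def)
  qed (use M gw S mult_field_elliptic[OF m ell a] in \<open>auto simp: nm_l2inner\<close>)
  then obtain p where p: "p \<in> pot_space \<Omega>"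
    and eq: "\<And>q. q \<in> pot_space \<Omega> \<Longrightarrow> l2inner \<Omega> q (mult_field a p) = l2inner \<Omega> q (wgrad \<Omega> w)" by blast
  obtain u where u: "u \<in> H10 \<Omega>" and up: "AE x in lebesgue_on \<Omega>. wgrad \<Omega> u x = p x"
    using pot_space_imp_wgrad[OF \<Omega> p] by blast
  have pL: "p \<in> L2 \<Omega>" using p pot_space_subset_L2 by auto
  have "l2inner \<Omega> (wgrad \<Omega> \<phi>) (mult_field a (wgrad \<Omega> u)) = - l2inner \<Omega> \<phi> (wlaplacian \<Omega> w)" if \<phi>: "\<phi> \<in> H10 \<Omega>" for \<phi>
  proof -
    have "AE x in lebesgue_on \<Omega>. mult_field a (wgrad \<Omega> u) x = mult_field a p x"
      using up by eventually_elim (simp add: mult_field_def)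
    then have "l2inner \<Omega> (wgrad \<Omega> \<phi>) (mult_field a (wgrad \<Omega> u)) = l2inner \<Omega> (wgrad \<Omega> \<phi>) (mult_field a p)"
      using wgrad_L2[OF H10_imp_H1] \<phi> u M(1) pL by (intro l2inner_cong_AE) auto
    then show ?thesis using eq[OF wgrad_pot_space[OF \<phi>]] green_formula[OF m w \<phi>] by simp
  qed
  then show ?thesis using u unfolding weak_solution_def by blast
qed

section \<open>The error estimate\<close>

lemma elliptic_operator_mult_field:
  fixes a :: "real^'n::finite \<Rightarrow> real^'n^'n"
  assumes \<Omega>: "\<Omega> \<in> lmeasurable" and a: "Linf_matrix \<Omega> a" and ell: "elliptic_with \<Omega> l L a"
    and sym: "\<And>x. x \<in> \<Omega> \<Longrightarrow> transpose (a x) = a x"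
  shows "elliptic_operator (L2 \<Omega>) (l2inner \<Omega>) (mult_field a) l L"
proof
  obtain M where M: "\<And>k. k \<in> L2 \<Omega> \<Longrightarrow> mult_field a k \<in> L2 \<Omega>" using mult_field_L2[OF a] by metis
  fix x y :: "real^'n \<Rightarrow> real^'n" and c :: real
  show "mult_field a (x + y) = mult_field a x + mult_field a y"
    by (simp add: mult_field_def fun_eq_iff matrix_vector_right_distrib)
  show "mult_field a (c *\<^sub>R x) = c *\<^sub>R mult_field a x"
    by (simp add: mult_field_def fun_eq_iff scaleR_fun_def matrix_vector_mult_scaleR)
  show "l2inner \<Omega> x (mult_field a y) = l2inner \<Omega> y (mult_field a x)"
    unfolding l2inner_def
  proof (rule Bochner_Integration.integral_cong[OF refl])
    fix z assume "z \<in> space (lebesgue_on \<Omega>)"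
    then have "transpose (a z) = a z" using sym by (simp add: space_restrict_space)
    then show "x z \<bullet> mult_field a y z = y z \<bullet> mult_field a x z"
      unfolding mult_field_def by (metis dot_lmul_matrix inner_commute vector_transpose_matrix)
  qed
  show "mult_field a x \<in> L2 \<Omega>" if "x \<in> L2 \<Omega>" using M that .
  show "l * l2inner \<Omega> x x \<le> l2inner \<Omega> x (mult_field a x)" "l2inner \<Omega> x (mult_field a x) \<le> L * l2inner \<Omega> x x"
    if "x \<in> L2 \<Omega>" using mult_field_elliptic[OF \<Omega> ell a that] by auto
  show "0 < l" "l \<le> L" using ell by (auto simp: elliptic_with_def)
qed

lemma findim_subspace_diff:
  assumes "findim_subspace \<Omega> V" "x \<in> V" "y \<in> V"
  shows "x - y \<in> V"
proof -
  have add: "\<forall>k\<in>V. \<forall>l\<in>V. (\<lambda>z. k z + l z) \<in> V" and scale: "\<forall>c. \<forall>k\<in>V. (\<lambda>z. c *\<^sub>R k z) \<in> V"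
    using assms(1) by (simp_all add: findim_subspace_def)
  have "(\<lambda>z. x z + (-1) *\<^sub>R y z) \<in> V"
    by (rule bspec[OF bspec[OF add assms(2)] bspec[OF spec[OF scale] assms(3)]])
  then show ?thesis by (simp add: fun_diff_def)
qed

text \<open>\<open>K_const\<close> ranges over fields that are not almost everywhere zero. For the
  others the bound follows from orthogonality, as the curl part is no larger than the field.\<close>

lemma curl_part_le:
  fixes V :: "(real^'n::finite \<Rightarrow> real^'n) set"
  assumes \<Omega>: "\<Omega> \<in> lmeasurable" and V: "V \<subseteq> L2 \<Omega>" and K: "K_const \<Omega> V = ennreal K" "0 \<le> K" and \<eta>: "\<eta> \<in> V"
  shows "l2norm \<Omega> (\<eta> - pot_part \<Omega> \<eta>) \<le> K * l2norm \<Omega> \<eta>"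
proof -
  have L: "\<eta> \<in> L2 \<Omega>" using \<eta> V by auto
  note P = pot_part_props[OF \<Omega> L]
  have pL: "pot_part \<Omega> \<eta> \<in> L2 \<Omega>" using P(1) by (simp add: pot_space_def)
  show ?thesis
  proof (cases "ae_zero \<Omega> \<eta>")
    case True
    then have "l2norm \<Omega> \<eta> = 0" using l2norm_eq_0_iff[OF L] by (simp add: ae_zero_def)
    moreover have "l2norm \<Omega> (\<eta> - pot_part \<Omega> \<eta>) \<le> l2norm \<Omega> (pot_part \<Omega> \<eta> + (\<eta> - pot_part \<Omega> \<eta>))"
      using P L pL by (intro L2.nm_orthogonal_le) auto
    ultimately show ?thesis by simp
  next
    case False
    then have "l2norm \<Omega> \<eta> \<noteq> 0" using l2norm_eq_0_iff[OF L] by (simp add: ae_zero_def)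
    then have pos: "l2norm \<Omega> \<eta> > 0" using l2norm_nonneg[of \<Omega> \<eta>] by linarith
    have "ennreal (l2norm \<Omega> (curl_part \<Omega> \<eta>) / l2norm \<Omega> \<eta>) \<le> K_const \<Omega> V"
      unfolding K_const_def using \<eta> False by (intro SUP_upper) auto
    then have "l2norm \<Omega> (curl_part \<Omega> \<eta>) / l2norm \<Omega> \<eta> \<le> K" using K by simp
    then show ?thesis using pos by (simp add: curl_part_def fun_diff_def field_simps)
  qed
qed

theorem theorem5p1:
  fixes lmin lmax :: real
  assumes "CARD('n::finite) \<ge> 2" and "0 < lmin" and "lmin \<le> lmax"
  shows "\<exists>Cstar>0. \<forall>\<Omega> :: (real^'n) set. bounded_C2_domain \<Omega> \<longrightarrow>
    (\<exists>C>0. \<forall>(a :: real^'n \<Rightarrow> real^'n^'n) (V :: (real^'n \<Rightarrow> real^'n) set)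
        (f :: real^'n \<Rightarrow> real) (w :: real^'n \<Rightarrow> real) (u :: real^'n \<Rightarrow> real)
        (\<zeta>V :: real^'n \<Rightarrow> real^'n).
      Linf_matrix \<Omega> a \<and> (\<forall>x\<in>\<Omega>. transpose (a x) = a x) \<and> elliptic_with \<Omega> lmin lmax a \<and>
      findim_subspace \<Omega> V \<and>
      f \<in> L2 \<Omega> \<and> w \<in> H2 \<Omega> \<inter> H10 \<Omega> \<and> (AE x in lebesgue_on \<Omega>. - wlaplacian \<Omega> w x = f x) \<and>
      u \<in> H10 \<Omega> \<and>
      (\<forall>\<phi>\<in>H10 \<Omega>. l2inner \<Omega> (wgrad \<Omega> \<phi>) (mult_field a (wgrad \<Omega> u))
                   = l2inner \<Omega> (wgrad \<Omega> \<phi>) (wgrad \<Omega> w)) \<and>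
      \<zeta>V \<in> V \<and>
      (\<forall>\<eta>\<in>V. l2inner \<Omega> \<eta> (mult_field a \<zeta>V) = l2inner \<Omega> \<eta> (wgrad \<Omega> w)) \<and>
      K_const \<Omega> V \<le> ennreal Cstar \<longrightarrow>
      ennreal (l2norm \<Omega> (\<lambda>x. wgrad \<Omega> u x - \<zeta>V x))
        \<le> ennreal (C * l2norm \<Omega> f) * (D_const \<Omega> a V + K_const \<Omega> V))"
proof -
  \<comment> \<open>The smallness condition \<open>L * K \<le> l / 2\<close> of
    \<open>galerkin_estimate\<close>, solved for K.\<close>
  define Cs where "Cs = lmin / (2 * lmax)"
  define C0 where "C0 = (1 + lmax / lmin) * (2 / lmin + 2 * lmax / lmin\<^sup>2) + lmax / lmin\<^sup>2"
  have lmax: "lmax > 0" using assms by simp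
  have Cs: "Cs > 0" using assms lmax by (simp add: Cs_def)
  have C0: "C0 > 0" unfolding C0_def using assms lmax by (intro add_pos_pos mult_pos_pos divide_pos_pos) auto
  show ?thesis
  proof (rule exI[of _ Cs], intro conjI allI impI Cs)
    fix \<Omega> :: "(real^'n) set" assume "bounded_C2_domain \<Omega>"
    then have \<Omega>: "open \<Omega>" "bounded \<Omega>" by (auto simp: bounded_C2_domain_def)
    then have m: "\<Omega> \<in> lmeasurable" by (intro lmeasurable_open)
    obtain R where R: "\<And>x. x \<in> \<Omega> \<Longrightarrow> norm x \<le> R" "0 \<le> R"
      using \<Omega>(2) bounded_pos less_imp_le by metis
    \<comment> \<open>\<open>C0\<close> is the constant of the Galerkin estimate, and
      \<open>2 * R\<close> is the Poincare constant that converts the norm of grad w into that of f.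
      The domain enters C through R alone.\<close>
    define C where "C = C0 * (1 + 2 * R)"
    have C: "C > 0" using C0 R(2) by (simp add: C_def)
    show "\<exists>C>0. \<forall>(a :: real^'n \<Rightarrow> real^'n^'n) (V :: (real^'n \<Rightarrow> real^'n) set)
        (f :: real^'n \<Rightarrow> real) (w :: real^'n \<Rightarrow> real) (u :: real^'n \<Rightarrow> real)
        (\<zeta>V :: real^'n \<Rightarrow> real^'n).
      Linf_matrix \<Omega> a \<and> (\<forall>x\<in>\<Omega>. transpose (a x) = a x) \<and> elliptic_with \<Omega> lmin lmax a \<and>
      findim_subspace \<Omega> V \<and>
      f \<in> L2 \<Omega> \<and> w \<in> H2 \<Omega> \<inter> H10 \<Omega> \<and> (AE x in lebesgue_on \<Omega>. - wlaplacian \<Omega> w x = f x) \<and>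
      u \<in> H10 \<Omega> \<and>
      (\<forall>\<phi>\<in>H10 \<Omega>. l2inner \<Omega> (wgrad \<Omega> \<phi>) (mult_field a (wgrad \<Omega> u))
                   = l2inner \<Omega> (wgrad \<Omega> \<phi>) (wgrad \<Omega> w)) \<and>
      \<zeta>V \<in> V \<and>
      (\<forall>\<eta>\<in>V. l2inner \<Omega> \<eta> (mult_field a \<zeta>V) = l2inner \<Omega> \<eta> (wgrad \<Omega> w)) \<and>
      K_const \<Omega> V \<le> ennreal Cs \<longrightarrow>
      ennreal (l2norm \<Omega> (\<lambda>x. wgrad \<Omega> u x - \<zeta>V x))
        \<le> ennreal (C * l2norm \<Omega> f) * (D_const \<Omega> a V + K_const \<Omega> V)"
    proof (intro exI[of _ C] conjI allI impI C, elim conjE IntE)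
      fix a :: "real^'n \<Rightarrow> real^'n^'n" and V :: "(real^'n \<Rightarrow> real^'n) set"
        and f w u :: "real^'n \<Rightarrow> real" and zV :: "real^'n \<Rightarrow> real^'n"
      assume a: "Linf_matrix \<Omega> a" and sym: "\<forall>x\<in>\<Omega>. transpose (a x) = a x"
        and ell: "elliptic_with \<Omega> lmin lmax a" and V: "findim_subspace \<Omega> V"
        and f: "f \<in> L2 \<Omega>" and w: "w \<in> H2 \<Omega>" "w \<in> H10 \<Omega>"
        and wf: "AE x in lebesgue_on \<Omega>. - wlaplacian \<Omega> w x = f x" and u: "u \<in> H10 \<Omega>"
        and weak: "\<forall>\<phi>\<in>H10 \<Omega>. l2inner \<Omega> (wgrad \<Omega> \<phi>) (mult_field a (wgrad \<Omega> u)) = l2inner \<Omega> (wgrad \<Omega> \<phi>) (wgrad \<Omega> w)"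
        and zV: "zV \<in> V" and gal: "\<forall>\<eta>\<in>V. l2inner \<Omega> \<eta> (mult_field a zV) = l2inner \<Omega> \<eta> (wgrad \<Omega> w)"
        and KC: "K_const \<Omega> V \<le> ennreal Cs"
      define gu where "gu = wgrad \<Omega> u"
      define gw where "gw = wgrad \<Omega> w"
      have guS: "gu \<in> pot_space \<Omega>" and gwS: "gw \<in> pot_space \<Omega>"
        using u w wgrad_pot_space by (auto simp: gu_def gw_def)
      have VL: "V \<subseteq> L2 \<Omega>" using V by (simp add: findim_subspace_def)
      have gL: "gu \<in> L2 \<Omega>" "gw \<in> L2 \<Omega>" "zV \<in> L2 \<Omega>"
        using guS gwS VL zV pot_space_subset_L2 by auto
      interpret E: elliptic_operator "L2 \<Omega>" "l2inner \<Omega>" "mult_field a" lmin lmax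
        by (rule elliptic_operator_mult_field[OF m a ell]) (use sym in auto)
      have wq: "l2inner \<Omega> q (mult_field a gu) = l2inner \<Omega> q gw" if "q \<in> pot_space \<Omega>" for q
        using orthogonal_pot_space_iff[OF \<Omega> E.A_H[OF gL(1)] gL(2)] weak that by (simp add: gu_def gw_def)
      define K where "K = enn2real (K_const \<Omega> V)"
      have "K_const \<Omega> V < top" using KC by (metis ennreal_less_top le_less_trans)
      then have K: "K_const \<Omega> V = ennreal K" "0 \<le> K" by (simp_all add: K_def)
      have "K \<le> Cs" using KC Cs by (simp add: K)
      then have K2: "lmax * K \<le> lmin / 2"
        using lmax mult_left_mono[of K Cs lmax] by (simp add: Cs_def)
      have lap: "wlaplacian \<Omega> w \<in> L2 \<Omega>" "l2norm \<Omega> (wlaplacian \<Omega> w) = l2norm \<Omega> f"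
      proof -
        show 1: "wlaplacian \<Omega> w \<in> L2 \<Omega>" using w by (intro wlaplacian_L2)
        have "AE x in lebesgue_on \<Omega>. wlaplacian \<Omega> w x = (- f) x"
          using wf by eventually_elim auto
        then have "l2norm \<Omega> (wlaplacian \<Omega> w) = l2norm \<Omega> (- f)"
          using 1 f by (intro l2norm_cong_AE) auto
        then show "l2norm \<Omega> (wlaplacian \<Omega> w) = l2norm \<Omega> f" by (simp add: l2norm_def)
      qed
      have wL: "w \<in> L2 \<Omega>" using w H1_imp_L2 H10_imp_H1 by blast
      \<comment> \<open>Green's formula with w as its own test function; the Poincare inequality and
        division by the norm of \<open>gw\<close> then give \<open>gw_le\<close>.\<close>
      have gw_sq: "(l2norm \<Omega> gw)\<^sup>2 \<le> l2norm \<Omega> w * l2norm \<Omega> f"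
        using green_formula[OF m w] L2.cauchy_schwarz[OF wL lap(1)] L2.nm_sq[OF gL(2)] lap(2)
        by (simp add: gw_def)
      also have "\<dots> \<le> (2 * R * l2norm \<Omega> gw) * l2norm \<Omega> f"
        using poincare_H10[OF m R w(2)] by (intro mult_right_mono) (auto simp: gw_def)
      finally have "l2norm \<Omega> gw * l2norm \<Omega> gw \<le> l2norm \<Omega> gw * (2 * R * l2norm \<Omega> f)"
        by (simp add: power2_eq_square mult_ac)
      then have gw_le: "l2norm \<Omega> gw \<le> 2 * R * l2norm \<Omega> f"
        using R(2) by (cases "l2norm \<Omega> gw = 0") (auto simp: mult_le_cancel_left dual_order.strict_iff_order)
      define t where "t = l2norm \<Omega> (gu - zV)"
      have t0: "0 \<le> t" by (simp add: t_def)
      have t_eq: "l2norm \<Omega> (\<lambda>x. wgrad \<Omega> u x - zV x) = t"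
        by (simp add: t_def gu_def fun_diff_def)
      have main: "ennreal t \<le> ennreal (C * l2norm \<Omega> f) * (D_const \<Omega> a V + ennreal K)"
      \<comment> \<open>If grad w vanishes, both solutions vanish. Otherwise f and w are nonzero, so
        that division by the norm of f is possible and w is admissible in the supremum.\<close>
      proof (cases "l2norm \<Omega> gw = 0")
        case True
        have "l2norm \<Omega> gu \<le> 0" "l2norm \<Omega> zV \<le> 0"
          using E.galerkin_bound[unfolded nm_l2inner, OF gL(1,2) wq[OF guS]]
            E.galerkin_bound[unfolded nm_l2inner, OF gL(3,2)] gal zV True by (simp_all add: gw_def)
        then have "t \<le> 0"
          using L2.nm_triangle_diff[OF gL(1) L2.H_0 gL(3)] L2.nm_minus_commute[OF L2.H_0 gL(3)] by (simp add: t_def)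
        then show ?thesis using t0 by simp
      next
        case False
        have "l2norm \<Omega> f \<noteq> 0"
        proof
          assume "l2norm \<Omega> f = 0"
          then have "l2norm \<Omega> gw \<le> 0" using gw_le by simp
          with False l2norm_nonneg[of \<Omega> gw] show False by linarith
        qed
        then have f_pos: "l2norm \<Omega> f > 0" using l2norm_nonneg[of \<Omega> f] by linarith
        have w_ne: "\<not> ae_zero \<Omega> w"
          using gw_sq False l2norm_eq_0_iff[OF wL] by (auto simp: ae_zero_def)
        define F where "F = C * l2norm \<Omega> f"
        have F: "F > 0" using C f_pos by (simp add: F_def)
        \<comment> \<open>The claim solved for \<open>D_const\<close>: as a lower bound it passes
          through both infima, and in the supremum it suffices to look at w. A negative left side
          becomes 0 in \<open>ennreal\<close>.\<close>
        have "ennreal (t / F - K) \<le> D_const \<Omega> a V"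
          unfolding D_const_def
        proof (rule INF_greatest, clarify)
          fix a' V' l L
          assume a': "Linf_matrix \<Omega> a'" and ell': "elliptic_with \<Omega> l L a'"
            and V': "findim_subspace \<Omega> V'" and div: "div_space \<Omega> a' V' = div_space \<Omega> a V"
          obtain u' where u': "weak_solution \<Omega> a' (wlaplacian \<Omega> w) u'"
            using weak_solution_exists[OF \<Omega> a' ell' w(1)] by blast
          obtain M where M: "\<And>k. k \<in> L2 \<Omega> \<Longrightarrow> mult_field a' k \<in> L2 \<Omega>" using mult_field_L2[OF a'] by metis
          define gu' where "gu' = wgrad \<Omega> u'"
          have u'H: "u' \<in> H10 \<Omega>" using u' by (simp add: weak_solution_def)
          have gu'L: "gu' \<in> L2 \<Omega>" using wgrad_L2[OF H10_imp_H1[OF u'H]] by (simp add: gu'_def)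
          have wq': "l2inner \<Omega> q (mult_field a' gu') = l2inner \<Omega> q gw" if "q \<in> pot_space \<Omega>" for q
            using orthogonal_pot_space_iff[OF \<Omega> M[OF gu'L] gL(2)] that u' green_formula[OF m w(1)]
            by (simp add: weak_solution_def gu'_def gw_def)
          have "ennreal (t / F - K) \<le> ennreal (l2norm \<Omega> (pot_part \<Omega> (mult_field a' (\<lambda>x. wgrad \<Omega> u' x - z' x)))
              / l2norm \<Omega> (wlaplacian \<Omega> w))" if z': "z' \<in> V'" for z'
          proof -
            have z'L: "z' \<in> L2 \<Omega>" using z' V' by (auto simp: findim_subspace_def)
            have "wdiv \<Omega> (mult_field a' z') \<in> div_space \<Omega> a V"
              using z' div by (auto simp: div_space_def)
            then obtain z where z: "z \<in> V" and zz': "wdiv \<Omega> (mult_field a z) = wdiv \<Omega> (mult_field a' z')"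
              by (auto simp: div_space_def)
            have zL: "z \<in> L2 \<Omega>" using z VL by auto
            have "l2inner \<Omega> (wgrad \<Omega> \<phi>) (mult_field a z) = l2inner \<Omega> (wgrad \<Omega> \<phi>) (mult_field a' z')"
              if "\<phi> \<in> H10 \<Omega>" for \<phi>
              using fun_cong[OF zz', of \<phi>] that by (simp add: wdiv_def)
            then have zq: "l2inner \<Omega> q (mult_field a z) = l2inner \<Omega> q (mult_field a' z')" if "q \<in> pot_space \<Omega>" for q
              using orthogonal_pot_space_iff[OF \<Omega> E.A_H[OF zL] M[OF z'L]] that by blast
            define r where "r = pot_part \<Omega> (mult_field a' (gu' - z'))"
            have diff': "mult_field a' (gu' - z') = mult_field a' gu' - mult_field a' z'"
              by (simp add: mult_field_def fun_eq_iff matrix_vector_mult_diff_distrib)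
            have kL: "mult_field a' (gu' - z') \<in> L2 \<Omega>" using M gu'L z'L by simp
            note P = pot_part_props[OF m kL, folded r_def]
            have rL: "r \<in> L2 \<Omega>" using P(1) pot_space_subset_L2 by auto
            have res: "l2inner \<Omega> (mult_field a (gu - z) - r) q = 0" if q: "q \<in> pot_space \<Omega>" for q
            proof -
              have qL: "q \<in> L2 \<Omega>" using q pot_space_subset_L2 by auto
              note mem = E.A_H[OF gL(1)] E.A_H[OF zL] M[OF gu'L] M[OF z'L] rL qL
              have "l2inner \<Omega> (mult_field a (gu - z) - r) q = l2inner \<Omega> (mult_field a' (gu' - z') - r) q"
                unfolding E.A_diff[OF gL(1) zL] diff'
                using mem wq[OF q] wq'[OF q] zq[OF q]
                by (simp add: L2.ip_diff L2.ip_commute[of _ \<Omega> q])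
              then show ?thesis using P(2)[OF q] by simp
            qed
            have "t \<le> C0 * (l2norm \<Omega> r + K * l2norm \<Omega> gw)"
              unfolding t_def C0_def
            proof (rule E.galerkin_estimate[unfolded nm_l2inner, where S="pot_space \<Omega>" and V=V and z=z])
              show "\<exists>p\<in>pot_space \<Omega>. (\<forall>q\<in>pot_space \<Omega>. l2inner \<Omega> (\<eta> - p) q = 0) \<and> l2norm \<Omega> (\<eta> - p) \<le> K * l2norm \<Omega> \<eta>"
                if "\<eta> \<in> V" for \<eta>
                using curl_part_le[OF m VL K that] pot_part_props[OF m, of \<eta>] that VL by blast
              show "x - y \<in> pot_space \<Omega>" if "x \<in> pot_space \<Omega>" "y \<in> pot_space \<Omega>" for x y
                using subspace_diff[OF subspace_pot_space[OF m]] that by blast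
            qed (use guS gwS pot_space_subset_L2 VL wq findim_subspace_diff[OF V] zV gal K K2 z P(1) res in
                \<open>auto simp: gw_def\<close>)
            also have "\<dots> \<le> C0 * (l2norm \<Omega> r + K * (2 * R * l2norm \<Omega> f))"
              using gw_le K C0 by (intro mult_left_mono add_left_mono) auto
            \<comment> \<open>Enlarged so that both terms share the factor
              \<open>1 + 2 * R\<close>.\<close>
            also have "\<dots> \<le> C0 * ((1 + 2 * R) * (l2norm \<Omega> r + K * l2norm \<Omega> f))"
              using C0 R(2) K(2) by (intro mult_left_mono) (auto simp: algebra_simps)
            also have "\<dots> = F * (l2norm \<Omega> r / l2norm \<Omega> f + K)"
              using f_pos by (simp add: F_def C_def field_simps)
            finally have "t / F - K \<le> l2norm \<Omega> r / l2norm \<Omega> f"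
              using F by (simp add: field_simps)
            then show ?thesis
              unfolding lap(2) r_def gu'_def fun_diff_def by (rule ennreal_leI)
          qed
          then show "ennreal (t / F - K) \<le> (SUP (w', u') \<in> {(w', u'). w' \<in> H2 \<Omega> \<inter> H10 \<Omega> \<and> \<not> ae_zero \<Omega> w' \<and>
                         weak_solution \<Omega> a' (wlaplacian \<Omega> w') u'}.
              INF \<zeta>'\<in>V'. ennreal (l2norm \<Omega> (pot_part \<Omega> (mult_field a' (\<lambda>x. wgrad \<Omega> u' x - \<zeta>' x)))
                / l2norm \<Omega> (wlaplacian \<Omega> w')))"
            using w w_ne u' by (intro SUP_upper2[of "(w, u')"]) (auto intro!: INF_greatest)
        qed
        then have "ennreal F * (ennreal (t / F - K) + ennreal K) \<le> ennreal F * (D_const \<Omega> a V + ennreal K)"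
          by (intro mult_left_mono add_right_mono) auto
        moreover have "ennreal t \<le> ennreal F * (ennreal (t / F - K) + ennreal K)"
        \<comment> \<open>Truncation at 0 loses nothing: if the difference is negative, the term
          with K alone already dominates t.\<close>
        proof (cases "0 \<le> t / F - K")
          case True
          have "ennreal F * (ennreal (t / F - K) + ennreal K) = ennreal F * ennreal (t / F - K + K)"
            by (subst ennreal_plus[OF True K(2)]) (rule refl)
          also have "\<dots> = ennreal (F * (t / F - K + K))"
            using F True K(2) by (intro ennreal_mult[symmetric]) auto
          also have "F * (t / F - K + K) = t" using F by simp
          finally show ?thesis by simp
        next
          case False
          then have "t \<le> F * K" using F by (simp add: field_simps)
          moreover have "ennreal (t / F - K) = 0" using False by (intro ennreal_neg) simp
          ultimately show ?thesis using F K(2) by (simp add: ennreal_leI flip: ennreal_mult)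
        qed
        ultimately show ?thesis unfolding F_def by (rule order_trans[rotated])
      qed
      then show "ennreal (l2norm \<Omega> (\<lambda>x. wgrad \<Omega> u x - zV x))
          \<le> ennreal (C * l2norm \<Omega> f) * (D_const \<Omega> a V + K_const \<Omega> V)"
        unfolding t_eq K(1) .
    qed
  qed
qed

end
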